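(* Let $a\ge 0$ and $\gamma>0$ be given, and let $A\in\mathbb{R}^{n\times n}$, $B_1\in\mathbb{R}^{n\times m}$, $B_2\in\mathbb{R}^{n\times n_u}$, $C_1\in\mathbb{R}^{n_z\times n}$, $C_2\in\mathbb{R}^{n_y\times n}$, $D_{11}\in\mathbb{R}^{n_z\times m}$, $D_{12}\in\mathbb{R}^{n_z\times n_u}$ be the data of the discrete-time plant $$x(t+1)=Ax(t)+B_1w(t)+B_2u(t),\quad z(t)=C_1x(t)+D_{11}w(t)+D_{12}u(t),\quad y(t)=C_2x(t).$$ Let $W$ be a matrix whose columns form a basis of the null space of $\begin{bmatrix} B_2^T & D_{12}^T\end{bmatrix}$ and let $V$ be a matrix whose columns form a basis of the null space of $\begin{bmatrix} C_2 & 0\end{bmatrix}\in\mathbb{R}^{n_y\times(n+m)}$. Suppose that there exist symmetric matrices $X>0$ and $Y>0$ in $\mathbb{R}^{n\times n}$ and a scalar $\eta^2$ such that, with $$\Phi_X:=\eta^2 I-B_1^TXB_1-D_{11}^TD_{11},\qquad \Phi_Y:=\eta^2 I-C_1YC_1^T-D_{11}D_{11}^T,$$ the following four conditions hold: $$V^T\begin{bmatrix} -X+A^TXA+C_1^TC_1 & A^TXB_1+C_1^TD_{11}\\ B_1^TXA+D_{11}^TC_1 & -\Phi_X\end{bmatrix}V<0,$$ $$W^T\begin{bmatrix} -Y+AYA^T+B_1B_1^T & AYC_1^T+B_1D_{11}^T\\ C_1YA^T+D_{11}B_1^T & -\Phi_Y\end{bmatrix}W<0,$$ $$\eta^2-\left(\det\Phi_X\right)^{1/m}e^{-2a/m}<\gamma^2,$$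 $$XY=\eta^2 I.$$ Then there exists a static output feedback gain $K\in\mathbb{R}^{n_u\times n_y}$ such that the closed loop system $\mathcal{F}_{c\ell}(K)$ obtained with $u(t)=Ky(t)$, namely $$x(t+1)=(A+B_2KC_2)x(t)+B_1w(t),\qquad z(t)=(C_1+D_{12}KC_2)x(t)+D_{11}w(t),$$ is stable and its $a$-anisotropic norm (from $w$ to $z$) satisfies $|||\mathcal{F}_{c\ell}(K)|||_a<\gamma$.
   Context: For a symmetric matrix $P$, $P>0$ ($P<0$) means positive (negative) definite. If a null space is trivial, so that the corresponding matrix $W$ or $V$ has no columns, the corresponding inequality is vacuous. A discrete-time linear system $x(t+1)=Ax(t)+Bw(t)$ with output $Cx(t)+Dw(t)$ is called stable if all eigenvalues of $A$ lie in the open unit disc. $H_2$ norm. For a stable system $F$ with output $y$, $\|F\|_2=\left[\lim_{\ell\to\infty}\frac1\ell\sum_{t=0}^{\ell}E[y^T(t)y(t)]\right]^{1/2}$, where $y$ is the output with zero initial condition generated by a sequence $w(t)$ of independent random vectors with $E[w(t)]=0$, $E[w(t)w^T(t)]=I_m$. Equivalently $\|F\|_2=(\mathrm{Tr}(B^TXB+D^TD))^{1/2}$, where $X\ge 0$ solves $X=A^TXA+C^TC$. Mean anisotropy. Let $G$ be a stable filter with $m$ inputs and $m$ outputs and (arbitrary) finite order $n_f$, $x_f(t+1)=A_fx_f(t)+B_fv(t)$, $w(t)=C_fx_f(t)+D_fv(t)$, driven by independent $m$-dimensional Gaussian white noises $v(t)$ with $E[v(t)]=0$ and $E[v(t)v^T(t)]=I_m$.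 The mean anisotropy of $G$ is $$\bar A(G)=-\frac12\ln\det\left(\frac{m\,E[\tilde w(0)\tilde w(0)^T]}{\mathrm{Tr}(E[w(0)w(0)^T])}\right),$$ where $w$ is the stationary Gaussian output sequence generated by $G$ and $\tilde w(0):=w(0)-E[w(0)\mid w(k),k<0]$ is the one-step prediction error. Anisotropic norm. For a stable system $F$ with $m$ inputs and $a\ge0$, the $a$-anisotropic norm is $$|||F|||_a=\sup_{G\in\mathcal{G}_a}\frac{\|FG\|_2}{\|G\|_2},$$ where $\mathcal{G}_a$ is the set of all stable filters $G$ with $m$ inputs and $m$ outputs and (arbitrary) finite order $n_f$, of the form $x_f(t+1)=A_fx_f(t)+B_fv(t)$, $w(t)=C_fx_f(t)+D_fv(t)$, driven by independent $m$-dimensional Gaussian white noises $v(t)$ with $E[v(t)]=0$ and $E[v(t)v^T(t)]=I_m$, with $\bar A(G)\le a$, and $FG$ is the cascade in which the output of $G$ is the input of $F$. *)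

theory Defs
  imports
    "HOL-Probability.Probability"
    "Jordan_Normal_Form.Char_Poly"
    "Jordan_Normal_Form.Matrix_Kernel"
begin

(* Vectors and matrices are the carrier-based ones of Jordan_Normal_Form: the order of a filter
   ranges over all natural numbers inside one formula, so it cannot be a type. *)
unbundle no vec_syntax
unbundle no inner_syntax

hide_const (open) Finite_Cartesian_Product.vec Determinants.det Finite_Cartesian_Product.mat
  Finite_Cartesian_Product.transpose Determinants.trace


section \<open>Matrices\<close>

definition trace_mat :: "real mat \<Rightarrow> real" where
  "trace_mat M = (\<Sum>i<dim_row M. M $$ (i, i))"

definition append_cols :: "real mat \<Rightarrow> real mat \<Rightarrow> real mat" (infixr \<open>@\<^sub>c\<close> 65) where
  "M @\<^sub>c N = four_block_mat M N (0\<^sub>m 0 (dim_col M)) (0\<^sub>m 0 (dim_col N))"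

definition symmetric_matrix :: "real mat \<Rightarrow> bool" where
  "symmetric_matrix M \<longleftrightarrow> square_mat M \<and> transpose_mat M = M"

(* Both notions are vacuous for the 0 x 0 matrix. *)
definition pos_definite :: "real mat \<Rightarrow> bool" where
  "pos_definite M \<longleftrightarrow> symmetric_matrix M \<and>
     (\<forall>x \<in> carrier_vec (dim_row M). x \<noteq> 0\<^sub>v (dim_row M) \<longrightarrow> scalar_prod x (M *\<^sub>v x) > 0)"

definition neg_definite :: "real mat \<Rightarrow> bool" where
  "neg_definite M \<longleftrightarrow> symmetric_matrix M \<and>
     (\<forall>x \<in> carrier_vec (dim_row M). x \<noteq> 0\<^sub>v (dim_row M) \<longrightarrow> scalar_prod x (M *\<^sub>v x) < 0)"

(* Distinctness is needed because the basis is the list of columns, not just their set.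
   If the null space is trivial then V has no columns. *)
definition null_space_basis_mat :: "real mat \<Rightarrow> real mat \<Rightarrow> bool" where
  "null_space_basis_mat N V \<longleftrightarrow>
     dim_row V = dim_col N \<and> distinct (cols V) \<and> kernel.basis (dim_col N) N (set (cols V))"


section \<open>Discrete-time linear systems\<close>

(* x(t+1) = A x(t) + B w(t),  y(t) = C x(t) + D w(t) *)
record lti =
  sysA :: "real mat"
  sysB :: "real mat"
  sysC :: "real mat"
  sysD :: "real mat"

definition is_lti :: "nat \<Rightarrow> nat \<Rightarrow> nat \<Rightarrow> lti \<Rightarrow> bool" where
  "is_lti n m p F \<longleftrightarrow> sysA F \<in> carrier_mat n n \<and> sysB F \<in> carrier_mat n m \<and>
     sysC F \<in> carrier_mat p n \<and> sysD F \<in> carrier_mat p m"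

definition stable_system :: "lti \<Rightarrow> bool" where
  "stable_system F \<longleftrightarrow> (\<forall>z. eigenvalue (map_mat complex_of_real (sysA F)) z \<longrightarrow> cmod z < 1)"

(* The series connection F G, with state (x_F, x_G): the output of G is the input of F. *)
definition cascade :: "lti \<Rightarrow> lti \<Rightarrow> lti" where
  "cascade F G = \<lparr>
     sysA = four_block_mat (sysA F) (sysB F * sysC G)
                           (0\<^sub>m (dim_row (sysA G)) (dim_col (sysA F))) (sysA G),
     sysB = (sysB F * sysD G) @\<^sub>r sysB G,
     sysC = sysC F @\<^sub>c (sysD F * sysC G),
     sysD = sysD F * sysD G \<rparr>"

primrec zero_init_state :: "lti \<Rightarrow> (nat \<Rightarrow> real vec) \<Rightarrow> nat \<Rightarrow> real vec" where
  "zero_init_state F w 0 = 0\<^sub>v (dim_row (sysA F))"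
| "zero_init_state F w (Suc t) = sysA F *\<^sub>v zero_init_state F w t + sysB F *\<^sub>v w t"

definition zero_init_output :: "lti \<Rightarrow> (nat \<Rightarrow> real vec) \<Rightarrow> nat \<Rightarrow> real vec" where
  "zero_init_output F w t = sysC F *\<^sub>v zero_init_state F w t + sysD F *\<^sub>v w t"


section \<open>White noise and the H2 norm\<close>

(* The canonical two-sided standard Gaussian white noise: independent standard normal coordinates
   indexed by (time, component). *)
definition noise_space :: "(int \<times> nat \<Rightarrow> real) measure" where
  "noise_space = (\<Pi>\<^sub>M k\<in>UNIV. std_normal_distribution)"

definition white_noise :: "nat \<Rightarrow> int \<Rightarrow> (int \<times> nat \<Rightarrow> real) \<Rightarrow> real vec" where
  "white_noise m t \<omega> = Matrix.vec m (\<lambda>i. \<omega> (t, i))"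

(* Only the mean and covariance of the input matter for the value, so the canonical Gaussian noise
   stands for any sequence of independent vectors with zero mean and identity covariance. *)
definition h2_norm :: "lti \<Rightarrow> real" where
  "h2_norm F = sqrt (lim (\<lambda>l. 1 / real l * (\<Sum>t=0..l.
     integral\<^sup>L noise_space (\<lambda>\<omega>.
       let y = zero_init_output F (\<lambda>s. white_noise (dim_col (sysD F)) (int s) \<omega>) t
       in scalar_prod y y))))"


section \<open>Mean anisotropy\<close>

(* The stationary solution x(t) = (SUM k. A^k B v(t-1-k)); for a stable system the series
   converges almost surely. *)
definition stationary_state :: "lti \<Rightarrow> int \<Rightarrow> (int \<times> nat \<Rightarrow> real) \<Rightarrow> real vec" where
  "stationary_state G t \<omega> = Matrix.vec (dim_row (sysA G)) (\<lambda>i. \<Sum>k.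
     ((sysA G ^\<^sub>m k) *\<^sub>v (sysB G *\<^sub>v white_noise (dim_col (sysD G)) (t - 1 - int k) \<omega>)) $ i)"

definition stationary_output :: "lti \<Rightarrow> int \<Rightarrow> (int \<times> nat \<Rightarrow> real) \<Rightarrow> real vec" where
  "stationary_output G t \<omega> =
     sysC G *\<^sub>v stationary_state G t \<omega> + sysD G *\<^sub>v white_noise (dim_col (sysD G)) t \<omega>"

definition past_algebra :: "lti \<Rightarrow> (int \<times> nat \<Rightarrow> real) measure" where
  "past_algebra G = sigma (space noise_space)
     {(\<lambda>\<omega>. stationary_output G k \<omega> $ i) -` S \<inter> space noise_space | k i S.
        k < 0 \<and> i < dim_row (sysD G) \<and> S \<in> sets borel}"

definition prediction_error :: "lti \<Rightarrow> (int \<times> nat \<Rightarrow> real) \<Rightarrow> real vec" where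
  "prediction_error G \<omega> = Matrix.vec (dim_row (sysD G)) (\<lambda>i. stationary_output G 0 \<omega> $ i -
     real_cond_exp noise_space (past_algebra G) (\<lambda>\<omega>. stationary_output G 0 \<omega> $ i) \<omega>)"

definition second_moment :: "nat \<Rightarrow> ((int \<times> nat \<Rightarrow> real) \<Rightarrow> real vec) \<Rightarrow> real mat" where
  "second_moment m u =
     Matrix.mat m m (\<lambda>(i, j). integral\<^sup>L noise_space (\<lambda>\<omega>. u \<omega> $ i * u \<omega> $ j))"

(* Extended-real valued, with -ln 0 = +infinity, since ln 0 = 0 for the real logarithm.  A filter
   with zero output has infinite mean anisotropy (division by the zero trace gives a zero matrix). *)
definition mean_anisotropy :: "lti \<Rightarrow> ereal" where
  "mean_anisotropy G =
    (let m = dim_row (sysD G);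
         d = Determinant.det ((real m / trace_mat (second_moment m (stationary_output G 0)))
                  \<cdot>\<^sub>m second_moment m (prediction_error G))
     in if d > 0 then ereal (- (1 / 2) * ln d) else \<infinity>)"


section \<open>Anisotropic norm\<close>

definition shaping_filters :: "nat \<Rightarrow> real \<Rightarrow> lti set" where
  "shaping_filters m a =
     {G. (\<exists>nf. is_lti nf m m G) \<and> stable_system G \<and> mean_anisotropy G \<le> ereal a}"

definition anisotropic_norm :: "real \<Rightarrow> lti \<Rightarrow> ereal" where
  "anisotropic_norm a F =
     (SUP G \<in> shaping_filters (dim_col (sysD F)) a. ereal (h2_norm (cascade F G) / h2_norm G))"


section \<open>Static output feedback\<close>

definition closed_loop ::
  "real mat \<Rightarrow> real mat \<Rightarrow> real mat \<Rightarrow> real mat \<Rightarrow> real mat \<Rightarrow> real mat \<Rightarrow> real mat \<Rightarrow> real mat \<Rightarrow> lti" where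
  "closed_loop A B1 B2 C1 C2 D11 D12 K = \<lparr>
     sysA = A + B2 * K * C2,
     sysB = B1,
     sysC = C1 + D12 * K * C2,
     sysD = D11 \<rparr>"

end

theory Submission
  imports Defs "Jordan_Normal_Form.Spectral_Radius"
begin

text \<open>The proof has an algebraic and a probabilistic half, which meet in one strict dissipation
inequality for the closed loop.

Put \<open>M = [A, B1; C1, D11]\<close>, \<open>U = [B2; D12]\<close>, \<open>R = [C2, 0]\<close>, \<open>P = diag(X, I)\<close> and
\<open>Q = diag(X, \<eta>\<^sup>2 I)\<close>. The closed loop with gain \<open>K\<close> has system matrix \<open>M + U K R\<close>, and the
algebraic half finds \<open>K\<close> such that this matrix is a strict contraction from the norm of \<open>Q\<close> to
the norm of \<open>P\<close>. On the kernel of \<open>R\<close> the gain has no influence, and the first matrix inequality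
says that \<open>M\<close> contracts there. By \<open>X Y = \<eta>\<^sup>2 I\<close> the inverses of \<open>P\<close> and \<open>Q\<close> are built from \<open>Y\<close>,
and the second matrix inequality says that the transpose of \<open>M\<close> contracts, in the dual norms, on
the kernel of the transpose of \<open>U\<close>, again a space on which the gain has no influence. A strict
form of Parrott's theorem (\<open>static_feedback_contraction\<close>) states that these two necessary
conditions are sufficient; \<open>static_output_feedback_exists\<close> applies it to the given data.

The contraction inequality, read at a state \<open>x\<close> and an input \<open>w\<close>, says that the gap
\<open>x\<^sup>T X x + \<eta>\<^sup>2 |w|\<^sup>2 - x\<^sub>+\<^sup>T X x\<^sub>+ - |z|\<^sup>2\<close> is a positive definite form in \<open>(x, w)\<close>, where
\<open>x\<^sub>+\<close> is the next state and \<open>z\<close> the output. For \<open>w = 0\<close> it is a Lyapunov inequality, so the closed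
loop is stable (\<open>lyapunov_stable\<close>). Now let a filter \<open>G\<close> drive the closed loop \<open>F\<close>. In the
stationary regime \<open>x\<close> and \<open>x\<^sub>+\<close> have the same covariance, so the expected gap is
\<open>\<eta>\<^sup>2 E|w|\<^sup>2 - E|z|\<^sup>2\<close>. Split \<open>w = q + e\<close> into the one-step prediction and its error. Since \<open>e\<close>
is orthogonal to the past of \<open>w\<close>, and both \<open>q\<close> and \<open>x\<close> are determined by that past, all cross
terms vanish in expectation; the value of the gap at \<open>(x, q)\<close> is nonnegative, and its value
at \<open>(0, e)\<close> is \<open>e\<^sup>T \<Phi> e\<close>. Hence the squared H2 norm of the cascade is at most
\<open>\<eta>\<^sup>2\<close> times that of \<open>G\<close> minus \<open>tr(\<Phi> \<Sigma>)\<close>, where \<open>\<Sigma>\<close> is the covariance of \<open>e\<close>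
(\<open>cascade_h2_bound\<close>).

Finally \<open>tr(\<Phi> \<Sigma>) \<ge> m (det \<Phi> det \<Sigma>)\<close> to the power \<open>1/m\<close> in the second factor, which is the
inequality between arithmetic and geometric mean combined with Hadamard's inequality
(\<open>trace_mult_ge_det\<close>), and mean anisotropy at most \<open>a\<close> means that \<open>det \<Sigma>\<close> is at least
\<open>exp(-2a)\<close> times the \<open>m\<close>-th power of the mean variance of \<open>w\<close>. So the squared gain of every
admissible filter is at most the left-hand side of the determinant condition
(\<open>anisotropic_bounded_real\<close>), a bound below \<open>\<gamma>\<^sup>2\<close> that is the same for all filters; this
uniformity keeps the inequality strict in the supremum.\<close>

section \<open>Matrices, vectors and kernels\<close>

lemma carrier_mat_iff: "A \<in> carrier_mat r c \<longleftrightarrow> dim_row A = r \<and> dim_col A = c"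
  by auto

text \<open>The conditional rules that read off a dimension from a membership fact have to guess that
dimension, and they loop once membership is itself rewritten to equations between dimensions.
The latter form is used throughout, because the side conditions below are then decided by
rewriting.\<close>

declare carrier_vecD [simp del] carrier_matD [simp del] carrier_dim_vec [simp] carrier_mat_iff [simp]

text \<open>The distributive and associative laws in a form whose side conditions are equations between
dimensions of the objects on the left-hand side, so that conditional rewriting never has to
invent a dimension.\<close>

lemma mat_vec_dim_rules:
  fixes A B :: "'a :: field mat" and u v w :: "'a vec"
  shows mult_mult_vec: "dim_col A = dim_row B \<Longrightarrow> dim_vec v = dim_col B \<Longrightarrow> (A * B) *\<^sub>v v = A *\<^sub>v (B *\<^sub>v v)"
    and mult_vec_add: "dim_vec u = dim_col A \<Longrightarrow> dim_vec v = dim_col A \<Longrightarrow> A *\<^sub>v (u + v) = A *\<^sub>v u + A *\<^sub>v v"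
    and mult_vec_diff: "dim_vec u = dim_col A \<Longrightarrow> dim_vec v = dim_col A \<Longrightarrow> A *\<^sub>v (u - v) = A *\<^sub>v u - A *\<^sub>v v"
    and add_mult_vec: "dim_row B = dim_row A \<Longrightarrow> dim_col B = dim_col A \<Longrightarrow> dim_vec v = dim_col A \<Longrightarrow> (A + B) *\<^sub>v v = A *\<^sub>v v + B *\<^sub>v v"
    and diff_mult_vec: "dim_row B = dim_row A \<Longrightarrow> dim_col B = dim_col A \<Longrightarrow> dim_vec v = dim_col A \<Longrightarrow> (A - B) *\<^sub>v v = A *\<^sub>v v - B *\<^sub>v v"
    and mult_smult_vec: "dim_vec v = dim_col A \<Longrightarrow> A *\<^sub>v (k \<cdot>\<^sub>v v) = k \<cdot>\<^sub>v (A *\<^sub>v v)"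
    and smult_mult_vec: "dim_vec v = dim_col A \<Longrightarrow> (k \<cdot>\<^sub>m A) *\<^sub>v v = k \<cdot>\<^sub>v (A *\<^sub>v v)"
    and zero_mult_vec: "dim_vec v = c \<Longrightarrow> 0\<^sub>m r c *\<^sub>v v = 0\<^sub>v r"
    and one_mult_vec: "dim_vec v = c \<Longrightarrow> 1\<^sub>m c *\<^sub>v v = v"
    and mult_zero_vec: "dim_col A = c \<Longrightarrow> A *\<^sub>v 0\<^sub>v c = 0\<^sub>v (dim_row A)"
proof -
  show "dim_col A = dim_row B \<Longrightarrow> dim_vec v = dim_col B \<Longrightarrow> (A * B) *\<^sub>v v = A *\<^sub>v (B *\<^sub>v v)"
    by (rule assoc_mult_mat_vec[of A "dim_row A" "dim_row B" B "dim_col B"]) simp_all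
  show "dim_vec u = dim_col A \<Longrightarrow> dim_vec v = dim_col A \<Longrightarrow> A *\<^sub>v (u + v) = A *\<^sub>v u + A *\<^sub>v v"
    by (rule mult_add_distrib_mat_vec[of A "dim_row A" "dim_col A"]) simp_all
  show "dim_vec u = dim_col A \<Longrightarrow> dim_vec v = dim_col A \<Longrightarrow> A *\<^sub>v (u - v) = A *\<^sub>v u - A *\<^sub>v v"
    by (rule mult_minus_distrib_mat_vec[of A "dim_row A" "dim_col A"]) simp_all
  show "dim_row B = dim_row A \<Longrightarrow> dim_col B = dim_col A \<Longrightarrow> dim_vec v = dim_col A \<Longrightarrow> (A + B) *\<^sub>v v = A *\<^sub>v v + B *\<^sub>v v"
    by (rule add_mult_distrib_mat_vec[of A "dim_row A" "dim_col A"]) simp_all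
  show "dim_row B = dim_row A \<Longrightarrow> dim_col B = dim_col A \<Longrightarrow> dim_vec v = dim_col A \<Longrightarrow> (A - B) *\<^sub>v v = A *\<^sub>v v - B *\<^sub>v v"
    by (rule minus_mult_distrib_mat_vec[of A "dim_row A" "dim_col A"]) simp_all
  show "dim_vec v = dim_col A \<Longrightarrow> A *\<^sub>v (k \<cdot>\<^sub>v v) = k \<cdot>\<^sub>v (A *\<^sub>v v)"
    by (rule mult_mat_vec[of A "dim_row A" "dim_col A"]) (simp_all add: carrier_vecI)
  show "(k \<cdot>\<^sub>m A) *\<^sub>v v = k \<cdot>\<^sub>v (A *\<^sub>v v)" if "dim_vec v = dim_col A"
  proof (rule eq_vecI)
    fix i assume i: "i < dim_vec (k \<cdot>\<^sub>v (A *\<^sub>v v))"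
    have "Matrix.row (k \<cdot>\<^sub>m A) i = k \<cdot>\<^sub>v Matrix.row A i" using i by (intro eq_vecI) auto
    then show "((k \<cdot>\<^sub>m A) *\<^sub>v v) $ i = (k \<cdot>\<^sub>v (A *\<^sub>v v)) $ i" using i that by simp
  qed simp
  show "dim_vec v = c \<Longrightarrow> 1\<^sub>m c *\<^sub>v v = v"
    by (rule one_mult_mat_vec) (simp add: carrier_vecI)
  show "0\<^sub>m r c *\<^sub>v v = 0\<^sub>v r" if "dim_vec v = c"
  proof (rule eq_vecI)
    fix i assume "i < dim_vec (0\<^sub>v r :: 'a vec)"
    then show "(0\<^sub>m r c *\<^sub>v v) $ i = 0\<^sub>v r $ i"
      using that unfolding mult_mat_vec_def scalar_prod_def by simp
  qed simp
  show "A *\<^sub>v 0\<^sub>v c = 0\<^sub>v (dim_row A)" if "dim_col A = c"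
  proof (rule eq_vecI)
    fix i assume "i < dim_vec (0\<^sub>v (dim_row A) :: 'a vec)"
    then show "(A *\<^sub>v 0\<^sub>v c) $ i = 0\<^sub>v (dim_row A) $ i"
      unfolding mult_mat_vec_def scalar_prod_def by simp
  qed simp
qed

lemma scalar_prod_dim_rules:
  fixes u v w :: "'a :: field vec"
  shows scalar_prod_add_right: "dim_vec u = dim_vec w \<Longrightarrow> dim_vec v = dim_vec w \<Longrightarrow> u \<bullet> (v + w) = u \<bullet> v + u \<bullet> w"
    and scalar_prod_add_left: "dim_vec u = dim_vec w \<Longrightarrow> dim_vec v = dim_vec w \<Longrightarrow> (u + v) \<bullet> w = u \<bullet> w + v \<bullet> w"
    and scalar_prod_diff_right: "dim_vec u = dim_vec w \<Longrightarrow> dim_vec v = dim_vec w \<Longrightarrow> u \<bullet> (v - w) = u \<bullet> v - u \<bullet> w"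
    and scalar_prod_diff_left: "dim_vec u = dim_vec w \<Longrightarrow> dim_vec v = dim_vec w \<Longrightarrow> (u - v) \<bullet> w = u \<bullet> w - v \<bullet> w"
    and scalar_prod_zero_left: "dim_vec u = d \<Longrightarrow> 0\<^sub>v d \<bullet> u = 0"
    and scalar_prod_zero_right: "dim_vec u = d \<Longrightarrow> u \<bullet> 0\<^sub>v d = 0"
    and scalar_prod_smult: "dim_vec u = dim_vec v \<Longrightarrow> u \<bullet> (k \<cdot>\<^sub>v v) = k * (u \<bullet> v)"
      "dim_vec u = dim_vec v \<Longrightarrow> (k \<cdot>\<^sub>v u) \<bullet> v = k * (u \<bullet> v)"
  by (simp_all add: scalar_prod_def distrib_left distrib_right left_diff_distrib right_diff_distrib
      sum.distrib sum_distrib_left sum_subtractf mult_ac)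

lemma scalar_prod_commute:
  fixes u v :: "'a :: field vec"
  shows "dim_vec u = dim_vec v \<Longrightarrow> u \<bullet> v = v \<bullet> u"
  by (simp add: scalar_prod_def mult.commute)

lemma scalar_prod_transpose:
  fixes u v :: "'a :: field vec"
  assumes "dim_vec u = dim_row A" "dim_vec v = dim_col A"
  shows "(transpose_mat A *\<^sub>v u) \<bullet> v = u \<bullet> (A *\<^sub>v v)"
  using assms by (intro transpose_vec_mult_scalar[of A "dim_row A" "dim_col A"]) simp_all

lemma transpose_mult_dim:
  fixes A B :: "'a :: field mat"
  shows "dim_col A = dim_row B \<Longrightarrow> transpose_mat (A * B) = transpose_mat B * transpose_mat A"
  by (intro transpose_mult[of A "dim_row A" "dim_col A"]) simp_all

lemma mult_assoc_dim:
  fixes A B C :: "'a :: field mat"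
  shows "dim_col A = dim_row B \<Longrightarrow> dim_col B = dim_row C \<Longrightarrow> (A * B) * C = A * (B * C)"
  by (intro assoc_mult_mat[of A "dim_row A" "dim_col A" B "dim_row C" C "dim_col C"]) simp_all

lemmas dim_rules = mat_vec_dim_rules scalar_prod_dim_rules

lemma mat_eq_by_vecI:
  fixes A B :: "'a :: field mat"
  assumes "A \<in> carrier_mat r c" "B \<in> carrier_mat r c"
    and "\<And>x. x \<in> carrier_vec c \<Longrightarrow> A *\<^sub>v x = B *\<^sub>v x"
  shows "A = B"
proof (rule eq_matI)
  fix i j assume "i < dim_row B" "j < dim_col B"
  then show "A $$ (i, j) = B $$ (i, j)"
    using arg_cong[OF assms(3)[of "unit_vec c j"], of "\<lambda>v. v $ i"] assms(1,2)
    by auto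
qed (use assms in auto)

text \<open>A kernel basis is used only as an injective parametrisation of the kernel by coordinate vectors,
including the case of a trivial kernel, where the coordinate vectors have length zero.\<close>

lemma null_space_basis_matD:
  assumes V: "null_space_basis_mat N V" and N: "N \<in> carrier_mat r c"
  shows "V \<in> carrier_mat c (dim_col V)"
    and "a \<in> carrier_vec (dim_col V) \<Longrightarrow> N *\<^sub>v (V *\<^sub>v a) = 0\<^sub>v r"
    and "x \<in> carrier_vec c \<Longrightarrow> N *\<^sub>v x = 0\<^sub>v r \<Longrightarrow> \<exists>a \<in> carrier_vec (dim_col V). x = V *\<^sub>v a"
    and "a \<in> carrier_vec (dim_col V) \<Longrightarrow> V *\<^sub>v a = 0\<^sub>v c \<Longrightarrow> a = 0\<^sub>v (dim_col V)"
proof -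
  interpret kernel r c N by unfold_locales (rule N)
  show V1: "V \<in> carrier_mat c (dim_col V)"
    using V N unfolding null_space_basis_mat_def by auto
  have dist: "distinct (cols V)" and bas: "basis (set (cols V))"
    using V N unfolding null_space_basis_mat_def by auto
  have sub: "set (cols V) \<subseteq> mat_kernel N" and ind: "\<not> NC.lin_dep (set (cols V))"
    and gen: "NC.span (set (cols V)) = mat_kernel N"
    using bas span_same lindep_same unfolding Ker.basis_def by auto
  have subc: "set (cols V) \<subseteq> carrier_vec c" using sub mat_kernel[OF N] by auto
  have moc: "mat_of_cols c (cols V) = V"
    using V1 by (metis carrier_matD(1) mat_of_cols_cols)
  have comb: "NC.lincomb_list f (cols V) = V *\<^sub>v vec (dim_col V) f" for f
    by (subst NC.lincomb_list_as_mat_mult) (use subc in \<open>auto simp: moc\<close>)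
  have Vmem: "V *\<^sub>v a \<in> mat_kernel N" if a: "a \<in> carrier_vec (dim_col V)" for a
  proof -
    have "vec (dim_col V) (\<lambda>i. a $ i) = a" using a by auto
    then have "V *\<^sub>v a = NC.lincomb_list (\<lambda>i. a $ i) (cols V)" by (simp add: comb)
    then have "V *\<^sub>v a \<in> NC.span_list (cols V)" unfolding NC.span_list_def by auto
    then show ?thesis using NC.span_list_as_span[OF subc] gen by auto
  qed
  then show "a \<in> carrier_vec (dim_col V) \<Longrightarrow> N *\<^sub>v (V *\<^sub>v a) = 0\<^sub>v r"
    using mat_kernelD[OF N] by auto
  show "\<exists>a \<in> carrier_vec (dim_col V). x = V *\<^sub>v a" if x: "x \<in> carrier_vec c" "N *\<^sub>v x = 0\<^sub>v r"
  proof -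
    have "x \<in> NC.span_list (cols V)"
      using mat_kernelI[OF N x] gen NC.span_list_as_span[OF subc] by auto
    then show ?thesis unfolding NC.span_list_def comb by auto
  qed
  show "a = 0\<^sub>v (dim_col V)" if a: "a \<in> carrier_vec (dim_col V)" and Va: "V *\<^sub>v a = 0\<^sub>v c"
  proof (rule ccontr)
    assume "a \<noteq> 0\<^sub>v (dim_col V)"
    then obtain i where i: "i < dim_col V" "a $ i \<noteq> 0" using a by (metis carrier_vecD eq_vecI index_zero_vec)
    define f where "f v = a $ (THE j. j < dim_col V \<and> cols V ! j = v)" for v
    have f: "f (cols V ! j) = a $ j" if j: "j < dim_col V" for j
    proof -
      have "(THE k. k < dim_col V \<and> cols V ! k = cols V ! j) = j"
        using j dist by (intro the_equality) (auto simp del: cols_nth simp: nth_eq_iff_index_eq)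
      then show ?thesis by (simp add: f_def)
    qed
    have "vec (dim_col V) (\<lambda>i. f (cols V ! i)) = a" using a f by auto
    then have "NC.lincomb f (set (cols V)) = 0\<^sub>v c"
      using NC.lincomb_as_lincomb_list_distinct[OF subc dist, of f] Va by (simp add: comb)
    moreover have "f (cols V ! i) \<noteq> 0" "cols V ! i \<in> set (cols V)" using f i by (auto simp del: cols_nth)
    ultimately have "NC.lin_dep (set (cols V))"
      unfolding NC.lin_dep_def
      by (intro exI[of _ "set (cols V)"] exI[of _ f] exI[of _ "cols V ! i"])
         (auto simp: class_ring_simps simp del: cols_nth)
    then show False using ind by simp
  qed
qed

lemma scalar_prod_self_pos:
  fixes x :: "real vec"
  assumes "x \<in> carrier_vec n"
  shows "0 \<le> x \<bullet> x" and "x \<noteq> 0\<^sub>v n \<Longrightarrow> 0 < x \<bullet> x"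
proof -
  show "0 \<le> x \<bullet> x" unfolding scalar_prod_def by (simp add: sum_nonneg)
  assume "x \<noteq> 0\<^sub>v n"
  then obtain i where "i < n" "x $ i \<noteq> 0"
    using assms by (metis carrier_vecD eq_vecI index_zero_vec)
  then show "0 < x \<bullet> x"
    unfolding scalar_prod_def using assms
    by (intro sum_pos2[of _ i]) (auto simp: zero_less_mult_iff)
qed

lemma invertible_of_positive:
  fixes A :: "real mat"
  assumes A: "A \<in> carrier_mat n n"
    and pos: "\<And>x. x \<in> carrier_vec n \<Longrightarrow> x \<noteq> 0\<^sub>v n \<Longrightarrow> 0 < x \<bullet> (A *\<^sub>v x)"
  obtains B where "B \<in> carrier_mat n n" "A * B = 1\<^sub>m n" "B * A = 1\<^sub>m n"
proof -
  have "Determinant.det A \<noteq> 0"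
    unfolding det_0_iff_vec_prod_zero[OF A] using pos by fastforce
  from det_non_zero_imp_unit[OF A this, of "()"] obtain B where "B \<in> carrier_mat n n" "A * B = 1\<^sub>m n" "B * A = 1\<^sub>m n"
    unfolding Units_def ring_mat_def by auto
  then show ?thesis using that by blast
qed

lemma inverse_mult_vec:
  fixes A B :: "real mat"
  assumes "A \<in> carrier_mat n n" "B \<in> carrier_mat n n" "A * B = 1\<^sub>m n" "x \<in> carrier_vec n"
  shows "A *\<^sub>v (B *\<^sub>v x) = x"
  using assms mult_mult_vec[of A B x] by (auto simp: dim_rules)

lemma symmetric_inverse:
  fixes A B :: "real mat"
  assumes A: "A \<in> carrier_mat n n" "transpose_mat A = A"
    and B: "B \<in> carrier_mat n n" "A * B = 1\<^sub>m n"
  shows "transpose_mat B = B"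
proof -
  have "transpose_mat B * A = 1\<^sub>m n"
    using transpose_mult[OF A(1) B(1)] A(2) B(2) by simp
  then have "transpose_mat B * A * B = B" using left_mult_one_mat[OF B(1)] by simp
  moreover have "transpose_mat B * A * B = transpose_mat B"
    using A B right_mult_one_mat[of "transpose_mat B" n n] by (simp add: mult_assoc_dim)
  ultimately show ?thesis by simp
qed

text \<open>\<open>T\<close> inverts the form of \<open>G\<close> on the kernel of \<open>N\<close> and vanishes on its orthogonal complement: for a
kernel basis \<open>W\<close> take \<open>T = W (W\<^sup>T G W)\<^sup>-\<^sup>1 W\<^sup>T\<close>. The product \<open>T G\<close> is then the projection onto the kernel that is
orthogonal for \<open>G\<close>.\<close>

lemma constrained_inverse:
  fixes G N W :: "real mat"
  assumes W: "null_space_basis_mat N W" and N: "N \<in> carrier_mat r n"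
    and G: "G \<in> carrier_mat n n" "transpose_mat G = G"
    and pos: "\<And>y. y \<in> carrier_vec n \<Longrightarrow> y \<noteq> 0\<^sub>v n \<Longrightarrow> N *\<^sub>v y = 0\<^sub>v r \<Longrightarrow> 0 < y \<bullet> (G *\<^sub>v y)"
  obtains T where "T \<in> carrier_mat n n" "transpose_mat T = T"
    "\<And>y. y \<in> carrier_vec n \<Longrightarrow> N *\<^sub>v (T *\<^sub>v y) = 0\<^sub>v r"
    "\<And>y. y \<in> carrier_vec n \<Longrightarrow> N *\<^sub>v y = 0\<^sub>v r \<Longrightarrow> T *\<^sub>v (G *\<^sub>v y) = y"
proof -
  define k where "k = dim_col W"
  note Wf = null_space_basis_matD[OF W N, folded k_def]
  have d[simp]: "dim_row W = n" "dim_col W = k" "dim_row G = n" "dim_col G = n" using Wf(1) G by auto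
  define H where "H = transpose_mat W * (G * W)"
  have Hc: "H \<in> carrier_mat k k" by (simp add: H_def)
  have Hv: "H *\<^sub>v a = transpose_mat W *\<^sub>v (G *\<^sub>v (W *\<^sub>v a))" if "a \<in> carrier_vec k" for a
    unfolding H_def using that by (simp add: dim_rules)
  have Hpos: "0 < a \<bullet> (H *\<^sub>v a)" if a: "a \<in> carrier_vec k" "a \<noteq> 0\<^sub>v k" for a
  proof -
    have "a \<bullet> (H *\<^sub>v a) = (W *\<^sub>v a) \<bullet> (G *\<^sub>v (W *\<^sub>v a))"
      using a scalar_prod_transpose[of "G *\<^sub>v (W *\<^sub>v a)" W a]
      by (simp add: Hv dim_rules scalar_prod_commute[of a] scalar_prod_commute[of "G *\<^sub>v _"])
    also have "\<dots> > 0" using a Wf by (intro pos) (auto simp: dim_rules)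
    finally show ?thesis .
  qed
  obtain B where B: "B \<in> carrier_mat k k" "H * B = 1\<^sub>m k" "B * H = 1\<^sub>m k"
    using invertible_of_positive[OF Hc Hpos] by blast
  have [simp]: "dim_row B = k" "dim_col B = k" using B by auto
  have "transpose_mat H = H"
    unfolding H_def using G(2) by (simp add: transpose_mult_dim mult_assoc_dim)
  then have Bt: "transpose_mat B = B" using symmetric_inverse[OF Hc _ B(1,2)] by simp
  define T where "T = W * (B * transpose_mat W)"
  have Tv: "T *\<^sub>v y = W *\<^sub>v (B *\<^sub>v (transpose_mat W *\<^sub>v y))" if "y \<in> carrier_vec n" for y
    unfolding T_def using that by (simp add: dim_rules)
  show thesis
  proof (rule that[of T])
    show "T \<in> carrier_mat n n" by (simp add: T_def)
    show "transpose_mat T = T" unfolding T_def using Bt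
      by (simp add: transpose_mult_dim mult_assoc_dim)
    show "N *\<^sub>v (T *\<^sub>v y) = 0\<^sub>v r" if "y \<in> carrier_vec n" for y
      using that by (simp add: Tv Wf(2))
    show "T *\<^sub>v (G *\<^sub>v y) = y" if y: "y \<in> carrier_vec n" "N *\<^sub>v y = 0\<^sub>v r" for y
    proof -
      obtain a where a: "a \<in> carrier_vec k" "y = W *\<^sub>v a" using Wf(3) y by blast
      have "B *\<^sub>v (H *\<^sub>v a) = a" using a B Hc by (intro inverse_mult_vec)
      then show ?thesis using a by (simp add: Tv Hv)
    qed
  qed
qed

text \<open>With \<open>T\<close> the orthogonal projection onto the kernel of \<open>R\<close>, the matrix \<open>B = R\<^sup>T R + T\<close> is positive
definite and fixes the range of \<open>T\<close>. Therefore \<open>1 = B\<^sup>-\<^sup>1 R\<^sup>T R + T\<close>, and multiplying by \<open>Z\<close>, which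
kills the range of \<open>T\<close>, gives \<open>Z = (Z B\<^sup>-\<^sup>1 R\<^sup>T) R\<close>.\<close>

lemma factor_through_kernel:
  fixes R Z :: "real mat"
  assumes V: "null_space_basis_mat R V" and R: "R \<in> carrier_mat r n" and Z: "Z \<in> carrier_mat s n"
    and ker: "\<And>x. x \<in> carrier_vec n \<Longrightarrow> R *\<^sub>v x = 0\<^sub>v r \<Longrightarrow> Z *\<^sub>v x = 0\<^sub>v s"
  obtains J where "J \<in> carrier_mat s r" "Z = J * R"
proof -
  obtain T where T: "T \<in> carrier_mat n n" "transpose_mat T = T"
    "\<And>y. y \<in> carrier_vec n \<Longrightarrow> R *\<^sub>v (T *\<^sub>v y) = 0\<^sub>v r"
    "\<And>y. y \<in> carrier_vec n \<Longrightarrow> R *\<^sub>v y = 0\<^sub>v r \<Longrightarrow> T *\<^sub>v (1\<^sub>m n *\<^sub>v y) = y"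
    by (rule constrained_inverse[OF V R, of "1\<^sub>m n"]) (auto intro: scalar_prod_self_pos)
  have [simp]: "dim_row R = r" "dim_col R = n" "dim_row Z = s" "dim_col Z = n" "dim_row T = n" "dim_col T = n"
    using R Z T(1) by auto
  have TT: "T *\<^sub>v (T *\<^sub>v y) = T *\<^sub>v y" if "y \<in> carrier_vec n" for y
    using T(4)[of "T *\<^sub>v y"] T(3) that by (simp add: dim_rules)
  have Tsq: "y \<bullet> (T *\<^sub>v y) = (T *\<^sub>v y) \<bullet> (T *\<^sub>v y)" if y: "y \<in> carrier_vec n" for y
    using scalar_prod_transpose[of y T "T *\<^sub>v y"] T(2) y TT[OF y] by (simp add: dim_rules)
  define B where "B = transpose_mat R * R + T"
  have Bc: "B \<in> carrier_mat n n" by (simp add: B_def)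
  have Bv: "B *\<^sub>v y = transpose_mat R *\<^sub>v (R *\<^sub>v y) + T *\<^sub>v y" if "y \<in> carrier_vec n" for y
    unfolding B_def using that by (simp add: dim_rules)
  have "0 < y \<bullet> (B *\<^sub>v y)" if y: "y \<in> carrier_vec n" "y \<noteq> 0\<^sub>v n" for y
  proof -
    have e: "y \<bullet> (B *\<^sub>v y) = (R *\<^sub>v y) \<bullet> (R *\<^sub>v y) + (T *\<^sub>v y) \<bullet> (T *\<^sub>v y)"
      using y scalar_prod_transpose[of "R *\<^sub>v y" R y]
      by (simp add: Bv dim_rules Tsq scalar_prod_commute[of y "_ *\<^sub>v (R *\<^sub>v y)"])
    have "R *\<^sub>v y \<noteq> 0\<^sub>v r \<or> T *\<^sub>v y \<noteq> 0\<^sub>v n" using T(4) y by (force simp: dim_rules)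
    moreover have "R *\<^sub>v y \<in> carrier_vec r" "T *\<^sub>v y \<in> carrier_vec n" by simp_all
    ultimately show ?thesis unfolding e
      using scalar_prod_self_pos[of "R *\<^sub>v y" r] scalar_prod_self_pos[of "T *\<^sub>v y" n] by force
  qed
  then obtain C where C: "C \<in> carrier_mat n n" "B * C = 1\<^sub>m n" "C * B = 1\<^sub>m n"
    using invertible_of_positive[OF Bc] by blast
  have [simp]: "dim_row C = n" "dim_col C = n" using C by auto
  have eq: "Z *\<^sub>v x = (Z * C * transpose_mat R * R) *\<^sub>v x" if x: "x \<in> carrier_vec n" for x
  proof -
    have "B *\<^sub>v (T *\<^sub>v x) = T *\<^sub>v x"
      using x by (simp add: Bv T(3) TT dim_rules)
    then have CT: "C *\<^sub>v (T *\<^sub>v x) = T *\<^sub>v x"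
      using inverse_mult_vec[OF C(1) Bc C(3), of "T *\<^sub>v x"] by simp
    have "x = C *\<^sub>v (B *\<^sub>v x)" using inverse_mult_vec[OF C(1) Bc C(3) x] by simp
    also have "\<dots> = C *\<^sub>v (transpose_mat R *\<^sub>v (R *\<^sub>v x)) + T *\<^sub>v x"
      using x by (simp add: Bv CT dim_rules)
    finally have "Z *\<^sub>v x = Z *\<^sub>v (C *\<^sub>v (transpose_mat R *\<^sub>v (R *\<^sub>v x)) + T *\<^sub>v x)" by simp
    also have "\<dots> = Z *\<^sub>v (C *\<^sub>v (transpose_mat R *\<^sub>v (R *\<^sub>v x)))"
      using x by (simp add: mult_vec_add ker T(3))
    finally show ?thesis using x by (simp add: dim_rules)
  qed
  show thesis
  proof (rule that[of "Z * C * transpose_mat R"])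
    show "Z * C * transpose_mat R \<in> carrier_mat s r" by simp
    show "Z = Z * C * transpose_mat R * R"
    proof (rule mat_eq_by_vecI)
      show "Z \<in> carrier_mat s n" "Z * C * transpose_mat R * R \<in> carrier_mat s n" by simp_all
    qed (rule eq)
  qed
qed

section \<open>Completing a partially known matrix to a strict contraction\<close>

text \<open>The form of \<open>Q\<close> is nonnegative at \<open>Q\<^sup>-\<^sup>1 u - x\<close>.\<close>

lemma cauchy_schwarz_dual:
  fixes Q Qinv :: "real mat"
  assumes Q: "Q \<in> carrier_mat n n" "transpose_mat Q = Q"
    and Qinv: "Qinv \<in> carrier_mat n n" "Q * Qinv = 1\<^sub>m n"
    and nonneg: "\<And>x. x \<in> carrier_vec n \<Longrightarrow> 0 \<le> x \<bullet> (Q *\<^sub>v x)"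
    and uv: "u \<in> carrier_vec n" "x \<in> carrier_vec n"
  shows "2 * (u \<bullet> x) \<le> u \<bullet> (Qinv *\<^sub>v u) + x \<bullet> (Q *\<^sub>v x)"
proof -
  define d where "d = Qinv *\<^sub>v u - x"
  have QQi: "Q *\<^sub>v (Qinv *\<^sub>v u) = u" using inverse_mult_vec[OF Q(1) Qinv] uv by simp
  have sym: "(Qinv *\<^sub>v u) \<bullet> (Q *\<^sub>v x) = u \<bullet> x"
    using scalar_prod_transpose[of "Qinv *\<^sub>v u" Q x] Q uv Qinv QQi by simp
  have "0 \<le> d \<bullet> (Q *\<^sub>v d)" using uv Q Qinv by (intro nonneg) (simp add: d_def)
  also have "\<dots> = u \<bullet> (Qinv *\<^sub>v u) - 2 * (u \<bullet> x) + x \<bullet> (Q *\<^sub>v x)"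
    using uv Q(1) Qinv(1) by (simp add: d_def dim_rules QQi sym scalar_prod_commute[of "Qinv *\<^sub>v u" u] scalar_prod_commute[of x u])
  finally show ?thesis by simp
qed

text \<open>A strict version of Parrott's theorem for quadratic forms. Let \<open>T\<close> invert \<open>P\<^sup>-\<^sup>1\<close> on the kernel of
\<open>U\<^sup>T\<close>. The part \<open>P\<^sup>-\<^sup>1 T M\<close> of \<open>M\<close> cannot be changed by the gain, and the rest
\<open>L = M - P\<^sup>-\<^sup>1 T M\<close> has its columns in the range of \<open>U\<close>. The dual condition makes
\<open>S = Q - M\<^sup>T T M\<close> positive definite. The gain is chosen to cancel \<open>L\<close> on the \<open>S\<close>-orthogonal
complement of the kernel of \<open>R\<close>. For \<open>x = y + e\<close> with \<open>y\<close> in the kernel and \<open>e\<close> in the complement,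
the defect of contraction then splits into the defect of \<open>M\<close> at \<open>y\<close>, which the primal condition
makes positive for nonzero \<open>y\<close>, and the value of \<open>S\<close> at \<open>e\<close>.\<close>

theorem static_feedback_contraction:
  fixes M U R P Pinv Q Qinv V W :: "real mat"
  assumes M: "M \<in> carrier_mat r c" and U: "U \<in> carrier_mat r k" and R: "R \<in> carrier_mat l c"
    and W: "null_space_basis_mat (transpose_mat U) W" and V: "null_space_basis_mat R V"
    and P: "P \<in> carrier_mat r r" "transpose_mat P = P"
    and Pinv: "Pinv \<in> carrier_mat r r" "transpose_mat Pinv = Pinv" "P * Pinv = 1\<^sub>m r"
    and Pipos: "\<And>y. y \<in> carrier_vec r \<Longrightarrow> y \<noteq> 0\<^sub>v r \<Longrightarrow> 0 < y \<bullet> (Pinv *\<^sub>v y)"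
    and Q: "Q \<in> carrier_mat c c" "transpose_mat Q = Q"
    and Qpos: "\<And>x. x \<in> carrier_vec c \<Longrightarrow> x \<noteq> 0\<^sub>v c \<Longrightarrow> 0 < x \<bullet> (Q *\<^sub>v x)"
    and Qinv: "Qinv \<in> carrier_mat c c" "Q * Qinv = 1\<^sub>m c"
    and primal: "\<And>x. x \<in> carrier_vec c \<Longrightarrow> x \<noteq> 0\<^sub>v c \<Longrightarrow> R *\<^sub>v x = 0\<^sub>v l \<Longrightarrow>
                   (M *\<^sub>v x) \<bullet> (P *\<^sub>v (M *\<^sub>v x)) < x \<bullet> (Q *\<^sub>v x)"
    and dual: "\<And>y. y \<in> carrier_vec r \<Longrightarrow> y \<noteq> 0\<^sub>v r \<Longrightarrow> transpose_mat U *\<^sub>v y = 0\<^sub>v k \<Longrightarrow>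
                   (transpose_mat M *\<^sub>v y) \<bullet> (Qinv *\<^sub>v (transpose_mat M *\<^sub>v y)) < y \<bullet> (Pinv *\<^sub>v y)"
  obtains K where "K \<in> carrier_mat k l"
    "\<And>x. x \<in> carrier_vec c \<Longrightarrow> x \<noteq> 0\<^sub>v c \<Longrightarrow>
       ((M + U * K * R) *\<^sub>v x) \<bullet> (P *\<^sub>v ((M + U * K * R) *\<^sub>v x)) < x \<bullet> (Q *\<^sub>v x)"
proof -
  have Ut: "transpose_mat U \<in> carrier_mat k r" using U by simp
  obtain T where T: "T \<in> carrier_mat r r" "transpose_mat T = T"
    and UT: "\<And>y. y \<in> carrier_vec r \<Longrightarrow> transpose_mat U *\<^sub>v (T *\<^sub>v y) = 0\<^sub>v k"
    and TPi: "\<And>y. y \<in> carrier_vec r \<Longrightarrow> transpose_mat U *\<^sub>v y = 0\<^sub>v k \<Longrightarrow> T *\<^sub>v (Pinv *\<^sub>v y) = y"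
    using constrained_inverse[OF W Ut Pinv(1,2) Pipos] by blast
  note [simp] = M[simplified] U[simplified] R[simplified] P(1)[simplified] Pinv(1)[simplified]
    Q(1)[simplified] Qinv(1)[simplified] T(1)[simplified]
  have Tsym: "(T *\<^sub>v u) \<bullet> v = u \<bullet> (T *\<^sub>v v)" if "u \<in> carrier_vec r" "v \<in> carrier_vec r" for u v
    using scalar_prod_transpose[of u T v] T(2) that by simp
  have TPiT: "T *\<^sub>v (Pinv *\<^sub>v (T *\<^sub>v y)) = T *\<^sub>v y" if "y \<in> carrier_vec r" for y
    using that by (simp add: TPi UT)
  have PPi: "P *\<^sub>v (Pinv *\<^sub>v y) = y" if "y \<in> carrier_vec r" for y
    using inverse_mult_vec[OF P(1) Pinv(1,3) that] .
  \<comment> \<open>The weight \<open>Q\<close> minus the energy of the part of the output that no gain can change.\<close>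
  define S where "S = Q - transpose_mat M * T * M"
  have Sd[simp]: "dim_row S = c" "dim_col S = c" by (simp_all add: S_def)
  have St: "transpose_mat S = S"
    unfolding S_def using Q(2) T(2) by (simp add: transpose_minus transpose_mult_dim mult_assoc_dim)
  have Sq: "x \<bullet> (S *\<^sub>v y) = x \<bullet> (Q *\<^sub>v y) - (M *\<^sub>v x) \<bullet> (T *\<^sub>v (M *\<^sub>v y))"
    if "x \<in> carrier_vec c" "y \<in> carrier_vec c" for x y
    using that scalar_prod_transpose[of "T *\<^sub>v (M *\<^sub>v y)" M x]
    by (simp add: S_def dim_rules scalar_prod_commute[of x "transpose_mat M *\<^sub>v _"]
        scalar_prod_commute[of "T *\<^sub>v _" "M *\<^sub>v _"])
  have Spos: "0 < x \<bullet> (S *\<^sub>v x)" if x: "x \<in> carrier_vec c" "x \<noteq> 0\<^sub>v c" for x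
  proof -
    define p where "p = T *\<^sub>v (M *\<^sub>v x)"
    have p: "p \<in> carrier_vec r" "transpose_mat U *\<^sub>v p = 0\<^sub>v k" using UT x by (simp_all add: p_def)
    have pp: "p \<bullet> (Pinv *\<^sub>v p) = (M *\<^sub>v x) \<bullet> p"
      using Tsym[of "M *\<^sub>v x" "Pinv *\<^sub>v p"] TPi[OF p] p(1) by (simp add: p_def)
    have Sx: "x \<bullet> (S *\<^sub>v x) = x \<bullet> (Q *\<^sub>v x) - p \<bullet> (Pinv *\<^sub>v p)"
      using Sq[OF x(1) x(1)] by (simp add: pp flip: p_def)
    show ?thesis
    proof (cases "p = 0\<^sub>v r")
      case True
      then show ?thesis using Sx Qpos[OF x] by (simp add: dim_rules)
    next
      case False
      have "2 * ((transpose_mat M *\<^sub>v p) \<bullet> x) \<le>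
          (transpose_mat M *\<^sub>v p) \<bullet> (Qinv *\<^sub>v (transpose_mat M *\<^sub>v p)) + x \<bullet> (Q *\<^sub>v x)"
        using cauchy_schwarz_dual[OF Q Qinv, of "transpose_mat M *\<^sub>v p" x] Qpos x
        by (force simp: dim_rules)
      moreover have "(transpose_mat M *\<^sub>v p) \<bullet> x = p \<bullet> (Pinv *\<^sub>v p)"
        using p x by (simp add: scalar_prod_transpose pp scalar_prod_commute[of p "M *\<^sub>v x"])
      ultimately show ?thesis using dual[OF p(1) False p(2)] Sx by simp
    qed
  qed
  obtain T' where T': "T' \<in> carrier_mat c c" "transpose_mat T' = T'"
    and RT': "\<And>x. x \<in> carrier_vec c \<Longrightarrow> R *\<^sub>v (T' *\<^sub>v x) = 0\<^sub>v l"
    and T'S: "\<And>x. x \<in> carrier_vec c \<Longrightarrow> R *\<^sub>v x = 0\<^sub>v l \<Longrightarrow> T' *\<^sub>v (S *\<^sub>v x) = x"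
    using constrained_inverse[OF V R, of S] St Spos by auto
  note [simp] = T'(1)[simplified]
  \<comment> \<open>The \<open>S\<close>-orthogonal projection onto the kernel of \<open>R\<close>.\<close>
  define Pr where "Pr = T' * S"
  have Prd[simp]: "dim_row Pr = c" "dim_col Pr = c" by (simp_all add: Pr_def)
  have Prv: "Pr *\<^sub>v x = T' *\<^sub>v (S *\<^sub>v x)" if "x \<in> carrier_vec c" for x
    using that by (simp add: Pr_def dim_rules)
  have "\<And>x. x \<in> carrier_vec c \<Longrightarrow> R *\<^sub>v x = 0\<^sub>v l \<Longrightarrow> (1\<^sub>m c - Pr) *\<^sub>v x = 0\<^sub>v c"
    by (simp add: dim_rules Prv T'S)
  then obtain J2 where J2: "J2 \<in> carrier_mat c l" "1\<^sub>m c - Pr = J2 * R"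
    using factor_through_kernel[OF V R, of "1\<^sub>m c - Pr" c] by auto
  \<comment> \<open>The part of \<open>M\<close> with columns in the range of \<open>U\<close>.\<close>
  define L where "L = M - Pinv * T * M"
  have [simp]: "dim_row L = r" "dim_col L = c" by (simp_all add: L_def)
  have Lt: "transpose_mat L = transpose_mat M - transpose_mat M * T * Pinv"
    unfolding L_def using Pinv(2) T(2) by (simp add: transpose_minus transpose_mult_dim mult_assoc_dim)
  have "\<And>y. y \<in> carrier_vec r \<Longrightarrow> transpose_mat U *\<^sub>v y = 0\<^sub>v k \<Longrightarrow> transpose_mat L *\<^sub>v y = 0\<^sub>v c"
    by (simp add: Lt dim_rules TPi)
  then obtain J1 where J1: "J1 \<in> carrier_mat c k" "transpose_mat L = J1 * transpose_mat U"
    using factor_through_kernel[OF W Ut, of "transpose_mat L" c] by auto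
  note [simp] = J1(1)[simplified] J2(1)[simplified]
  have "transpose_mat (transpose_mat L) = U * transpose_mat J1"
    unfolding J1(2) by (simp add: transpose_mult_dim)
  then have LU: "L = U * transpose_mat J1" by simp
  \<comment> \<open>By the two factorisations, \<open>U K R = - L (1 - Pr)\<close>.\<close>
  define K where "K = - (transpose_mat J1 * J2)"
  show thesis
  proof (rule that)
    show "K \<in> carrier_mat k l" by (simp add: K_def)
    fix x :: "real vec" assume x: "x \<in> carrier_vec c" "x \<noteq> 0\<^sub>v c"
    define y where "y = Pr *\<^sub>v x"
    define e where "e = x - y"
    have [simp]: "dim_vec x = c" "dim_vec y = c" "dim_vec e = c" using x by (simp_all add: y_def e_def)
    have xye: "x = y + e" by (auto simp: e_def)
    have Ry: "R *\<^sub>v y = 0\<^sub>v l" using RT' by (simp add: y_def Prv)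
    have "U * K * R = - (L * (1\<^sub>m c - Pr))"
      unfolding K_def LU J2(2) by (simp add: mult_assoc_dim)
    then have "(M + U * K * R) *\<^sub>v x = M *\<^sub>v x - L *\<^sub>v e"
      by (intro eq_vecI) (simp_all add: dim_rules e_def y_def)
    also have "\<dots> = M *\<^sub>v y + Pinv *\<^sub>v (T *\<^sub>v (M *\<^sub>v e))"
      unfolding L_def by (subst xye) (auto simp: dim_rules)
    finally have MK: "(M + U * K * R) *\<^sub>v x = M *\<^sub>v y + Pinv *\<^sub>v (T *\<^sub>v (M *\<^sub>v e))" .
    define b where "b = T *\<^sub>v (M *\<^sub>v e)"
    have [simp]: "dim_vec b = r" by (simp add: b_def)
    have bb: "b \<bullet> (Pinv *\<^sub>v b) = (M *\<^sub>v e) \<bullet> b"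
      using Tsym[of "M *\<^sub>v e" "Pinv *\<^sub>v b"] TPiT[of "M *\<^sub>v e"] by (simp add: b_def)
    have cross: "(Pinv *\<^sub>v b) \<bullet> (P *\<^sub>v (M *\<^sub>v y)) = (M *\<^sub>v y) \<bullet> b"
      using scalar_prod_transpose[of "Pinv *\<^sub>v b" P "M *\<^sub>v y"] P(2)
      by (simp add: PPi scalar_prod_commute[of b "M *\<^sub>v y"])
    have "((M + U * K * R) *\<^sub>v x) \<bullet> (P *\<^sub>v ((M + U * K * R) *\<^sub>v x))
        = (M *\<^sub>v y) \<bullet> (P *\<^sub>v (M *\<^sub>v y)) + 2 * ((M *\<^sub>v y) \<bullet> b) + (M *\<^sub>v e) \<bullet> b"
      unfolding MK b_def[symmetric]
      by (simp add: dim_rules PPi cross scalar_prod_commute[of "Pinv *\<^sub>v b" b] bb)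
    moreover have "x \<bullet> (Q *\<^sub>v x) = y \<bullet> (Q *\<^sub>v y) + 2 * (y \<bullet> (Q *\<^sub>v e)) + e \<bullet> (Q *\<^sub>v e)"
      using scalar_prod_transpose[of e Q y] Q(2)
      by (subst (1 2) xye) (simp add: dim_rules scalar_prod_commute[of "Q *\<^sub>v e" y])
    moreover have "y \<bullet> (S *\<^sub>v e) = 0"
    proof -
      have T'sym: "(T' *\<^sub>v u) \<bullet> v = u \<bullet> (T' *\<^sub>v v)" if "u \<in> carrier_vec c" "v \<in> carrier_vec c" for u v
        using scalar_prod_transpose[of u T' v] T'(2) that by simp
      have Ssym: "(S *\<^sub>v u) \<bullet> v = u \<bullet> (S *\<^sub>v v)" if "u \<in> carrier_vec c" "v \<in> carrier_vec c" for u v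
        using scalar_prod_transpose[of u S v] St that by simp
      have "y \<bullet> (S *\<^sub>v y) = (S *\<^sub>v y) \<bullet> (T' *\<^sub>v (S *\<^sub>v x))"
        by (simp add: y_def Prv Ssym)
      also have "\<dots> = (T' *\<^sub>v (S *\<^sub>v y)) \<bullet> (S *\<^sub>v x)" by (simp add: T'sym)
      also have "\<dots> = y \<bullet> (S *\<^sub>v x)" using Ry by (simp add: T'S)
      finally show ?thesis by (simp add: e_def dim_rules)
    qed
    moreover have "y \<bullet> (S *\<^sub>v e) = y \<bullet> (Q *\<^sub>v e) - (M *\<^sub>v y) \<bullet> b"
      "e \<bullet> (S *\<^sub>v e) = e \<bullet> (Q *\<^sub>v e) - (M *\<^sub>v e) \<bullet> b"
      by (simp_all add: Sq b_def)
    moreover have "0 < (y \<bullet> (Q *\<^sub>v y) - (M *\<^sub>v y) \<bullet> (P *\<^sub>v (M *\<^sub>v y))) + e \<bullet> (S *\<^sub>v e)"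
    proof (cases "e = 0\<^sub>v c")
      case True
      then have "y = x" by (subst xye) simp
      then show ?thesis using True primal[OF x] Ry by (simp add: dim_rules)
    next
      case False
      have "(M *\<^sub>v y) \<bullet> (P *\<^sub>v (M *\<^sub>v y)) \<le> y \<bullet> (Q *\<^sub>v y)"
        using primal[of y] Ry by (cases "y = 0\<^sub>v c") (force simp: dim_rules)+
      then show ?thesis using Spos[of e] False by simp
    qed
    ultimately show "((M + U * K * R) *\<^sub>v x) \<bullet> (P *\<^sub>v ((M + U * K * R) *\<^sub>v x)) < x \<bullet> (Q *\<^sub>v x)"
      by linarith
  qed
qed

lemma append_cols_mult_vec:
  assumes "M \<in> carrier_mat r c1" "N \<in> carrier_mat r c2" "u \<in> carrier_vec c1" "v \<in> carrier_vec c2"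
  shows "(M @\<^sub>c N) *\<^sub>v (u @\<^sub>v v) = M *\<^sub>v u + N *\<^sub>v v"
proof -
  have "(M @\<^sub>c N) *\<^sub>v (u @\<^sub>v v) = (M *\<^sub>v u + N *\<^sub>v v) @\<^sub>v (0\<^sub>m 0 c1 *\<^sub>v u + 0\<^sub>m 0 c2 *\<^sub>v v)"
    unfolding append_cols_def using assms
    by (subst four_block_mat_mult_vec[of _ r c1 _ c2 _ 0]) simp_all
  also have "\<dots> = M *\<^sub>v u + N *\<^sub>v v"
    using assms by (intro eq_vecI) simp_all
  finally show ?thesis .
qed

lemma append_cols_carrier:
  "M \<in> carrier_mat r c1 \<Longrightarrow> N \<in> carrier_mat r c2 \<Longrightarrow> M @\<^sub>c N \<in> carrier_mat r (c1 + c2)"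
  by (simp add: append_cols_def)

lemma transpose_append_rows:
  fixes M N :: "real mat"
  assumes "M \<in> carrier_mat r1 c" "N \<in> carrier_mat r2 c"
  shows "transpose_mat (M @\<^sub>r N) = transpose_mat M @\<^sub>c transpose_mat N"
  using assms unfolding append_rows_def append_cols_def
  by (subst transpose_four_block_mat[of _ r1 c _ 0 _ r2]) simp_all

lemma vec_append_split:
  assumes "x \<in> carrier_vec (n + m)"
  obtains u w where "u \<in> carrier_vec n" "w \<in> carrier_vec m" "x = u @\<^sub>v w"
  using assms by (metis vec_first_last_append vec_first_carrier vec_last_carrier)

lemma append_vec_eq_zero:
  fixes u w :: "'a :: zero vec"
  assumes "u \<in> carrier_vec n" "w \<in> carrier_vec m"
  shows "u @\<^sub>v w = 0\<^sub>v (n + m) \<longleftrightarrow> u = 0\<^sub>v n \<and> w = 0\<^sub>v m"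
proof -
  have "0\<^sub>v (n + m) = 0\<^sub>v n @\<^sub>v 0\<^sub>v m" by (rule eq_vecI) auto
  then show ?thesis by (metis append_vec_eq[OF assms(1) zero_carrier_vec])
qed

section \<open>From the matrix inequalities to a feedback gain\<close>

text \<open>Both matrix inequalities of the synthesis problem have this block shape, the second one for the
transposed system matrices. As a quadratic form the block matrix is the dissipation of the system
with storage function \<open>u\<^sup>T X u\<close>.\<close>

lemma bounded_real_form:
  fixes A B C D X :: "real mat"
  assumes A: "A \<in> carrier_mat n n" and B: "B \<in> carrier_mat n m" and C: "C \<in> carrier_mat p n"
    and D: "D \<in> carrier_mat p m" and X: "X \<in> carrier_mat n n" "transpose_mat X = X"
    and u: "u \<in> carrier_vec n" and w: "w \<in> carrier_vec m"
  shows "(u @\<^sub>v w) \<bullet> (four_block_mat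
            (- X + transpose_mat A * X * A + transpose_mat C * C)
            (transpose_mat A * X * B + transpose_mat C * D)
            (transpose_mat B * X * A + transpose_mat D * C)
            (- (s \<cdot>\<^sub>m 1\<^sub>m m - transpose_mat B * X * B - transpose_mat D * D)) *\<^sub>v (u @\<^sub>v w))
    = (A *\<^sub>v u + B *\<^sub>v w) \<bullet> (X *\<^sub>v (A *\<^sub>v u + B *\<^sub>v w)) + (C *\<^sub>v u + D *\<^sub>v w) \<bullet> (C *\<^sub>v u + D *\<^sub>v w)
        - u \<bullet> (X *\<^sub>v u) - s * (w \<bullet> w)"
proof -
  note [simp] = A[simplified] B[simplified] C[simplified] D[simplified] X(1)[simplified] u[simplified] w[simplified]
  have neg: "(- E) *\<^sub>v v = - (E *\<^sub>v v)" if "dim_vec v = dim_col E" for E :: "real mat" and v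
    using that by (intro eq_vecI) (simp_all add: scalar_prod_def sum_negf)
  have nsp: "v \<bullet> (- v') = - (v \<bullet> v')" for v v' :: "real vec"
    by (simp add: scalar_prod_def sum_negf)
  have adj: "v \<bullet> (transpose_mat E *\<^sub>v v') = (E *\<^sub>v v) \<bullet> v'" if "dim_vec v = dim_col E" "dim_vec v' = dim_row E"
    for E :: "real mat" and v v'
    using that scalar_prod_transpose[of v' E v] by (simp add: scalar_prod_commute)
  show ?thesis
    by (subst four_block_mat_mult_vec[of _ n n _ m _ m])
       (simp_all add: scalar_prod_append[of _ n _ m] dim_rules neg nsp adj)
qed

lemma neg_definite_congruence:
  assumes neg: "neg_definite (transpose_mat V * H * V)" and V: "V \<in> carrier_mat c k"
    and H: "H \<in> carrier_mat c c" and b: "b \<in> carrier_vec k" and nz: "V *\<^sub>v b \<noteq> 0\<^sub>v c"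
  shows "(V *\<^sub>v b) \<bullet> (H *\<^sub>v (V *\<^sub>v b)) < 0"
proof -
  note [simp] = V[simplified] H[simplified] b[simplified]
  have "b \<noteq> 0\<^sub>v k" using nz by (auto simp: dim_rules)
  then have "b \<bullet> ((transpose_mat V * H * V) *\<^sub>v b) < 0"
    using neg unfolding neg_definite_def by simp
  also have "b \<bullet> ((transpose_mat V * H * V) *\<^sub>v b) = (V *\<^sub>v b) \<bullet> (H *\<^sub>v (V *\<^sub>v b))"
    using scalar_prod_transpose[of "H *\<^sub>v (V *\<^sub>v b)" V b]
    by (simp add: dim_rules scalar_prod_commute[of b] scalar_prod_commute[of "H *\<^sub>v _"])
  finally show ?thesis .
qed

lemma transpose_smult_real: "transpose_mat (k \<cdot>\<^sub>m A) = k \<cdot>\<^sub>m transpose_mat A" for A :: "real mat"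
  by (rule eq_matI) simp_all

lemma smult_smult_mat: "k \<cdot>\<^sub>m (l \<cdot>\<^sub>m A) = (k * l) \<cdot>\<^sub>m A" for A :: "real mat"
  by (rule eq_matI) simp_all

lemma smult_one_mult: "(k \<cdot>\<^sub>m 1\<^sub>m n) * (l \<cdot>\<^sub>m 1\<^sub>m n) = (k * l) \<cdot>\<^sub>m (1\<^sub>m n :: real mat)"
  by (simp add: mult_smult_distrib[of _ n n _ n] mult_smult_assoc_mat[of _ n n _ n]) (intro eq_matI; simp)

lemma one_smult_mat: "1 \<cdot>\<^sub>m A = (A :: real mat)"
  by (rule eq_matI) simp_all

text \<open>The coupling condition forces \<open>\<eta>\<^sup>2 > 0\<close> and makes \<open>\<eta>\<^sup>-\<^sup>2 Y\<close> the inverse of \<open>X\<close>. So the first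
inequality is the primal condition of Parrott's theorem with weights \<open>diag(X, I)\<close> and
\<open>diag(X, \<eta>\<^sup>2 I)\<close>, and the second inequality divided by \<open>\<eta>\<^sup>2\<close> is the dual condition.\<close>

lemma static_output_feedback_exists:
  fixes \<eta> :: real and A B1 B2 C1 C2 D11 D12 V W X Y :: "real mat"
  assumes n: "0 < n"
    and A: "A \<in> carrier_mat n n"
    and B1: "B1 \<in> carrier_mat n m"
    and B2: "B2 \<in> carrier_mat n nu"
    and C1: "C1 \<in> carrier_mat nz n"
    and C2: "C2 \<in> carrier_mat ny n"
    and D11: "D11 \<in> carrier_mat nz m"
    and D12: "D12 \<in> carrier_mat nz nu"
    and W: "null_space_basis_mat (transpose_mat B2 @\<^sub>c transpose_mat D12) W"
    and V: "null_space_basis_mat (C2 @\<^sub>c 0\<^sub>m ny m) V"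
    and X: "X \<in> carrier_mat n n" "pos_definite X"
    and Y: "Y \<in> carrier_mat n n" "pos_definite Y"
    and LMI_V: "neg_definite (transpose_mat V *
          four_block_mat
            (- X + transpose_mat A * X * A + transpose_mat C1 * C1)
            (transpose_mat A * X * B1 + transpose_mat C1 * D11)
            (transpose_mat B1 * X * A + transpose_mat D11 * C1)
            (- (\<eta>\<^sup>2 \<cdot>\<^sub>m 1\<^sub>m m - transpose_mat B1 * X * B1 - transpose_mat D11 * D11)) * V)"
    and LMI_W: "neg_definite (transpose_mat W *
          four_block_mat
            (- Y + A * Y * transpose_mat A + B1 * transpose_mat B1)
            (A * Y * transpose_mat C1 + B1 * transpose_mat D11)
            (C1 * Y * transpose_mat A + D11 * transpose_mat B1)
            (- (\<eta>\<^sup>2 \<cdot>\<^sub>m 1\<^sub>m nz - C1 * Y * transpose_mat C1 - D11 * transpose_mat D11)) * W)"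
    and coupling: "X * Y = \<eta>\<^sup>2 \<cdot>\<^sub>m 1\<^sub>m n"
  obtains K where "K \<in> carrier_mat nu ny"
    "\<And>x w. x \<in> carrier_vec n \<Longrightarrow> w \<in> carrier_vec m \<Longrightarrow> x \<noteq> 0\<^sub>v n \<or> w \<noteq> 0\<^sub>v m \<Longrightarrow>
      ((A + B2 * K * C2) *\<^sub>v x + B1 *\<^sub>v w) \<bullet> (X *\<^sub>v ((A + B2 * K * C2) *\<^sub>v x + B1 *\<^sub>v w))
       + ((C1 + D12 * K * C2) *\<^sub>v x + D11 *\<^sub>v w) \<bullet> ((C1 + D12 * K * C2) *\<^sub>v x + D11 *\<^sub>v w)
      < x \<bullet> (X *\<^sub>v x) + \<eta>\<^sup>2 * (w \<bullet> w)"
proof -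
  note [simp] = A[simplified] B1[simplified] B2[simplified] C1[simplified] C2[simplified]
    D11[simplified] D12[simplified] X(1)[simplified] Y(1)[simplified]
  have Xs: "transpose_mat X = X" and Xpos: "\<And>x. x \<in> carrier_vec n \<Longrightarrow> x \<noteq> 0\<^sub>v n \<Longrightarrow> 0 < x \<bullet> (X *\<^sub>v x)"
    using X unfolding pos_definite_def symmetric_matrix_def by auto
  have Ys: "transpose_mat Y = Y" and Ypos: "\<And>x. x \<in> carrier_vec n \<Longrightarrow> x \<noteq> 0\<^sub>v n \<Longrightarrow> 0 < x \<bullet> (Y *\<^sub>v x)"
    using Y unfolding pos_definite_def symmetric_matrix_def by auto
  have XY: "X *\<^sub>v (Y *\<^sub>v x) = \<eta>\<^sup>2 \<cdot>\<^sub>v x" if "x \<in> carrier_vec n" for x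
    using that arg_cong[OF coupling, of "\<lambda>E. E *\<^sub>v x"] by (simp add: dim_rules)
  have eta: "0 < \<eta>\<^sup>2"
  proof (rule ccontr)
    assume "\<not> 0 < \<eta>\<^sup>2"
    then have e0: "\<eta>\<^sup>2 = 0" by simp
    define y :: "real vec" where "y = unit_vec n 0"
    have y: "y \<in> carrier_vec n" "y \<noteq> 0\<^sub>v n" using n by (simp_all add: y_def)
    have Yy: "Y *\<^sub>v y \<noteq> 0\<^sub>v n" using Ypos[OF y] y by (auto simp: dim_rules)
    have "X *\<^sub>v (Y *\<^sub>v y) = 0\<^sub>v n" using XY[OF y(1)] y unfolding e0 by (auto intro!: eq_vecI)
    then show False using Xpos[of "Y *\<^sub>v y"] Yy by (simp add: dim_rules)
  qed
  define h where "h = 1 / \<eta>\<^sup>2"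
  have h: "0 < h" "h * \<eta>\<^sup>2 = 1" using eta by (simp_all add: h_def)
  define M where "M = four_block_mat A B1 C1 D11"
  define U where "U = B2 @\<^sub>r D12"
  define R where "R = C2 @\<^sub>c 0\<^sub>m ny m"
  define P where "P = four_block_mat X (0\<^sub>m n nz) (0\<^sub>m nz n) (1\<^sub>m nz)"
  define Pinv where "Pinv = four_block_mat (h \<cdot>\<^sub>m Y) (0\<^sub>m n nz) (0\<^sub>m nz n) (1\<^sub>m nz)"
  define Q where "Q = four_block_mat X (0\<^sub>m n m) (0\<^sub>m m n) (\<eta>\<^sup>2 \<cdot>\<^sub>m 1\<^sub>m m)"
  define Qinv where "Qinv = four_block_mat (h \<cdot>\<^sub>m Y) (0\<^sub>m n m) (0\<^sub>m m n) (h \<cdot>\<^sub>m 1\<^sub>m m)"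
  note defs = M_def U_def R_def P_def Pinv_def Q_def Qinv_def
  have car: "M \<in> carrier_mat (n + nz) (n + m)" "U \<in> carrier_mat (n + nz) nu" "R \<in> carrier_mat ny (n + m)"
    "P \<in> carrier_mat (n + nz) (n + nz)" "Pinv \<in> carrier_mat (n + nz) (n + nz)"
    "Q \<in> carrier_mat (n + m) (n + m)" "Qinv \<in> carrier_mat (n + m) (n + m)"
    by (simp_all add: defs append_rows_def append_cols_def)
  have Ut: "transpose_mat U = transpose_mat B2 @\<^sub>c transpose_mat D12"
    unfolding U_def by (rule transpose_append_rows[OF B2 D12])
  have Mv: "M *\<^sub>v (u @\<^sub>v w) = (A *\<^sub>v u + B1 *\<^sub>v w) @\<^sub>v (C1 *\<^sub>v u + D11 *\<^sub>v w)"
    if "u \<in> carrier_vec n" "w \<in> carrier_vec m" for u w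
    unfolding M_def using that by (intro four_block_mat_mult_vec[of _ n n _ m _ nz]) simp_all
  have Mtv: "transpose_mat M *\<^sub>v (p @\<^sub>v q) = (transpose_mat A *\<^sub>v p + transpose_mat C1 *\<^sub>v q)
      @\<^sub>v (transpose_mat B1 *\<^sub>v p + transpose_mat D11 *\<^sub>v q)"
    if "p \<in> carrier_vec n" "q \<in> carrier_vec nz" for p q
    unfolding M_def using that
    by (subst transpose_four_block_mat[of _ n n _ m _ nz], simp_all)
       (intro four_block_mat_mult_vec[of _ n n _ nz _ m], simp_all)
  have Pv: "(p @\<^sub>v q) \<bullet> (P *\<^sub>v (p @\<^sub>v q)) = p \<bullet> (X *\<^sub>v p) + q \<bullet> q"
    "(p @\<^sub>v q) \<bullet> (Pinv *\<^sub>v (p @\<^sub>v q)) = h * (p \<bullet> (Y *\<^sub>v p)) + q \<bullet> q"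
    if "p \<in> carrier_vec n" "q \<in> carrier_vec nz" for p q
    unfolding P_def Pinv_def using that
    by (simp_all add: mult_mat_vec_split[of _ n _ nz] scalar_prod_append[of _ n _ nz] dim_rules)
  have Qv: "(u @\<^sub>v w) \<bullet> (Q *\<^sub>v (u @\<^sub>v w)) = u \<bullet> (X *\<^sub>v u) + \<eta>\<^sup>2 * (w \<bullet> w)"
    "(u @\<^sub>v w) \<bullet> (Qinv *\<^sub>v (u @\<^sub>v w)) = h * (u \<bullet> (Y *\<^sub>v u)) + h * (w \<bullet> w)"
    if "u \<in> carrier_vec n" "w \<in> carrier_vec m" for u w
    unfolding Q_def Qinv_def using that
    by (simp_all add: mult_mat_vec_split[of _ n _ m] scalar_prod_append[of _ n _ m] dim_rules)
  have pos: "0 < h * (p \<bullet> (Y *\<^sub>v p)) + q \<bullet> q" "0 < p \<bullet> (X *\<^sub>v p) + \<eta>\<^sup>2 * (q \<bullet> q)"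
    if "p \<in> carrier_vec n" "q \<in> carrier_vec k" "p \<noteq> 0\<^sub>v n \<or> q \<noteq> 0\<^sub>v k" for p q k
  proof -
    have "0 \<le> p \<bullet> (Y *\<^sub>v p)" "0 \<le> p \<bullet> (X *\<^sub>v p)"
      using Ypos[of p] Xpos[of p] that by (cases "p = 0\<^sub>v n"; simp add: dim_rules)+
    then show "0 < h * (p \<bullet> (Y *\<^sub>v p)) + q \<bullet> q" "0 < p \<bullet> (X *\<^sub>v p) + \<eta>\<^sup>2 * (q \<bullet> q)"
      using Ypos[of p] Xpos[of p] scalar_prod_self_pos[of q k] that h eta
      by (cases "p = 0\<^sub>v n"; force intro: add_nonneg_pos add_pos_nonneg)+
  qed
  have XYm: "X * (h \<cdot>\<^sub>m Y) = 1\<^sub>m n"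
    using coupling h by (simp add: mult_smult_distrib[of _ n n _ n]) (intro eq_matI; simp)
  show thesis
  proof (rule static_feedback_contraction[OF car(1,2,3) _ _ car(4) _ car(5) _ _ _ car(6) _ _ car(7)])
    show "null_space_basis_mat (transpose_mat U) W" unfolding Ut by (rule W)
    show "null_space_basis_mat R V" unfolding R_def by (rule V)
    show "transpose_mat P = P" "transpose_mat Q = Q" "transpose_mat Pinv = Pinv"
      unfolding P_def Q_def Pinv_def
      by (subst transpose_four_block_mat[of _ n n _ nz _ nz] transpose_four_block_mat[of _ n n _ m _ m]; simp add: Xs Ys transpose_smult_real)+
    show "P * Pinv = 1\<^sub>m (n + nz)" "Q * Qinv = 1\<^sub>m (n + m)"
      unfolding P_def Q_def Pinv_def Qinv_def using XYm
      by (simp_all add: mult_four_block_mat[of _ n n _ nz _ nz _ _ n _ nz]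
          mult_four_block_mat[of _ n n _ m _ m _ _ n _ m] smult_one_mult h mult.commute one_smult_mat)
  next
    fix y :: "real vec" assume y: "y \<in> carrier_vec (n + nz)" "y \<noteq> 0\<^sub>v (n + nz)"
    obtain p q where pq: "p \<in> carrier_vec n" "q \<in> carrier_vec nz" "y = p @\<^sub>v q"
      using vec_append_split[OF y(1)] by blast
    have nz: "p \<noteq> 0\<^sub>v n \<or> q \<noteq> 0\<^sub>v nz" using y(2) pq append_vec_eq_zero[OF pq(1,2)] by auto
    show "0 < y \<bullet> (Pinv *\<^sub>v y)" using pq nz by (simp only: Pv pos)
    assume "transpose_mat U *\<^sub>v y = 0\<^sub>v nu"
    then obtain b where b: "b \<in> carrier_vec (dim_col W)" "y = W *\<^sub>v b"
      using null_space_basis_matD(3)[OF W append_cols_carrier[of _ nu n _ nz]] y by (auto simp: Ut simp del: carrier_dim_vec)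
    show "(transpose_mat M *\<^sub>v y) \<bullet> (Qinv *\<^sub>v (transpose_mat M *\<^sub>v y)) < y \<bullet> (Pinv *\<^sub>v y)"
    proof -
      have "y \<bullet> (four_block_mat
            (- Y + transpose_mat (transpose_mat A) * Y * transpose_mat A + transpose_mat (transpose_mat B1) * transpose_mat B1)
            (transpose_mat (transpose_mat A) * Y * transpose_mat C1 + transpose_mat (transpose_mat B1) * transpose_mat D11)
            (transpose_mat (transpose_mat C1) * Y * transpose_mat A + transpose_mat (transpose_mat D11) * transpose_mat B1)
            (- (\<eta>\<^sup>2 \<cdot>\<^sub>m 1\<^sub>m nz - transpose_mat (transpose_mat C1) * Y * transpose_mat C1 - transpose_mat (transpose_mat D11) * transpose_mat D11)) *\<^sub>v y) < 0"
        unfolding b(2) transpose_transpose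
        by (rule neg_definite_congruence[OF LMI_W null_space_basis_matD(1)[OF W append_cols_carrier[of _ nu n _ nz]] _ b(1)])
           (use b(2) y in simp_all)
      then have "(transpose_mat A *\<^sub>v p + transpose_mat C1 *\<^sub>v q) \<bullet> (Y *\<^sub>v (transpose_mat A *\<^sub>v p + transpose_mat C1 *\<^sub>v q))
          + (transpose_mat B1 *\<^sub>v p + transpose_mat D11 *\<^sub>v q) \<bullet> (transpose_mat B1 *\<^sub>v p + transpose_mat D11 *\<^sub>v q)
          < p \<bullet> (Y *\<^sub>v p) + \<eta>\<^sup>2 * (q \<bullet> q)" (is "?l < ?r")
        unfolding pq(3) using pq by (subst (asm) bounded_real_form[of _ n _ nz _ m]) (simp_all add: Ys)
      then have "h * ?l < h * ?r" using h by simp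
      also have "\<dots> = h * (p \<bullet> (Y *\<^sub>v p)) + q \<bullet> q" using h by (simp add: algebra_simps)
      finally show ?thesis
        unfolding pq(3) using pq by (simp add: Mtv Qv Pv distrib_left)
    qed
  next
    fix x :: "real vec" assume x: "x \<in> carrier_vec (n + m)" "x \<noteq> 0\<^sub>v (n + m)"
    obtain u w where uw: "u \<in> carrier_vec n" "w \<in> carrier_vec m" "x = u @\<^sub>v w"
      using vec_append_split[OF x(1)] by blast
    have nz: "u \<noteq> 0\<^sub>v n \<or> w \<noteq> 0\<^sub>v m" using x(2) uw append_vec_eq_zero[OF uw(1,2)] by auto
    show "0 < x \<bullet> (Q *\<^sub>v x)" using uw nz by (simp only: Qv pos)
    assume "R *\<^sub>v x = 0\<^sub>v ny"
    then obtain b where b: "b \<in> carrier_vec (dim_col V)" "x = V *\<^sub>v b"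
      using null_space_basis_matD(3)[OF V append_cols_carrier[of _ ny n _ m]] x by (auto simp: R_def simp del: carrier_dim_vec)
    show "(M *\<^sub>v x) \<bullet> (P *\<^sub>v (M *\<^sub>v x)) < x \<bullet> (Q *\<^sub>v x)"
    proof -
      have "x \<bullet> (four_block_mat
            (- X + transpose_mat A * X * A + transpose_mat C1 * C1)
            (transpose_mat A * X * B1 + transpose_mat C1 * D11)
            (transpose_mat B1 * X * A + transpose_mat D11 * C1)
            (- (\<eta>\<^sup>2 \<cdot>\<^sub>m 1\<^sub>m m - transpose_mat B1 * X * B1 - transpose_mat D11 * D11)) *\<^sub>v x) < 0"
        unfolding b(2)
        by (rule neg_definite_congruence[OF LMI_V null_space_basis_matD(1)[OF V append_cols_carrier[of _ ny n _ m]] _ b(1)])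
           (use b(2) x in simp_all)
      then show ?thesis
        unfolding uw(3) using uw
        by (subst (asm) bounded_real_form[of _ n _ m _ nz]) (simp_all add: Xs Mv Pv Qv)
    qed
  next
    fix K :: "real mat"
    assume K: "K \<in> carrier_mat nu ny"
      and contr: "\<And>x. x \<in> carrier_vec (n + m) \<Longrightarrow> x \<noteq> 0\<^sub>v (n + m) \<Longrightarrow>
       ((M + U * K * R) *\<^sub>v x) \<bullet> (P *\<^sub>v ((M + U * K * R) *\<^sub>v x)) < x \<bullet> (Q *\<^sub>v x)"
    note [simp] = K[simplified]
    show thesis
    proof (rule that[OF K])
      fix x w :: "real vec" assume xw: "x \<in> carrier_vec n" "w \<in> carrier_vec m" "x \<noteq> 0\<^sub>v n \<or> w \<noteq> 0\<^sub>v m"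
      have "(M + U * K * R) *\<^sub>v (x @\<^sub>v w) = M *\<^sub>v (x @\<^sub>v w) + U *\<^sub>v (K *\<^sub>v (R *\<^sub>v (x @\<^sub>v w)))"
        using xw car(1-3)[simplified] by (simp add: dim_rules)
      also have "R *\<^sub>v (x @\<^sub>v w) = C2 *\<^sub>v x"
        unfolding R_def using xw by (subst append_cols_mult_vec[of _ ny n _ m]) (simp_all add: dim_rules)
      also have "U *\<^sub>v (K *\<^sub>v (C2 *\<^sub>v x)) = (B2 *\<^sub>v (K *\<^sub>v (C2 *\<^sub>v x))) @\<^sub>v (D12 *\<^sub>v (K *\<^sub>v (C2 *\<^sub>v x)))"
        unfolding U_def by (rule mat_mult_append[OF B2 D12]) simp
      also have "M *\<^sub>v (x @\<^sub>v w) + \<dots> = ((A + B2 * K * C2) *\<^sub>v x + B1 *\<^sub>v w) @\<^sub>v ((C1 + D12 * K * C2) *\<^sub>v x + D11 *\<^sub>v w)"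
        using xw by (intro eq_vecI) (auto simp: Mv dim_rules)
      finally have eq: "(M + U * K * R) *\<^sub>v (x @\<^sub>v w) = \<dots>" .
      show "((A + B2 * K * C2) *\<^sub>v x + B1 *\<^sub>v w) \<bullet> (X *\<^sub>v ((A + B2 * K * C2) *\<^sub>v x + B1 *\<^sub>v w))
       + ((C1 + D12 * K * C2) *\<^sub>v x + D11 *\<^sub>v w) \<bullet> ((C1 + D12 * K * C2) *\<^sub>v x + D11 *\<^sub>v w)
      < x \<bullet> (X *\<^sub>v x) + \<eta>\<^sup>2 * (w \<bullet> w)"
        using contr[of "x @\<^sub>v w"] xw append_vec_eq_zero[OF xw(1,2)]
        by (simp add: eq Qv Pv)
    qed
  qed
qed

section \<open>Determinants and traces of positive definite matrices\<close>

lemma pos_definite_iff: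
  "M \<in> carrier_mat n n \<Longrightarrow> pos_definite M \<longleftrightarrow> transpose_mat M = M \<and>
     (\<forall>x \<in> carrier_vec n. x \<noteq> 0\<^sub>v n \<longrightarrow> 0 < x \<bullet> (M *\<^sub>v x))"
  by (simp add: pos_definite_def symmetric_matrix_def)

text \<open>Induction on the dimension: the Schur complement of the top left entry is again positive definite,
because its form is the minimum of the given form over the first coordinate.\<close>

lemma cholesky:
  assumes "S \<in> carrier_mat n n" "pos_definite S"
  shows "\<exists>R \<in> carrier_mat n n. upper_triangular R \<and> S = transpose_mat R * R"
  using assms
proof (induction n arbitrary: S)
  case 0
  then show ?case by (intro bexI[of _ "0\<^sub>m 0 0"]) (auto intro!: eq_matI)
next
  case (Suc n)
  obtain S1 S2 S3 S4 where sp: "split_block S 1 1 = (S1, S2, S3, S4)" by (metis prod_cases4)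
  note blk = split_block[OF sp, of n n]
  have c: "S1 \<in> carrier_mat 1 1" "S2 \<in> carrier_mat 1 n" "S3 \<in> carrier_mat n 1" "S4 \<in> carrier_mat n n"
    and S: "S = four_block_mat S1 S2 S3 S4"
    using blk Suc.prems(1) by simp_all
  note [simp] = c[simplified]
  have sym: "transpose_mat S = S" and pos: "\<And>x. x \<in> carrier_vec (Suc n) \<Longrightarrow> x \<noteq> 0\<^sub>v (Suc n) \<Longrightarrow> 0 < x \<bullet> (S *\<^sub>v x)"
    using Suc.prems by (simp_all add: pos_definite_iff)
  have t: "transpose_mat S = four_block_mat (transpose_mat S1) (transpose_mat S3) (transpose_mat S2) (transpose_mat S4)"
    unfolding S by (rule transpose_four_block_mat[OF c])
  have S3: "S3 = transpose_mat S2" and S4: "transpose_mat S4 = S4"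
  proof -
    have e: "S $$ (j, i) = S $$ (i, j)" if "i < Suc n" "j < Suc n" for i j
      using arg_cong[OF sym, of "\<lambda>M. M $$ (i, j)"] Suc.prems(1) that by simp
    show "S3 = transpose_mat S2"
      by (rule eq_matI) (use e[of "Suc _" 0] in \<open>auto simp: S\<close>)
    show "transpose_mat S4 = S4"
      by (rule eq_matI) (use e[of "Suc _" "Suc _"] in \<open>auto simp: S\<close>)
  qed
  define s where "s = S1 $$ (0, 0)"
  have s: "0 < s"
  proof -
    have "unit_vec (Suc n) 0 \<bullet> (S *\<^sub>v unit_vec (Suc n) 0) = s"
      using Suc.prems(1) by (simp add: s_def S)
    then show ?thesis using pos[of "unit_vec (Suc n) 0"] by simp
  qed
  have S1: "S1 = s \<cdot>\<^sub>m 1\<^sub>m 1" by (rule eq_matI) (auto simp: s_def)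
  define T where "T = S4 - (1 / s) \<cdot>\<^sub>m (S3 * S2)"
  have Tc: "T \<in> carrier_mat n n" by (simp add: T_def)
  have "pos_definite T"
    unfolding pos_definite_iff[OF Tc]
  proof (intro conjI ballI impI)
    show "transpose_mat T = T"
      by (simp add: T_def transpose_minus transpose_smult_real transpose_mult_dim S4 S3)
    fix x :: "real vec" assume x: "x \<in> carrier_vec n" "x \<noteq> 0\<^sub>v n"
    \<comment> \<open>The first coordinate that minimises the form for the given remaining ones.\<close>
    define b where "b = - (1 / s) \<cdot>\<^sub>v (S2 *\<^sub>v x)"
    have [simp]: "dim_vec b = 1" "dim_vec x = n" using x by (simp_all add: b_def)
    have "0 < (b @\<^sub>v x) \<bullet> (S *\<^sub>v (b @\<^sub>v x))"
    proof (rule pos)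
      show "b @\<^sub>v x \<in> carrier_vec (Suc n)" by simp
      show "b @\<^sub>v x \<noteq> 0\<^sub>v (Suc n)" using append_vec_eq_zero[of b 1 x n] x by simp
    qed
    also have "\<dots> = b \<bullet> (s \<cdot>\<^sub>v b) + 2 * (b \<bullet> (S2 *\<^sub>v x)) + x \<bullet> (S4 *\<^sub>v x)"
      unfolding S using scalar_prod_transpose[of b S2 x]
      by (subst four_block_mat_mult_vec[OF c])
         (simp_all add: scalar_prod_append[of _ 1 _ n] dim_rules S1 S3 scalar_prod_commute[of x "transpose_mat S2 *\<^sub>v b"])
    also have "\<dots> = x \<bullet> (S4 *\<^sub>v x) - (1 / s) * ((S2 *\<^sub>v x) \<bullet> (S2 *\<^sub>v x))"
      using s by (simp add: b_def dim_rules field_simps)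
    also have "\<dots> = x \<bullet> (T *\<^sub>v x)"
      using scalar_prod_transpose[of "S2 *\<^sub>v x" S2 x]
      by (simp add: T_def dim_rules S3 scalar_prod_commute[of x "transpose_mat S2 *\<^sub>v _"])
    finally show "0 < x \<bullet> (T *\<^sub>v x)" .
  qed
  then obtain R where R: "R \<in> carrier_mat n n" "upper_triangular R" "T = transpose_mat R * R"
    using Suc.IH[OF Tc] by auto
  note [simp] = R(1)[simplified]
  define R' where "R' = four_block_mat (sqrt s \<cdot>\<^sub>m 1\<^sub>m 1) ((1 / sqrt s) \<cdot>\<^sub>m S2) (0\<^sub>m n 1) R"
  show ?case
  proof (intro bexI conjI)
    show "R' \<in> carrier_mat (Suc n) (Suc n)" by (simp add: R'_def)
    show "upper_triangular R'"
      using R(2) unfolding R'_def upper_triangular_def by auto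
    have "transpose_mat R' * R' = four_block_mat (s \<cdot>\<^sub>m 1\<^sub>m 1) S2 (transpose_mat S2) ((1/s) \<cdot>\<^sub>m (S3 * S2) + T)"
      unfolding R'_def R(3)
      by (subst transpose_four_block_mat[of _ 1 1 _ n _ n], simp_all,
          subst mult_four_block_mat[of _ 1 1 _ n _ n _ _ 1 _ n])
         (use s in \<open>simp_all add: S3 transpose_smult_real smult_one_mult
           mult_smult_distrib[of _ n 1 _ n] mult_smult_distrib[of _ 1 1 _ n] mult_smult_assoc_mat[of _ 1 1 _ n]
           mult_smult_assoc_mat[of _ n 1 _ 1] mult_smult_assoc_mat[of _ n 1 _ n]
           mult_smult_distrib[of _ n 1 _ 1] smult_smult_mat one_smult_mat\<close>)
    also have "(1/s) \<cdot>\<^sub>m (S3 * S2) + T = S4"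
      unfolding T_def by (rule eq_matI) simp_all
    also have "four_block_mat (s \<cdot>\<^sub>m 1\<^sub>m 1) S2 (transpose_mat S2) S4 = S"
      unfolding S S3[symmetric] S1[symmetric] ..
    finally show "S = transpose_mat R' * R'" by simp
  qed
qed

text \<open>In a factorisation \<open>S = R\<^sup>T R\<close> with \<open>R\<close> upper triangular, the determinant of \<open>S\<close> is the product of
the squared diagonal entries of \<open>R\<close>, and each of these is one summand of a diagonal entry of \<open>S\<close>.\<close>

theorem hadamard_inequality:
  assumes S: "S \<in> carrier_mat n n" "pos_definite S"
  shows "Determinant.det S \<le> (\<Prod>i<n. S $$ (i, i))" and "0 < Determinant.det S" and "i < n \<Longrightarrow> 0 < S $$ (i, i)"
proof -
  obtain R where R: "R \<in> carrier_mat n n" "upper_triangular R" "S = transpose_mat R * R"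
    using cholesky[OF S] by blast
  have "Determinant.det S = Determinant.det R * Determinant.det R"
    using R(1) unfolding R(3) by (subst det_mult[of _ n]) (simp_all add: det_transpose[of _ n])
  also have "Determinant.det R = (\<Prod>i<n. R $$ (i, i))"
    using det_upper_triangular[OF R(2,1)] R(1)
    by (simp add: prod_list_diag_prod atLeast0LessThan)
  finally have detS: "Determinant.det S = (\<Prod>i<n. (R $$ (i, i))\<^sup>2)"
    by (simp add: prod.distrib power2_eq_square)
  have diag: "S $$ (i, i) = (\<Sum>k<n. (R $$ (k, i))\<^sup>2)" if "i < n" for i
    using that R(1) unfolding R(3)
    by (simp add: scalar_prod_def power2_eq_square atLeast0LessThan)
  have le: "(R $$ (i, i))\<^sup>2 \<le> S $$ (i, i)" if "i < n" for i
    unfolding diag[OF that] using that by (intro member_le_sum) auto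
  show "Determinant.det S \<le> (\<Prod>i<n. S $$ (i, i))"
    unfolding detS using le by (intro prod_mono) auto
  have "Determinant.det S \<noteq> 0"
    unfolding det_0_iff_vec_prod_zero[OF S(1)] using S(2) unfolding pos_definite_iff[OF S(1)] by (force simp: dim_rules)
  moreover have "0 \<le> Determinant.det S" unfolding detS by (intro prod_nonneg) auto
  ultimately show "0 < Determinant.det S" by simp
  show "0 < S $$ (i, i)" if "i < n"
  proof -
    have "S $$ (i, i) = unit_vec n i \<bullet> (S *\<^sub>v unit_vec n i)" using that S(1) by simp
    also have "\<dots> > 0" using S(2) that unfolding pos_definite_iff[OF S(1)] by simp
    finally show ?thesis .
  qed
qed

text \<open>The double sum is the trace of the product. With \<open>Sig = R\<^sup>T R\<close> it is the trace of
\<open>R Phi R\<^sup>T\<close>, a positive definite matrix whose determinant is the product of the two given ones. The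
mean of its diagonal entries dominates their geometric mean, which by Hadamard's inequality
dominates the root of the determinant.\<close>

theorem trace_mult_ge_det:
  assumes m: "0 < m"
    and Phi: "Phi \<in> carrier_mat m m" "pos_definite Phi"
    and Sig: "Sig \<in> carrier_mat m m" "pos_definite Sig"
  shows "real m * (Determinant.det Phi * Determinant.det Sig) powr (1 / real m)
      \<le> (\<Sum>i<m. \<Sum>j<m. Phi $$ (i, j) * Sig $$ (i, j))"
proof -
  obtain R where R: "R \<in> carrier_mat m m" "Sig = transpose_mat R * R"
    using cholesky[OF Sig] by blast
  note [simp] = R(1)[simplified] Phi(1)[simplified]
  define S where "S = R * Phi * transpose_mat R"
  have Sc: "S \<in> carrier_mat m m" by (simp add: S_def)
  have detR: "Determinant.det R * Determinant.det R = Determinant.det Sig"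
    using R(1) unfolding R(2) by (subst det_mult[of _ m]) (simp_all add: det_transpose[of _ m])
  have Rt: "transpose_mat R *\<^sub>v x \<noteq> 0\<^sub>v m" if "x \<in> carrier_vec m" "x \<noteq> 0\<^sub>v m" for x
  proof -
    have "Determinant.det (transpose_mat R) \<noteq> 0"
      using hadamard_inequality(2)[OF Sig] detR R(1) by (auto simp: det_transpose[of _ m])
    then show ?thesis
      using that det_0_iff_vec_prod_zero[of "transpose_mat R" m] by auto
  qed
  have "pos_definite S"
    unfolding pos_definite_iff[OF Sc]
  proof (intro conjI ballI impI)
    show "transpose_mat S = S"
      using Phi(2) unfolding pos_definite_iff[OF Phi(1)] S_def
      by (simp add: transpose_mult_dim mult_assoc_dim)
    fix x :: "real vec" assume x: "x \<in> carrier_vec m" "x \<noteq> 0\<^sub>v m"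
    have "x \<bullet> (S *\<^sub>v x) = (transpose_mat R *\<^sub>v x) \<bullet> (Phi *\<^sub>v (transpose_mat R *\<^sub>v x))"
      using x scalar_prod_transpose[of x R "Phi *\<^sub>v (transpose_mat R *\<^sub>v x)"]
      by (simp add: S_def dim_rules)
    also have "\<dots> > 0"
      using Phi(2) Rt[OF x] x unfolding pos_definite_iff[OF Phi(1)] by simp
    finally show "0 < x \<bullet> (S *\<^sub>v x)" .
  qed
  note H = hadamard_inequality[OF Sc this]
  have "Determinant.det S = Determinant.det Phi * Determinant.det Sig"
    unfolding S_def detR[symmetric]
    by (simp add: det_mult[of _ m] det_transpose[of _ m])
  then have "(Determinant.det Phi * Determinant.det Sig) powr (1 / real m) \<le> (\<Prod>i<m. S $$ (i, i)) powr (1 / real m)"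
    using H m by (intro powr_mono2) auto
  also have "\<dots> \<le> (\<Sum>i<m. S $$ (i, i) / real m)"
    using arith_geom_mean[of "{..<m}" "\<lambda>i. S $$ (i, i)"] m H(3) by (force intro: less_imp_le)
  finally have "real m * (Determinant.det Phi * Determinant.det Sig) powr (1 / real m) \<le> (\<Sum>i<m. S $$ (i, i))"
    using m by (simp add: field_simps flip: sum_divide_distrib)
  also have "(\<Sum>i<m. S $$ (i, i)) = (\<Sum>i<m. \<Sum>j<m. Phi $$ (i, j) * Sig $$ (i, j))"
  proof -
    have "(\<Sum>k<m. S $$ (k, k)) = (\<Sum>k<m. \<Sum>j<m. \<Sum>i<m. R $$ (k, i) * Phi $$ (i, j) * R $$ (k, j))"
      unfolding S_def
      by (simp add: scalar_prod_def atLeast0LessThan sum_distrib_left mult_assoc_dim mult_ac)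
         (rule sum.cong[OF refl], subst sum.swap, simp add: mult_ac)
    also have "\<dots> = (\<Sum>j<m. \<Sum>i<m. \<Sum>k<m. R $$ (k, i) * Phi $$ (i, j) * R $$ (k, j))"
      by (subst sum.swap, rule sum.cong[OF refl], rule sum.swap)
    also have "\<dots> = (\<Sum>j<m. \<Sum>i<m. Phi $$ (i, j) * Sig $$ (i, j))"
      by (simp add: R(2) scalar_prod_def atLeast0LessThan sum_distrib_left mult_ac)
    finally show ?thesis by (subst sum.swap) 
  qed
  finally show ?thesis .
qed

section \<open>Stability\<close>

text \<open>The real and imaginary part of an eigenvector for \<open>z\<close> span a real subspace on which \<open>A\<close> acts as
multiplication by \<open>z\<close>, so the sum of the storage function over the two parts is multiplied by
\<open>|z|\<^sup>2\<close>.\<close>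

lemma lyapunov_stable:
  fixes A X :: "real mat"
  assumes A: "A \<in> carrier_mat n n" and X: "X \<in> carrier_mat n n" "pos_definite X"
    and decr: "\<And>x. x \<in> carrier_vec n \<Longrightarrow> x \<noteq> 0\<^sub>v n \<Longrightarrow> (A *\<^sub>v x) \<bullet> (X *\<^sub>v (A *\<^sub>v x)) < x \<bullet> (X *\<^sub>v x)"
    and ev: "eigenvalue (map_mat complex_of_real A) z"
  shows "cmod z < 1"
proof -
  note [simp] = A[simplified] X(1)[simplified]
  have Xs: "transpose_mat X = X" and Xpos: "\<And>x. x \<in> carrier_vec n \<Longrightarrow> x \<noteq> 0\<^sub>v n \<Longrightarrow> 0 < x \<bullet> (X *\<^sub>v x)"
    using X(2) by (auto simp: pos_definite_iff[OF X(1)] simp del: carrier_dim_vec)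
  obtain v where v: "dim_vec v = n" "v \<noteq> 0\<^sub>v n" "map_mat complex_of_real A *\<^sub>v v = z \<cdot>\<^sub>v v"
    using ev unfolding eigenvalue_def eigenvector_def by auto
  define u where "u = map_vec Re v"
  define w where "w = map_vec Im v"
  have [simp]: "dim_vec u = n" "dim_vec w = n" using v by (simp_all add: u_def w_def)
  have comp: "(\<Sum>j<n. complex_of_real (A $$ (i, j)) * v $ j) = z * v $ i" if "i < n" for i
    using arg_cong[OF v(3), of "\<lambda>x. x $ i"] that v(1) by (simp add: scalar_prod_def atLeast0LessThan)
  have Au: "A *\<^sub>v u = Re z \<cdot>\<^sub>v u - Im z \<cdot>\<^sub>v w"
  proof (rule eq_vecI)
    fix i assume "i < dim_vec (Re z \<cdot>\<^sub>v u - Im z \<cdot>\<^sub>v w)"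
    then show "(A *\<^sub>v u) $ i = (Re z \<cdot>\<^sub>v u - Im z \<cdot>\<^sub>v w) $ i"
      using arg_cong[OF comp[of i], of Re] v(1) by (simp add: scalar_prod_def atLeast0LessThan u_def w_def)
  qed simp
  have Aw: "A *\<^sub>v w = Im z \<cdot>\<^sub>v u + Re z \<cdot>\<^sub>v w"
  proof (rule eq_vecI)
    fix i assume "i < dim_vec (Im z \<cdot>\<^sub>v u + Re z \<cdot>\<^sub>v w)"
    then show "(A *\<^sub>v w) $ i = (Im z \<cdot>\<^sub>v u + Re z \<cdot>\<^sub>v w) $ i"
      using arg_cong[OF comp[of i], of Im] v(1) by (simp add: scalar_prod_def atLeast0LessThan u_def w_def)
  qed simp
  have sym: "w \<bullet> (X *\<^sub>v u) = u \<bullet> (X *\<^sub>v w)"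
    using scalar_prod_transpose[of u X w] Xs by (simp add: scalar_prod_commute[of "X *\<^sub>v u" w])
  have "(A *\<^sub>v u) \<bullet> (X *\<^sub>v (A *\<^sub>v u)) + (A *\<^sub>v w) \<bullet> (X *\<^sub>v (A *\<^sub>v w))
     = (cmod z)\<^sup>2 * (u \<bullet> (X *\<^sub>v u) + w \<bullet> (X *\<^sub>v w))"
    unfolding Au Aw cmod_power2
    by (simp add: dim_rules sym) (simp add: algebra_simps power2_eq_square)
  moreover have "u \<noteq> 0\<^sub>v n \<or> w \<noteq> 0\<^sub>v n"
  proof (rule ccontr)
    assume "\<not> ?thesis"
    then have "Re (v $ i) = 0" "Im (v $ i) = 0" if "i < n" for i
      using that v(1) by (metis index_map_vec(1) index_zero_vec(1) u_def, metis index_map_vec(1) index_zero_vec(1) w_def)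
    then have "v = 0\<^sub>v n" using v(1) by (intro eq_vecI) (auto simp: complex_eq_iff)
    then show False using v(2) by simp
  qed
  then have "(A *\<^sub>v u) \<bullet> (X *\<^sub>v (A *\<^sub>v u)) + (A *\<^sub>v w) \<bullet> (X *\<^sub>v (A *\<^sub>v w)) < u \<bullet> (X *\<^sub>v u) + w \<bullet> (X *\<^sub>v w)"
    "0 < u \<bullet> (X *\<^sub>v u) + w \<bullet> (X *\<^sub>v w)"
    using decr[of u] decr[of w] Xpos[of u] Xpos[of w]
    by (cases "u = 0\<^sub>v n"; cases "w = 0\<^sub>v n"; force simp: dim_rules)+
  ultimately have "(cmod z)\<^sup>2 < 1" by (simp add: mult_less_cancel_right)
  then show ?thesis by (simp add: power_less_one_iff abs_square_less_1)
qed

lemma smult_pow_mat: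
  "A \<in> carrier_mat n n \<Longrightarrow> (c \<cdot>\<^sub>m A) ^\<^sub>m k = (c ^ k) \<cdot>\<^sub>m (A ^\<^sub>m k)" for A :: "complex mat"
proof (induction k)
  case 0 then show ?case by (auto intro!: eq_matI)
next
  case (Suc k)
  have "A ^\<^sub>m k \<in> carrier_mat n n" using Suc.prems by (rule pow_carrier_mat)
  then show ?case using Suc
    by (simp add: mult_smult_distrib[of _ n n _ n] mult_smult_assoc_mat[of _ n n _ n])
       (intro eq_matI; simp add: mult_ac)
qed

text \<open>The powers decay geometrically: after division by a number between the spectral radius and 1 the
matrix still has spectral radius below 1, so its powers are bounded.\<close>

lemma summable_abs_matrix_power:
  fixes A :: "real mat"
  assumes A: "A \<in> carrier_mat n n"
    and ev: "\<And>z. eigenvalue (map_mat complex_of_real A) z \<Longrightarrow> cmod z < 1"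
    and ij: "i < n" "j < n"
  shows "summable (\<lambda>k. \<bar>(A ^\<^sub>m k) $$ (i, j)\<bar>)"
proof -
  define CA where "CA = map_mat complex_of_real A"
  have CA: "CA \<in> carrier_mat n n" using A by (simp add: CA_def)
  have n: "0 < n" using ij by simp
  have sr: "spectral_radius CA < 1"
  proof -
    obtain z where "eigenvalue CA z" "spectral_radius CA = cmod z"
      using spectral_radius_mem_max(1)[OF CA n] by (auto simp: spectrum_def)
    then show ?thesis using ev by (simp add: CA_def)
  qed
  have sr0: "0 \<le> spectral_radius CA" using spectral_radius_mem_max(1)[OF CA n] by auto
  define r where "r = (1 + spectral_radius CA) / 2"
  have r: "0 < r" "r < 1" "spectral_radius CA < r" using sr sr0 by (simp_all add: r_def)
  define B where "B = complex_of_real (1 / r) \<cdot>\<^sub>m CA"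
  have B: "B \<in> carrier_mat n n" using CA by (simp add: B_def)
  have "spectral_radius B < 1"
  proof -
    obtain z where z: "eigenvalue B z" "spectral_radius B = cmod z"
      using spectral_radius_mem_max(1)[OF B n] by (auto simp: spectrum_def)
    obtain v where v: "dim_vec v = n" "v \<noteq> 0\<^sub>v n" "B *\<^sub>v v = z \<cdot>\<^sub>v v"
      using z(1) B unfolding eigenvalue_def eigenvector_def by auto
    have "CA *\<^sub>v v = complex_of_real r \<cdot>\<^sub>v (B *\<^sub>v v)"
      using r v(1) CA by (intro eq_vecI) (simp_all add: B_def smult_mult_vec)
    also have "\<dots> = (r * z) \<cdot>\<^sub>v v" using v by (intro eq_vecI) auto
    finally have "eigenvalue CA (r * z)"
      using v CA unfolding eigenvalue_def eigenvector_def by auto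
    then have "cmod (r * z) \<le> spectral_radius CA"
      using spectral_radius_mem_max(2)[OF CA n] by (auto simp: spectrum_def)
    then have "r * cmod z \<le> spectral_radius CA" using r by (simp add: norm_mult)
    then have "r * cmod z < r * 1" using r(3) by linarith
    then show ?thesis using r z(2) by simp
  qed
  then obtain c where c: "norm_bound (B ^\<^sub>m k) c" for k
    using spectral_radius_jnf_norm_bound_less_1_upper_triangular[OF B] by blast
  have bound: "\<bar>(A ^\<^sub>m k) $$ (i, j)\<bar> \<le> c * r ^ k" for k
  proof -
    have Ak: "A ^\<^sub>m k \<in> carrier_mat n n" using A by (rule pow_carrier_mat)
    have "CA ^\<^sub>m k = map_mat complex_of_real (A ^\<^sub>m k)"
      unfolding CA_def by (rule of_real_hom.mat_hom_pow[OF A, symmetric])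
    then have "(B ^\<^sub>m k) $$ (i, j) = complex_of_real ((1 / r) ^ k) * complex_of_real ((A ^\<^sub>m k) $$ (i, j))"
      unfolding B_def smult_pow_mat[OF CA] using Ak ij by simp
    then have "cmod ((B ^\<^sub>m k) $$ (i, j)) = (1 / r) ^ k * \<bar>(A ^\<^sub>m k) $$ (i, j)\<bar>"
      using r by (simp add: norm_mult norm_power norm_divide)
    moreover have "cmod ((B ^\<^sub>m k) $$ (i, j)) \<le> c"
      using c[of k] B ij unfolding norm_bound_def by (metis carrier_matD pow_carrier_mat)
    ultimately have "(1 / r) ^ k * \<bar>(A ^\<^sub>m k) $$ (i, j)\<bar> * r ^ k \<le> c * r ^ k"
      using r by (intro mult_right_mono) simp_all
    then show ?thesis using r by (simp add: power_one_over)
  qed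
  have "summable (\<lambda>k. c * r ^ k)" using r by (intro summable_mult summable_geometric) simp
  then show ?thesis by (rule summable_comparison_test'[where N = 0]) (use bound in simp)
qed

text \<open>The state matrix of the cascade is block triangular, so an eigenvector yields one of \<open>G\<close> if its
second block is nonzero, and otherwise one of \<open>F\<close>.\<close>

lemma cascade_stable:
  assumes F: "is_lti n m p F" "stable_system F" and G: "is_lti nf k m G" "stable_system G"
  shows "is_lti (n + nf) k p (cascade F G)" and "stable_system (cascade F G)"
proof -
  note d = F(1)[unfolded is_lti_def] G(1)[unfolded is_lti_def]
  note [simp] = d[simplified]
  show "is_lti (n + nf) k p (cascade F G)"
    by (simp add: is_lti_def cascade_def append_rows_def append_cols_def)
  show "stable_system (cascade F G)"
    unfolding stable_system_def
  proof (intro allI impI)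
    fix z
    let ?c = "map_mat complex_of_real"
    assume "eigenvalue (?c (sysA (cascade F G))) z"
    then obtain v where v: "v \<in> carrier_vec (n + nf)" "v \<noteq> 0\<^sub>v (n + nf)" "?c (sysA (cascade F G)) *\<^sub>v v = z \<cdot>\<^sub>v v"
      unfolding eigenvalue_def eigenvector_def by (auto simp: cascade_def)
    obtain a b where ab: "a \<in> carrier_vec n" "b \<in> carrier_vec nf" "v = a @\<^sub>v b"
      using vec_append_split[OF v(1)] by blast
    have "?c (sysA (cascade F G)) = four_block_mat (?c (sysA F)) (?c (sysB F * sysC G)) (0\<^sub>m nf n) (?c (sysA G))"
      unfolding cascade_def by (rule eq_matI) auto
    then have "?c (sysA (cascade F G)) *\<^sub>v v = (?c (sysA F) *\<^sub>v a + ?c (sysB F * sysC G) *\<^sub>v b) @\<^sub>v (0\<^sub>m nf n *\<^sub>v a + ?c (sysA G) *\<^sub>v b)"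
      using ab by (simp only: ab(3)) (intro four_block_mat_mult_vec[of _ n n _ nf _ nf], simp_all)
    moreover have "z \<cdot>\<^sub>v v = (z \<cdot>\<^sub>v a) @\<^sub>v (z \<cdot>\<^sub>v b)" unfolding ab(3) using ab by (intro eq_vecI) auto
    ultimately have "(?c (sysA F) *\<^sub>v a + ?c (sysB F * sysC G) *\<^sub>v b) @\<^sub>v (0\<^sub>m nf n *\<^sub>v a + ?c (sysA G) *\<^sub>v b) = (z \<cdot>\<^sub>v a) @\<^sub>v (z \<cdot>\<^sub>v b)"
      using v(3) by simp
    then have e: "?c (sysA F) *\<^sub>v a + ?c (sysB F * sysC G) *\<^sub>v b = z \<cdot>\<^sub>v a" "0\<^sub>m nf n *\<^sub>v a + ?c (sysA G) *\<^sub>v b = z \<cdot>\<^sub>v b"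
      using ab by (simp_all add: append_vec_eq[of _ n])
    show "cmod z < 1"
    proof (cases "b = 0\<^sub>v nf")
      case True
      then have "a \<noteq> 0\<^sub>v n" using v(2) ab append_vec_eq_zero[OF ab(1,2)] by auto
      moreover have "?c (sysA F) *\<^sub>v a = z \<cdot>\<^sub>v a" using e(1) True ab by (simp add: dim_rules)
      ultimately have "eigenvalue (?c (sysA F)) z" using ab unfolding eigenvalue_def eigenvector_def by auto
      then show ?thesis using F(2) by (simp add: stable_system_def)
    next
      case False
      moreover have "?c (sysA G) *\<^sub>v b = z \<cdot>\<^sub>v b" using e(2) ab by (simp add: dim_rules)
      ultimately have "eigenvalue (?c (sysA G)) z" using ab unfolding eigenvalue_def eigenvector_def by auto
      then show ?thesis using G(2) by (simp add: stable_system_def)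
    qed
  qed
qed

section \<open>Moving averages of white noise\<close>

lemma prob_space_noise: "prob_space noise_space"
  unfolding noise_space_def
  by (intro prob_space_PiM prob_space_normal_density) simp

interpretation noise: prob_space noise_space
  by (rule prob_space_noise)

lemma noise_coordinate_measurable [measurable]: "(\<lambda>\<omega>. \<omega> a) \<in> borel_measurable noise_space"
proof -
  have "(\<lambda>\<omega>. \<omega> a) \<in> measurable noise_space std_normal_distribution"
    unfolding noise_space_def by (rule measurable_component_singleton) simp
  then show ?thesis by simp
qed

lemma noise_coordinate_distr:
  "distr noise_space std_normal_distribution (\<lambda>\<omega>. \<omega> a) = std_normal_distribution"
  unfolding noise_space_def by (rule distr_PiM_component) (auto intro: prob_space_normal_density)

lemma noise_coordinate_integral:
  fixes h :: "real \<Rightarrow> real"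
  assumes [measurable]: "h \<in> borel_measurable borel"
  shows "integral\<^sup>L noise_space (\<lambda>\<omega>. h (\<omega> a)) = integral\<^sup>L std_normal_distribution h"
    and "integrable noise_space (\<lambda>\<omega>. h (\<omega> a)) \<longleftrightarrow> integrable std_normal_distribution h"
proof -
  have m: "(\<lambda>\<omega>. \<omega> a) \<in> measurable noise_space std_normal_distribution" by simp
  show "integral\<^sup>L noise_space (\<lambda>\<omega>. h (\<omega> a)) = integral\<^sup>L std_normal_distribution h"
    using integral_distr[OF m, of h] unfolding noise_coordinate_distr by simp
  show "integrable noise_space (\<lambda>\<omega>. h (\<omega> a)) \<longleftrightarrow> integrable std_normal_distribution h"
    using integrable_distr_eq[OF m, of h] unfolding noise_coordinate_distr by simp
qed

text \<open>The coordinates of the noise form an orthonormal system. All second moments below follow from this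
alone.\<close>

lemma noise_orthonormal:
  "integral\<^sup>L noise_space (\<lambda>\<omega>. \<omega> a * \<omega> b) = (if a = b then 1 else 0)"
proof (cases "a = b")
  case True
  have "integral\<^sup>L noise_space (\<lambda>\<omega>. (\<omega> a)\<^sup>2) = 1"
    using std_normal_distribution_even_moments(1)[of 1] by (subst noise_coordinate_integral(1)) (simp_all add: fact_numeral)
  then show ?thesis using True by (simp add: power2_eq_square)
next
  case False
  interpret P: product_prob_space "\<lambda>_::int \<times> nat. std_normal_distribution" UNIV
    by (intro product_prob_spaceI prob_space_normal_density) simp
  let ?J = "{a, b}"
  have "integral\<^sup>L noise_space (\<lambda>\<omega>. \<omega> a * \<omega> b)
      = integral\<^sup>L noise_space (\<lambda>\<omega>. (\<lambda>x. \<Prod>i\<in>?J. x i) (restrict \<omega> ?J))"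
    using False by simp
  also have "\<dots> = integral\<^sup>L (distr noise_space (Pi\<^sub>M ?J (\<lambda>_. std_normal_distribution)) (\<lambda>\<omega>. restrict \<omega> ?J)) (\<lambda>x. \<Prod>i\<in>?J. x i)"
    unfolding noise_space_def
  proof (rule integral_distr[symmetric])
    show "(\<lambda>\<omega>. restrict \<omega> ?J) \<in> measurable (Pi\<^sub>M UNIV (\<lambda>_. std_normal_distribution)) (Pi\<^sub>M ?J (\<lambda>_. std_normal_distribution))"
      by (rule measurable_restrict_subset) simp
    show "(\<lambda>x. \<Prod>i\<in>?J. x i) \<in> borel_measurable (Pi\<^sub>M ?J (\<lambda>_. std_normal_distribution))"
    proof (rule borel_measurable_prod)
      fix i assume "i \<in> ?J"
      from measurable_component_singleton[OF this, of "\<lambda>_. std_normal_distribution"]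
      show "(\<lambda>x. x i) \<in> borel_measurable (Pi\<^sub>M ?J (\<lambda>_. std_normal_distribution))" by simp
    qed
  qed
  also have "distr noise_space (Pi\<^sub>M ?J (\<lambda>_. std_normal_distribution)) (\<lambda>\<omega>. restrict \<omega> ?J) = Pi\<^sub>M ?J (\<lambda>_. std_normal_distribution)"
    unfolding noise_space_def by (rule P.distr_PiM_restrict_finite) auto
  also have "integral\<^sup>L \<dots> (\<lambda>x. \<Prod>i\<in>?J. x i) = (\<Prod>i\<in>?J. integral\<^sup>L std_normal_distribution (\<lambda>x. x))"
    using integrable_std_normal_distribution_moment[of 1] by (intro P.product_integral_prod) auto
  also have "\<dots> = 0" using integral_std_normal_distribution_moment_odd[of 1] False by simp
  finally show ?thesis using False by simp
qed

definition square_integrable :: "((int \<times> nat \<Rightarrow> real) \<Rightarrow> real) \<Rightarrow> bool" where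
  "square_integrable f \<longleftrightarrow> f \<in> borel_measurable noise_space \<and> integrable noise_space (\<lambda>\<omega>. (f \<omega>)\<^sup>2)"

lemma abs_mult_le_sum_squares: "\<bar>x * y\<bar> \<le> x\<^sup>2 + y\<^sup>2" for x y :: real
proof -
  have "2 * \<bar>x\<bar> * \<bar>y\<bar> \<le> x\<^sup>2 + y\<^sup>2" using sum_squares_bound[of "\<bar>x\<bar>" "\<bar>y\<bar>"] by simp
  moreover have "0 \<le> \<bar>x\<bar> * \<bar>y\<bar>" by simp
  ultimately show ?thesis unfolding abs_mult by linarith
qed

lemma square_integrable_mult:
  assumes "square_integrable f" "square_integrable g"
  shows "integrable noise_space (\<lambda>\<omega>. f \<omega> * g \<omega>)"
proof (rule Bochner_Integration.integrable_bound)
  show "integrable noise_space (\<lambda>\<omega>. (f \<omega>)\<^sup>2 + (g \<omega>)\<^sup>2)"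
    using assms by (auto simp: square_integrable_def)
  show "(\<lambda>\<omega>. f \<omega> * g \<omega>) \<in> borel_measurable noise_space"
    using assms by (auto simp: square_integrable_def)
  show "AE \<omega> in noise_space. norm (f \<omega> * g \<omega>) \<le> norm ((f \<omega>)\<^sup>2 + (g \<omega>)\<^sup>2)"
    using abs_mult_le_sum_squares by (intro AE_I2) simp
qed

lemma square_integrable_const: "square_integrable (\<lambda>_. c)"
  by (simp add: square_integrable_def)

lemma square_integrable_integrable: "square_integrable f \<Longrightarrow> integrable noise_space f"
  using square_integrable_mult[OF _ square_integrable_const[of 1]] by simp

lemma square_integrable_cmult: "square_integrable f \<Longrightarrow> square_integrable (\<lambda>\<omega>. c * f \<omega>)"
  by (auto simp: square_integrable_def power_mult_distrib)

lemma square_integrable_add: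
  assumes "square_integrable f" "square_integrable g"
  shows "square_integrable (\<lambda>\<omega>. f \<omega> + g \<omega>)"
  using assms square_integrable_mult[OF assms]
  by (auto simp: square_integrable_def power2_sum mult.assoc)

lemma square_integrable_diff:
  assumes "square_integrable f" "square_integrable g"
  shows "square_integrable (\<lambda>\<omega>. f \<omega> - g \<omega>)"
  using square_integrable_add[OF assms(1) square_integrable_cmult[OF assms(2), of "-1"]] by simp

lemma square_integrable_sum:
  "(\<And>i. i \<in> I \<Longrightarrow> square_integrable (f i)) \<Longrightarrow> square_integrable (\<lambda>\<omega>. \<Sum>i\<in>I. f i \<omega>)"
  by (induction I rule: infinite_finite_induct)
     (auto simp: square_integrable_const intro: square_integrable_add)

lemma square_integrable_noise: "square_integrable (\<lambda>\<omega>. \<omega> a)"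
  using integrable_std_normal_distribution_moment[of 2] noise_coordinate_integral(2)[of "\<lambda>x. x\<^sup>2" a]
  by (simp add: square_integrable_def)

text \<open>By monotone convergence the sum has finite expectation, hence is finite almost everywhere.\<close>

lemma AE_summable_of_summable_integral:
  fixes X :: "nat \<Rightarrow> 'a \<Rightarrow> real"
  assumes X: "\<And>k. integrable M (X k)" "\<And>k \<omega>. 0 \<le> X k \<omega>" and s: "summable (\<lambda>k. integral\<^sup>L M (X k))"
  shows "AE \<omega> in M. summable (\<lambda>k. X k \<omega>)" and "integrable M (\<lambda>\<omega>. \<Sum>k. X k \<omega>)"
proof -
  have [measurable]: "X k \<in> borel_measurable M" for k using X(1) by auto
  have "(\<integral>\<^sup>+ \<omega>. (\<Sum>k. ennreal (X k \<omega>)) \<partial>M) = (\<Sum>k. \<integral>\<^sup>+ \<omega>. ennreal (X k \<omega>) \<partial>M)"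
    by (rule nn_integral_suminf) simp
  also have "\<dots> = (\<Sum>k. ennreal (integral\<^sup>L M (X k)))"
    using X by (simp add: nn_integral_eq_integral)
  also have "\<dots> = ennreal (\<Sum>k. integral\<^sup>L M (X k))"
    using X s by (intro suminf_ennreal2) (auto intro!: integral_nonneg_AE)
  finally have "(\<integral>\<^sup>+ \<omega>. (\<Sum>k. ennreal (X k \<omega>)) \<partial>M) \<noteq> \<infinity>" by simp
  then have "AE \<omega> in M. (\<Sum>k. ennreal (X k \<omega>)) \<noteq> \<infinity>"
    by (intro nn_integral_PInf_AE) auto
  then show ae: "AE \<omega> in M. summable (\<lambda>k. X k \<omega>)"
    using X(2) by (auto elim!: eventually_mono intro!: summable_suminf_not_top)
  show "integrable M (\<lambda>\<omega>. \<Sum>k. X k \<omega>)"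
    using X ae s by (intro integrable_suminf) simp_all
qed

text \<open>Moving averages of the noise: \<open>f k j\<close> is the weight of the \<open>j\<close>-th noise component \<open>k\<close> steps before
time \<open>t\<close>. The truncated version describes systems started at rest.\<close>

definition filtered_upto :: "nat \<Rightarrow> (nat \<Rightarrow> nat \<Rightarrow> real) \<Rightarrow> nat \<Rightarrow> int \<Rightarrow> (int \<times> nat \<Rightarrow> real) \<Rightarrow> real" where
  "filtered_upto m f N t \<omega> = (\<Sum>k<N. \<Sum>j<m. f k j * \<omega> (t - int k, j))"

definition filtered :: "nat \<Rightarrow> (nat \<Rightarrow> nat \<Rightarrow> real) \<Rightarrow> int \<Rightarrow> (int \<times> nat \<Rightarrow> real) \<Rightarrow> real" where
  "filtered m f t \<omega> = (\<Sum>k. \<Sum>j<m. f k j * \<omega> (t - int k, j))"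

definition summable_response :: "nat \<Rightarrow> (nat \<Rightarrow> nat \<Rightarrow> real) \<Rightarrow> bool" where
  "summable_response m f \<longleftrightarrow> (\<forall>j<m. summable (\<lambda>k. \<bar>f k j\<bar>))"

lemma integral_filtered_upto:
  "integral\<^sup>L noise_space (\<lambda>\<omega>. filtered_upto m f N t \<omega> * filtered_upto m g N t \<omega>) = (\<Sum>k<N. \<Sum>j<m. f k j * g k j)"
proof -
  let ?I = "{..<N} \<times> {..<m}"
  define x where "x p \<omega> = \<omega> (t - int (fst p), snd p)" for p :: "nat \<times> nat" and \<omega> :: "int \<times> nat \<Rightarrow> real"
  have x: "square_integrable (x p)" for p unfolding x_def by (rule square_integrable_noise)
  have E: "integral\<^sup>L noise_space (\<lambda>\<omega>. x p \<omega> * x q \<omega>) = (if p = q then 1 else 0)" for p q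
    unfolding x_def noise_orthonormal by (cases p; cases q) auto
  have u: "filtered_upto m f N t \<omega> = (\<Sum>p\<in>?I. case_prod f p * x p \<omega>)" for f \<omega>
    unfolding filtered_upto_def x_def by (subst sum.cartesian_product) (simp add: case_prod_beta)
  have "integral\<^sup>L noise_space (\<lambda>\<omega>. filtered_upto m f N t \<omega> * filtered_upto m g N t \<omega>)
      = integral\<^sup>L noise_space (\<lambda>\<omega>. \<Sum>p\<in>?I. \<Sum>q\<in>?I. (case_prod f p * case_prod g q) * (x p \<omega> * x q \<omega>))"
    unfolding u sum_product by (simp add: mult_ac)
  also have "\<dots> = (\<Sum>p\<in>?I. \<Sum>q\<in>?I. (case_prod f p * case_prod g q) * integral\<^sup>L noise_space (\<lambda>\<omega>. x p \<omega> * x q \<omega>))"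
    using square_integrable_mult[OF x x] by simp
  also have "\<dots> = (\<Sum>p\<in>?I. case_prod f p * case_prod g p)"
    unfolding E by (intro sum.cong) (simp_all add: if_distrib cong: if_cong)
  also have "\<dots> = (\<Sum>k<N. \<Sum>j<m. f k j * g k j)"
    by (subst sum.cartesian_product) (simp add: case_prod_beta)
  finally show ?thesis .
qed

text \<open>The Cauchy-Schwarz inequality with weights \<open>|f k j|\<close>. The right-hand side increases with \<open>N\<close> to an
integrable limit if the weights are summable, which provides the majorant for dominated
convergence.\<close>

lemma filtered_upto_square_le:
  "(filtered_upto m f N t \<omega>)\<^sup>2 \<le> (\<Sum>k<N. \<Sum>j<m. \<bar>f k j\<bar>) * (\<Sum>k<N. \<Sum>j<m. \<bar>f k j\<bar> * (\<omega> (t - int k, j))\<^sup>2)"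
proof -
  let ?I = "{..<N} \<times> {..<m}"
  define a where "a p = sqrt \<bar>case_prod f p\<bar>" for p
  define b where "b p = sgn (case_prod f p) * sqrt \<bar>case_prod f p\<bar> * \<omega> (t - int (fst p), snd p)" for p
  have "(\<Sum>p\<in>?I. a p * b p)\<^sup>2 \<le> (\<Sum>p\<in>?I. (a p)\<^sup>2) * (\<Sum>p\<in>?I. (b p)\<^sup>2)"
    by (rule Cauchy_Schwarz_ineq_sum)
  moreover have "a p * b p = case_prod f p * \<omega> (t - int (fst p), snd p)" for p
    by (simp add: a_def b_def mult_ac) (simp add: abs_mult_sgn)
  moreover have "(b p)\<^sup>2 = \<bar>case_prod f p\<bar> * (\<omega> (t - int (fst p), snd p))\<^sup>2" for p
    by (simp add: b_def power_mult_distrib sgn_if)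
  moreover have "(a p)\<^sup>2 = \<bar>case_prod f p\<bar>" for p by (simp add: a_def)
  ultimately show ?thesis
    unfolding filtered_upto_def by (simp add: sum.cartesian_product case_prod_beta)
qed

lemma AE_summable_filtered:
  assumes f: "summable_response m f"
  shows "AE \<omega> in noise_space. summable (\<lambda>k. \<Sum>j<m. \<bar>f k j\<bar> * (\<omega> (t - int k, j))\<^sup>2)"
    and "integrable noise_space (\<lambda>\<omega>. \<Sum>k. \<Sum>j<m. \<bar>f k j\<bar> * (\<omega> (t - int k, j))\<^sup>2)"
proof -
  have "integral\<^sup>L noise_space (\<lambda>\<omega>. (\<omega> a)\<^sup>2) = 1" for a
    using noise_orthonormal[of a a] by (simp add: power2_eq_square)
  moreover have i: "integrable noise_space (\<lambda>\<omega>. (\<omega> a)\<^sup>2)" for a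
    using square_integrable_noise[of a] by (simp add: square_integrable_def)
  ultimately have E: "integral\<^sup>L noise_space (\<lambda>\<omega>. \<Sum>j<m. \<bar>f k j\<bar> * (\<omega> (t - int k, j))\<^sup>2) = (\<Sum>j<m. \<bar>f k j\<bar>)" for k
    by simp
  have "summable (\<lambda>k. \<Sum>j<m. \<bar>f k j\<bar>)" using f by (auto simp: summable_response_def intro!: summable_sum)
  then have "summable (\<lambda>k. integral\<^sup>L noise_space (\<lambda>\<omega>. \<Sum>j<m. \<bar>f k j\<bar> * (\<omega> (t - int k, j))\<^sup>2))"
    unfolding E .
  note * = AE_summable_of_summable_integral[OF _ _ this]
  show "AE \<omega> in noise_space. summable (\<lambda>k. \<Sum>j<m. \<bar>f k j\<bar> * (\<omega> (t - int k, j))\<^sup>2)"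
    and "integrable noise_space (\<lambda>\<omega>. \<Sum>k. \<Sum>j<m. \<bar>f k j\<bar> * (\<omega> (t - int k, j))\<^sup>2)"
    by (rule *; use i in \<open>simp add: sum_nonneg\<close>)+
qed

lemma AE_filtered_convergent:
  assumes f: "summable_response m f"
  shows "AE \<omega> in noise_space. summable (\<lambda>k. \<Sum>j<m. f k j * \<omega> (t - int k, j))"
  using AE_summable_filtered(1)[OF f, of t]
proof eventually_elim
  case (elim \<omega>)
  have "summable (\<lambda>k. \<Sum>j<m. \<bar>f k j\<bar>)" using f by (auto simp: summable_response_def intro!: summable_sum)
  from summable_add[OF this elim] show ?case
  proof (rule summable_comparison_test'[where N = 0])
    fix k
    have "\<bar>x\<bar> \<le> 1 + x\<^sup>2" for x :: real
      using abs_mult_le_sum_squares[of 1 x] by simp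
    then have "\<bar>f k j * x\<bar> \<le> \<bar>f k j\<bar> + \<bar>f k j\<bar> * x\<^sup>2" for j x
      using mult_left_mono[of "\<bar>x\<bar>" "1 + x\<^sup>2" "\<bar>f k j\<bar>"] by (simp add: abs_mult distrib_left)
    then show "norm (\<Sum>j<m. f k j * \<omega> (t - int k, j)) \<le> (\<Sum>j<m. \<bar>f k j\<bar>) + (\<Sum>j<m. \<bar>f k j\<bar> * (\<omega> (t - int k, j))\<^sup>2)"
      unfolding real_norm_def sum.distrib[symmetric]
      by (intro order_trans[OF sum_abs] sum_mono)
  qed
qed

lemma filtered_measurable [measurable]:
  "filtered m f t \<in> borel_measurable noise_space" "filtered_upto m f N t \<in> borel_measurable noise_space"
  unfolding filtered_def filtered_upto_def by measurable

text \<open>Dominated convergence applied to products of truncated moving averages, whose expectations are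
known by orthonormality. The value does not involve \<open>t\<close>, which is how stationarity enters the later
arguments.\<close>

theorem filtered_second_moments:
  assumes f: "summable_response m f" and g: "summable_response m g"
  shows "square_integrable (filtered m f t)"
    and "(\<lambda>k. \<Sum>j<m. f k j * g k j) sums integral\<^sup>L noise_space (\<lambda>\<omega>. filtered m f t \<omega> * filtered m g t \<omega>)"
proof -
  have main: "integrable noise_space (\<lambda>\<omega>. filtered m f t \<omega> * filtered m g t \<omega>) \<and>
      (\<lambda>N. integral\<^sup>L noise_space (\<lambda>\<omega>. filtered_upto m f N t \<omega> * filtered_upto m g N t \<omega>))
        \<longlonglongrightarrow> integral\<^sup>L noise_space (\<lambda>\<omega>. filtered m f t \<omega> * filtered m g t \<omega>)"
    if f: "summable_response m f" and g: "summable_response m g" for f g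
  proof -
    define D where "D f \<omega> = (\<Sum>k. \<Sum>j<m. \<bar>f k j\<bar>) * (\<Sum>k. \<Sum>j<m. \<bar>f k j\<bar> * (\<omega> (t - int k, j))\<^sup>2)"
      for f :: "nat \<Rightarrow> nat \<Rightarrow> real" and \<omega>
    have D: "AE \<omega> in noise_space. \<forall>N. (filtered_upto m f N t \<omega>)\<^sup>2 \<le> D f \<omega>" if f: "summable_response m f" for f
      using AE_summable_filtered(1)[OF f, of t]
    proof eventually_elim
      case (elim \<omega>)
      have "summable (\<lambda>k. \<Sum>j<m. \<bar>f k j\<bar>)" using f by (auto simp: summable_response_def intro!: summable_sum)
      then show ?case unfolding D_def using elim
        by (intro allI order_trans[OF filtered_upto_square_le] mult_mono sum_le_suminf suminf_nonneg sum_nonneg)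
           (simp_all add: sum_nonneg)
    qed
    have lim: "AE \<omega> in noise_space. (\<lambda>N. filtered_upto m f N t \<omega>) \<longlonglongrightarrow> filtered m f t \<omega>" if f: "summable_response m f" for f
      using AE_filtered_convergent[OF f, of t]
      by eventually_elim (simp add: filtered_def filtered_upto_def summable_LIMSEQ)
    have l: "AE \<omega> in noise_space. (\<lambda>N. filtered_upto m f N t \<omega> * filtered_upto m g N t \<omega>) \<longlonglongrightarrow> filtered m f t \<omega> * filtered m g t \<omega>"
      using lim[OF f] lim[OF g] by eventually_elim (rule tendsto_mult)
    have b: "AE \<omega> in noise_space. norm (filtered_upto m f N t \<omega> * filtered_upto m g N t \<omega>) \<le> D f \<omega> + D g \<omega>" for N
      using D[OF f] D[OF g]
    proof eventually_elim
      case (elim \<omega>)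
      have "(filtered_upto m f N t \<omega>)\<^sup>2 \<le> D f \<omega>" "(filtered_upto m g N t \<omega>)\<^sup>2 \<le> D g \<omega>" using elim by simp_all
      then show ?case
        using abs_mult_le_sum_squares[of "filtered_upto m f N t \<omega>" "filtered_upto m g N t \<omega>"] by simp
    qed
    have w: "integrable noise_space (\<lambda>\<omega>. D f \<omega> + D g \<omega>)"
      unfolding D_def using AE_summable_filtered(2)[OF f] AE_summable_filtered(2)[OF g] by simp
    have m1: "(\<lambda>\<omega>. filtered m f t \<omega> * filtered m g t \<omega>) \<in> borel_measurable noise_space"
      and m2: "(\<lambda>\<omega>. filtered_upto m f N t \<omega> * filtered_upto m g N t \<omega>) \<in> borel_measurable noise_space" for N
      by (intro borel_measurable_times filtered_measurable)+
    show ?thesis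
      by (intro conjI integrable_dominated_convergence[OF m1 m2 w l b] integral_dominated_convergence[OF m1 m2 w l b])
  qed
  show "square_integrable (filtered m f t)"
    using main[OF f f] by (simp add: square_integrable_def power2_eq_square)
  show "(\<lambda>k. \<Sum>j<m. f k j * g k j) sums integral\<^sup>L noise_space (\<lambda>\<omega>. filtered m f t \<omega> * filtered m g t \<omega>)"
    using main[OF f g] unfolding integral_filtered_upto sums_def by simp
qed

section \<open>Stationary outputs and the H2 norm\<close>

text \<open>The impulse responses from the noise to one component of the state and of the output. The state
reacts with a delay of one step, so the state at time \<open>t\<close> is the moving average with these weights
at time \<open>t - 1\<close>.\<close>

definition state_response :: "lti \<Rightarrow> nat \<Rightarrow> nat \<Rightarrow> nat \<Rightarrow> real" where
  "state_response G i k j = (sysA G ^\<^sub>m k * sysB G) $$ (i, j)"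

definition output_response :: "lti \<Rightarrow> nat \<Rightarrow> nat \<Rightarrow> nat \<Rightarrow> real" where
  "output_response G i k j = (case k of 0 \<Rightarrow> sysD G $$ (i, j)
     | Suc l \<Rightarrow> \<Sum>s<dim_row (sysA G). sysC G $$ (i, s) * state_response G s l j)"

lemma pow_mat_commute:
  fixes A :: "real mat"
  assumes A: "A \<in> carrier_mat n n"
  shows "A ^\<^sub>m k * A = A * A ^\<^sub>m k"
proof (induction k)
  case 0
  then show ?case using A by simp
next
  case (Suc k)
  have c: "A ^\<^sub>m k \<in> carrier_mat n n" using A by (rule pow_carrier_mat)
  have "A ^\<^sub>m Suc k * A = A * A ^\<^sub>m k * A" using Suc by simp
  also have "\<dots> = A * (A ^\<^sub>m k * A)" by (rule assoc_mult_mat[OF A c A])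
  finally show ?case by simp
qed

lemma mult_vec_index:
  "i < dim_row A \<Longrightarrow> dim_vec v = dim_col A \<Longrightarrow> (A *\<^sub>v v) $ i = (\<Sum>j<dim_col A. A $$ (i, j) * v $ j)"
  by (simp add: scalar_prod_def atLeast0LessThan)

lemma mult_mat_index:
  "i < dim_row A \<Longrightarrow> j < dim_col B \<Longrightarrow> dim_col A = dim_row B \<Longrightarrow>
    (A * B) $$ (i, j) = (\<Sum>k<dim_row B. A $$ (i, k) * B $$ (k, j))"
  by (simp add: scalar_prod_def atLeast0LessThan)

lemma dim_white_noise [simp]: "dim_vec (white_noise m t \<omega>) = m"
  by (simp add: white_noise_def)

lemma white_noise_index [simp]: "j < m \<Longrightarrow> white_noise m t \<omega> $ j = \<omega> (t, j)"
  by (simp add: white_noise_def)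

lemma is_lti_dims:
  assumes "is_lti n m p G"
  shows "dim_row (sysA G) = n" "dim_col (sysA G) = n" "dim_row (sysB G) = n" "dim_col (sysB G) = m"
    "dim_row (sysC G) = p" "dim_col (sysC G) = n" "dim_row (sysD G) = p" "dim_col (sysD G) = m"
    "dim_row (sysA G ^\<^sub>m k) = n" "dim_col (sysA G ^\<^sub>m k) = n"
  using assms by (auto simp: is_lti_def)

lemma state_response_Suc:
  assumes G: "is_lti n m p G" and ij: "i < n" "j < m"
  shows "state_response G i (Suc k) j = (\<Sum>l<n. sysA G $$ (i, l) * state_response G l k j)"
proof -
  note [simp] = is_lti_dims[OF G]
  have A: "sysA G \<in> carrier_mat n n" using G by (simp add: is_lti_def)
  have "sysA G ^\<^sub>m Suc k * sysB G = sysA G * (sysA G ^\<^sub>m k * sysB G)"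
    unfolding pow_mat.simps pow_mat_commute[OF A] by (simp add: mult_assoc_dim)
  then show ?thesis using ij
    by (simp add: state_response_def mult_mat_index del: index_mult_mat(1) pow_mat.simps)
qed

lemma summable_state_response:
  assumes G: "is_lti n m p G" "stable_system G" and i: "i < n"
  shows "summable_response m (state_response G i)"
  unfolding summable_response_def
proof (intro allI impI)
  fix j assume j: "j < m"
  note [simp] = is_lti_dims[OF G(1)]
  have "summable (\<lambda>k. \<bar>(sysA G ^\<^sub>m k) $$ (i, l)\<bar>)" if "l < n" for l
    using G i that by (intro summable_abs_matrix_power[of _ n]) (simp_all add: stable_system_def)
  then have "summable (\<lambda>k. \<Sum>l<n. \<bar>(sysA G ^\<^sub>m k) $$ (i, l)\<bar> * \<bar>sysB G $$ (l, j)\<bar>)"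
    by (intro summable_sum summable_mult2) simp
  then show "summable (\<lambda>k. \<bar>state_response G i k j\<bar>)"
  proof (rule summable_comparison_test'[where N = 0])
    fix k
    show "norm \<bar>state_response G i k j\<bar> \<le> (\<Sum>l<n. \<bar>(sysA G ^\<^sub>m k) $$ (i, l)\<bar> * \<bar>sysB G $$ (l, j)\<bar>)"
      using i j by (simp add: state_response_def mult_mat_index del: index_mult_mat) (auto intro: order_trans[OF sum_abs] simp: abs_mult)
  qed
qed

lemma summable_output_response:
  assumes G: "is_lti n m p G" "stable_system G" and i: "i < p"
  shows "summable_response m (output_response G i)"
  unfolding summable_response_def
proof (intro allI impI)
  fix j assume j: "j < m"
  note [simp] = is_lti_dims[OF G(1)]
  have "summable (\<lambda>k. \<bar>state_response G s k j\<bar>)" if "s < n" for s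
    using summable_state_response[OF G that] j by (simp add: summable_response_def)
  then have "summable (\<lambda>k. \<Sum>s<n. \<bar>sysC G $$ (i, s)\<bar> * \<bar>state_response G s k j\<bar>)"
    by (intro summable_sum summable_mult) simp
  then have "summable (\<lambda>k. \<bar>output_response G i (Suc k) j\<bar>)"
    by (rule summable_comparison_test'[where N = 0])
       (auto simp: output_response_def intro!: order_trans[OF sum_abs] simp: abs_mult)
  then show "summable (\<lambda>k. \<bar>output_response G i k j\<bar>)"
    by (rule summable_Suc_iff[THEN iffD1])
qed

lemma stationary_state_index:
  assumes G: "is_lti n m p G" and i: "i < n"
  shows "stationary_state G t \<omega> $ i = filtered m (state_response G i) (t - 1) \<omega>"
proof -
  note [simp] = is_lti_dims[OF G(1)]
  have "((sysA G ^\<^sub>m k) *\<^sub>v (sysB G *\<^sub>v white_noise m (t - 1 - int k) \<omega>)) $ i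
      = (\<Sum>j<m. state_response G i k j * \<omega> (t - 1 - int k, j))" for k
    using i unfolding state_response_def
    by (subst mult_mult_vec[symmetric]) (simp_all add: mult_vec_index del: index_mult_mat_vec index_mult_mat(1))
  then show ?thesis using i by (simp add: stationary_state_def filtered_def)
qed

text \<open>One null set serves all times and all components, so the identities between the stationary
processes below can be used at every time simultaneously.\<close>

lemma AE_stationary_convergent:
  assumes G: "is_lti n m p G" "stable_system G"
  shows "AE \<omega> in noise_space. \<forall>t. \<forall>i<n. summable (\<lambda>k. \<Sum>j<m. state_response G i k j * \<omega> (t - int k, j))"
proof -
  have "AE \<omega> in noise_space. \<forall>t. \<forall>i\<in>{..<n}. summable (\<lambda>k. \<Sum>j<m. state_response G i k j * \<omega> (t - int k, j))"
    unfolding AE_all_countable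
    by (intro allI AE_finite_allI AE_filtered_convergent summable_state_response[OF G]) auto
  then show ?thesis by (rule eventually_mono) simp
qed

lemma AE_stationary_output_index:
  assumes G: "is_lti n m p G" "stable_system G"
  shows "AE \<omega> in noise_space. \<forall>t. \<forall>i<p. stationary_output G t \<omega> $ i = filtered m (output_response G i) t \<omega>"
  using AE_stationary_convergent[OF G]
proof eventually_elim
  case (elim \<omega>)
  note [simp] = is_lti_dims[OF G(1)]
  have [simp]: "dim_vec (stationary_state G t \<omega>) = n" for t by (simp add: stationary_state_def)
  show ?case
  proof (intro allI impI)
    fix t i assume i: "i < p"
    define h where "h k = (\<Sum>j<m. output_response G i k j * \<omega> (t - int k, j))" for k
    have hS: "h (Suc k) = (\<Sum>s<n. sysC G $$ (i, s) * (\<Sum>j<m. state_response G s k j * \<omega> (t - 1 - int k, j)))" for k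
      unfolding h_def output_response_def
      by (simp add: sum_distrib_left sum_distrib_right mult.assoc algebra_simps)
         (subst sum.swap, simp add: mult_ac)
    have hs: "(\<lambda>k. h (Suc k)) sums (\<Sum>s<n. sysC G $$ (i, s) * stationary_state G t \<omega> $ s)"
      unfolding hS
    proof (intro sums_sum sums_mult)
      fix l assume "l \<in> {..<n}"
      then show "(\<lambda>k. \<Sum>j<m. state_response G l k j * \<omega> (t - 1 - int k, j)) sums (stationary_state G t \<omega> $ l)"
        using elim[rule_format, of l "t - 1"] by (simp add: stationary_state_index[OF G(1)] filtered_def summable_sums)
    qed
    have s: "summable (\<lambda>k. h (Suc k))" by (rule sums_summable[OF hs])
    have "(\<Sum>k. h (Suc k)) = (\<Sum>s<n. sysC G $$ (i, s) * stationary_state G t \<omega> $ s)"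
      by (rule sums_unique[OF hs, symmetric])
    moreover have "(\<Sum>k. h k) = (\<Sum>k. h (Suc k)) + h 0"
      using s by (subst suminf_split_head) (simp_all add: summable_Suc_iff)
    moreover have "h 0 = (\<Sum>j<m. sysD G $$ (i, j) * \<omega> (t, j))"
      by (simp add: h_def output_response_def)
    ultimately show "stationary_output G t \<omega> $ i = filtered m (output_response G i) t \<omega>"
      using i by (simp add: stationary_output_def filtered_def h_def mult_vec_index del: index_mult_mat_vec)
  qed
qed

lemma stationary_state_measurable:
  assumes G: "is_lti n m p G" and i: "i < n"
  shows "(\<lambda>\<omega>. stationary_state G t \<omega> $ i) \<in> borel_measurable noise_space"
  unfolding stationary_state_index[OF G i] by (rule filtered_measurable)

lemma stationary_output_index:
  assumes G: "is_lti n m p G" and i: "i < p"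
  shows "stationary_output G t \<omega> $ i =
    (\<Sum>s<n. sysC G $$ (i, s) * stationary_state G t \<omega> $ s) + (\<Sum>j<m. sysD G $$ (i, j) * \<omega> (t, j))"
proof -
  note [simp] = is_lti_dims[OF G(1)]
  have [simp]: "dim_vec (stationary_state G t \<omega>) = n" for t by (simp add: stationary_state_def)
  show ?thesis using i by (simp add: stationary_output_def mult_vec_index del: index_mult_mat_vec)
qed

lemma stationary_output_measurable:
  assumes G: "is_lti n m p G" and i: "i < p"
  shows "(\<lambda>\<omega>. stationary_output G t \<omega> $ i) \<in> borel_measurable noise_space"
  unfolding stationary_output_index[OF G i]
  by (intro borel_measurable_add borel_measurable_sum borel_measurable_times
      stationary_state_measurable[OF G] noise_coordinate_measurable) auto

lemma stationary_state_square_integrable: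
  assumes G: "is_lti n m p G" "stable_system G" and i: "i < n"
  shows "square_integrable (\<lambda>\<omega>. stationary_state G t \<omega> $ i)"
  unfolding stationary_state_index[OF G(1) i]
  by (rule filtered_second_moments(1)[OF summable_state_response[OF G i] summable_state_response[OF G i]])

lemma stationary_output_square_integrable:
  assumes G: "is_lti n m p G" "stable_system G" and i: "i < p"
  shows "square_integrable (\<lambda>\<omega>. stationary_output G t \<omega> $ i)"
  unfolding stationary_output_index[OF G(1) i]
  by (intro square_integrable_add square_integrable_sum square_integrable_cmult square_integrable_noise
      stationary_state_square_integrable[OF G]) auto

lemma stationary_state_covariance_shift:
  assumes G: "is_lti n m p G" "stable_system G" and ij: "i < n" "j < n"
  shows "integral\<^sup>L noise_space (\<lambda>\<omega>. stationary_state G t \<omega> $ i * stationary_state G t \<omega> $ j)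
     = integral\<^sup>L noise_space (\<lambda>\<omega>. stationary_state G s \<omega> $ i * stationary_state G s \<omega> $ j)"
  unfolding stationary_state_index[OF G(1) ij(1)] stationary_state_index[OF G(1) ij(2)]
  by (rule sums_unique2[OF filtered_second_moments(2)[OF summable_state_response[OF G ij(1)] summable_state_response[OF G ij(2)]]
      filtered_second_moments(2)[OF summable_state_response[OF G ij(1)] summable_state_response[OF G ij(2)]]])

lemma AE_stationary_recursion:
  assumes G: "is_lti n m p G" "stable_system G"
  shows "AE \<omega> in noise_space. \<forall>t. \<forall>i<n. stationary_state G (t + 1) \<omega> $ i =
    (\<Sum>l<n. sysA G $$ (i, l) * stationary_state G t \<omega> $ l) + (\<Sum>j<m. sysB G $$ (i, j) * \<omega> (t, j))"
  using AE_stationary_convergent[OF G]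
proof eventually_elim
  case (elim \<omega>)
  note [simp] = is_lti_dims[OF G(1)]
  show ?case
  proof (intro allI impI)
    fix t i assume i: "i < n"
    define h where "h k = (\<Sum>j<m. state_response G i k j * \<omega> (t - int k, j))" for k
    note sr = state_response_Suc[OF G(1) i]
    have hS: "h (Suc k) = (\<Sum>l<n. sysA G $$ (i, l) * (\<Sum>j<m. state_response G l k j * \<omega> (t - 1 - int k, j)))" for k
      unfolding h_def
      by (simp add: sr sum_distrib_left sum_distrib_right mult.assoc algebra_simps)
         (subst sum.swap, simp add: mult_ac)
    have hs: "(\<lambda>k. h (Suc k)) sums (\<Sum>l<n. sysA G $$ (i, l) * stationary_state G t \<omega> $ l)"
      unfolding hS
    proof (intro sums_sum sums_mult)
      fix l assume "l \<in> {..<n}"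
      then show "(\<lambda>k. \<Sum>j<m. state_response G l k j * \<omega> (t - 1 - int k, j)) sums (stationary_state G t \<omega> $ l)"
        using elim[rule_format, of l "t - 1"] by (simp add: stationary_state_index[OF G(1)] filtered_def summable_sums)
    qed
    have s: "summable (\<lambda>k. h (Suc k))" by (rule sums_summable[OF hs])
    have "(\<Sum>k. h (Suc k)) = (\<Sum>l<n. sysA G $$ (i, l) * stationary_state G t \<omega> $ l)"
      by (rule sums_unique[OF hs, symmetric])
    moreover have "(\<Sum>k. h k) = (\<Sum>k. h (Suc k)) + h 0"
      using s by (subst suminf_split_head) (simp_all add: summable_Suc_iff)
    moreover have "h 0 = (\<Sum>j<m. sysB G $$ (i, j) * \<omega> (t, j))"
      using i G(1) by (simp add: h_def state_response_def is_lti_def)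
    ultimately show "stationary_state G (t + 1) \<omega> $ i =
        (\<Sum>l<n. sysA G $$ (i, l) * stationary_state G t \<omega> $ l) + (\<Sum>j<m. sysB G $$ (i, j) * \<omega> (t, j))"
      using i by (simp add: stationary_state_index[OF G(1)] filtered_def h_def)
  qed
qed

text \<open>Started at rest at time 0, the system reacts only to the noise at the times from 0 to \<open>t\<close>: the output
is the truncation of the moving average that defines the stationary output.\<close>

lemma zero_init_output_index:
  assumes G: "is_lti n m p G" and i: "i < p"
  shows "zero_init_output G (\<lambda>s. white_noise m (int s) \<omega>) t $ i = filtered_upto m (output_response G i) (Suc t) (int t) \<omega>"
proof -
  note [simp] = is_lti_dims[OF G(1)]
  have dim: "dim_vec (zero_init_state G (\<lambda>s. white_noise m (int s) \<omega>) t) = n" for t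
    by (induction t) simp_all
  have st: "zero_init_state G (\<lambda>s. white_noise m (int s) \<omega>) t $ l = filtered_upto m (state_response G l) t (int t - 1) \<omega>"
    if "l < n" for l t using that
  proof (induction t arbitrary: l)
    case 0 then show ?case by (simp add: filtered_upto_def)
  next
    case (Suc t)
    note sr = state_response_Suc[OF G Suc.prems]
    have "zero_init_state G (\<lambda>s. white_noise m (int s) \<omega>) (Suc t) $ l
        = (\<Sum>s<n. sysA G $$ (l, s) * filtered_upto m (state_response G s) t (int t - 1) \<omega>) + (\<Sum>j<m. sysB G $$ (l, j) * \<omega> (int t, j))"
      using Suc by (simp add: mult_vec_index dim del: index_mult_mat_vec)
    also have "(\<Sum>s<n. sysA G $$ (l, s) * filtered_upto m (state_response G s) t (int t - 1) \<omega>)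
        = (\<Sum>k<t. \<Sum>j<m. state_response G l (Suc k) j * \<omega> (int t - int (Suc k), j))"
      by (simp add: filtered_upto_def sr sum_distrib_left sum_distrib_right mult.assoc algebra_simps)
         (subst sum.swap, rule sum.cong[OF refl], subst sum.swap, simp add: mult_ac)
    also have "(\<Sum>j<m. sysB G $$ (l, j) * \<omega> (int t, j)) = (\<Sum>j<m. state_response G l 0 j * \<omega> (int t - int 0, j))"
      using Suc.prems G(1) by (simp add: state_response_def is_lti_def)
    also have "(\<Sum>k<t. \<Sum>j<m. state_response G l (Suc k) j * \<omega> (int t - int (Suc k), j)) + \<dots>
        = filtered_upto m (state_response G l) (Suc t) (int (Suc t) - 1) \<omega>"
      unfolding filtered_upto_def by (simp add: sum.lessThan_Suc_shift algebra_simps del: sum.lessThan_Suc)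
    finally show ?case .
  qed
  have "zero_init_output G (\<lambda>s. white_noise m (int s) \<omega>) t $ i
      = (\<Sum>s<n. sysC G $$ (i, s) * filtered_upto m (state_response G s) t (int t - 1) \<omega>) + (\<Sum>j<m. sysD G $$ (i, j) * \<omega> (int t, j))"
    using i by (simp add: zero_init_output_def mult_vec_index dim st del: index_mult_mat_vec)
  also have "(\<Sum>s<n. sysC G $$ (i, s) * filtered_upto m (state_response G s) t (int t - 1) \<omega>)
      = (\<Sum>k<t. \<Sum>j<m. output_response G i (Suc k) j * \<omega> (int t - int (Suc k), j))"
    by (simp add: filtered_upto_def output_response_def sum_distrib_left sum_distrib_right mult.assoc algebra_simps)
       (subst sum.swap, rule sum.cong[OF refl], subst sum.swap, simp add: mult_ac)
  also have "(\<Sum>j<m. sysD G $$ (i, j) * \<omega> (int t, j)) = (\<Sum>j<m. output_response G i 0 j * \<omega> (int t - int 0, j))"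
    by (simp add: output_response_def)
  also have "(\<Sum>k<t. \<Sum>j<m. output_response G i (Suc k) j * \<omega> (int t - int (Suc k), j)) + \<dots>
      = filtered_upto m (output_response G i) (Suc t) (int t) \<omega>"
    unfolding filtered_upto_def by (simp add: sum.lessThan_Suc_shift algebra_simps del: sum.lessThan_Suc)
  finally show ?thesis .
qed

text \<open>The sum has one summand more than the denominator indicates; the excess tends to 0.\<close>

lemma cesaro_mean_tendsto:
  fixes x :: "nat \<Rightarrow> real"
  assumes "x \<longlonglongrightarrow> L"
  shows "(\<lambda>l. 1 / real l * (\<Sum>t=0..l. x t)) \<longlonglongrightarrow> L"
proof -
  have zero: "(\<lambda>l. 1 / real l * (\<Sum>t=0..l. y t)) \<longlonglongrightarrow> 0" if y: "y \<longlonglongrightarrow> 0" for y :: "nat \<Rightarrow> real"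
  proof (rule LIMSEQ_I)
    fix e :: real assume e: "0 < e"
    obtain N where N: "\<And>t. N \<le> t \<Longrightarrow> \<bar>y t\<bar> < e / 4"
      using LIMSEQ_D[OF y, of "e / 4"] e by auto
    define K where "K = (\<Sum>t<N. \<bar>y t\<bar>)"
    have K0: "0 \<le> K" by (simp add: K_def sum_nonneg)
    obtain M :: nat where M: "2 * K / e < real M" using reals_Archimedean2 by blast
    have "norm (1 / real l * (\<Sum>t=0..l. y t) - 0) < e" if l: "max M 1 \<le> l" for l
    proof -
      have "\<bar>y t\<bar> \<le> (if t < N then \<bar>y t\<bar> else 0) + e / 4" for t
        using N[of t] e by (cases "t < N") (auto intro: less_imp_le simp: not_less)
      then have "\<bar>\<Sum>t=0..l. y t\<bar> \<le> (\<Sum>t=0..l. (if t < N then \<bar>y t\<bar> else 0) + e / 4)"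
        by (intro order_trans[OF sum_abs] sum_mono)
      also have "\<dots> = (\<Sum>t\<in>{0..l} \<inter> {..<N}. \<bar>y t\<bar>) + (real l + 1) * (e / 4)"
        by (simp add: sum.distrib sum.If_cases lessThan_def)
      also have "\<dots> \<le> K + (real l + 1) * (e / 4)"
        unfolding K_def by (intro add_right_mono sum_mono2) auto
      also have "\<dots> < real l * e"
      proof -
        have "2 * K < e * real M" using M e by (simp add: field_simps)
        also have "\<dots> \<le> e * real l" using l e by simp
        finally have "2 * K < e * real l" .
        moreover have "(real l + 1) * (e / 4) \<le> (2 * real l) * (e / 4)"
          using l e by (intro mult_right_mono) auto
        ultimately show ?thesis by (simp add: field_simps)
      qed
      finally show ?thesis using l by (simp add: abs_mult field_simps)
    qed
    then show "\<exists>no. \<forall>l\<ge>no. norm (1 / real l * (\<Sum>t=0..l. y t) - 0) < e" by blast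
  qed
  have "(\<lambda>l. 1 / real l * (\<Sum>t=0..l. x t - L) + (L + L * (1 / real l))) \<longlonglongrightarrow> 0 + (L + L * 0)"
    using LIM_zero[OF assms]
    by (intro tendsto_add tendsto_mult zero tendsto_const lim_1_over_n)
  moreover have "\<forall>\<^sub>F l in sequentially. 1 / real l * (\<Sum>t=0..l. x t - L) + (L + L * (1 / real l)) = 1 / real l * (\<Sum>t=0..l. x t)"
    using eventually_gt_at_top[of 0] by eventually_elim (simp add: sum_subtractf field_simps)
  ultimately show ?thesis by (simp add: tendsto_cong)
qed

text \<open>The mean square of the output of the system started at rest increases to that of the stationary
output, and so do the time averages in the definition of the norm.\<close>

theorem h2_norm_stationary:
  assumes G: "is_lti n m p G" "stable_system G"
  shows "h2_norm G = sqrt (\<Sum>i<p. integral\<^sup>L noise_space (\<lambda>\<omega>. (stationary_output G 0 \<omega> $ i)\<^sup>2))"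
proof -
  note [simp] = is_lti_dims[OF G(1)]
  let ?y = "\<lambda>t \<omega>. zero_init_output G (\<lambda>s. white_noise m (int s) \<omega>) t"
  have dim: "dim_vec (?y t \<omega>) = p" for t \<omega> by (simp add: zero_init_output_def)
  have "integral\<^sup>L noise_space (\<lambda>\<omega>. ?y t \<omega> \<bullet> ?y t \<omega>)
      = (\<Sum>i<p. \<Sum>k<Suc t. \<Sum>j<m. (output_response G i k j)\<^sup>2)" for t
  proof -
    have "square_integrable (filtered_upto m (output_response G i) (Suc t) (int t))" for i
      unfolding filtered_upto_def
      by (intro square_integrable_sum square_integrable_cmult square_integrable_noise)
    then have "integral\<^sup>L noise_space (\<lambda>\<omega>. ?y t \<omega> \<bullet> ?y t \<omega>) = (\<Sum>i<p. integral\<^sup>L noise_space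
        (\<lambda>\<omega>. filtered_upto m (output_response G i) (Suc t) (int t) \<omega> * filtered_upto m (output_response G i) (Suc t) (int t) \<omega>))"
      by (simp add: scalar_prod_def dim zero_init_output_index[OF G(1)] atLeast0LessThan square_integrable_mult)
    then show ?thesis by (simp only: integral_filtered_upto power2_eq_square)
  qed
  moreover have "(\<lambda>t. \<Sum>i<p. \<Sum>k<Suc t. \<Sum>j<m. (output_response G i k j)\<^sup>2)
      \<longlonglongrightarrow> (\<Sum>i<p. integral\<^sup>L noise_space (\<lambda>\<omega>. (stationary_output G 0 \<omega> $ i)\<^sup>2))"
  proof (rule tendsto_sum)
    fix i assume "i \<in> {..<p}"
    then have i: "i < p" by simp
    have "integral\<^sup>L noise_space (\<lambda>\<omega>. (stationary_output G 0 \<omega> $ i)\<^sup>2)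
        = integral\<^sup>L noise_space (\<lambda>\<omega>. filtered m (output_response G i) 0 \<omega> * filtered m (output_response G i) 0 \<omega>)"
      using AE_stationary_output_index[OF G] i stationary_output_measurable[OF G(1) i]
      by (intro integral_cong_AE) (auto simp: power2_eq_square elim!: eventually_mono)
    then have "(\<lambda>k. \<Sum>j<m. (output_response G i k j)\<^sup>2) sums integral\<^sup>L noise_space (\<lambda>\<omega>. (stationary_output G 0 \<omega> $ i)\<^sup>2)"
      using filtered_second_moments(2)[OF summable_output_response[OF G i] summable_output_response[OF G i], of 0]
      by (simp add: power2_eq_square)
    then show "(\<lambda>t. \<Sum>k<Suc t. \<Sum>j<m. (output_response G i k j)\<^sup>2) \<longlonglongrightarrow> integral\<^sup>L noise_space (\<lambda>\<omega>. (stationary_output G 0 \<omega> $ i)\<^sup>2)"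
      unfolding sums_def by (rule LIMSEQ_Suc)
  qed
  ultimately have "(\<lambda>t. integral\<^sup>L noise_space (\<lambda>\<omega>. ?y t \<omega> \<bullet> ?y t \<omega>))
      \<longlonglongrightarrow> (\<Sum>i<p. integral\<^sup>L noise_space (\<lambda>\<omega>. (stationary_output G 0 \<omega> $ i)\<^sup>2))" by simp
  from limI[OF cesaro_mean_tendsto[OF this]] show ?thesis
    by (simp add: h2_norm_def Let_def)
qed

section \<open>One-step prediction and the cascade\<close>

lemma integral_weighted_sum:
  fixes f :: "'i \<Rightarrow> 'a \<Rightarrow> real"
  assumes "\<And>i. i \<in> I \<Longrightarrow> integrable M (f i)"
  shows "integrable M (\<lambda>\<omega>. \<Sum>i\<in>I. c i * f i \<omega>)"
    and "integral\<^sup>L M (\<lambda>\<omega>. \<Sum>i\<in>I. c i * f i \<omega>) = (\<Sum>i\<in>I. c i * integral\<^sup>L M (f i))"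
proof -
  have i: "integrable M (\<lambda>\<omega>. c i * f i \<omega>)" if "i \<in> I" for i
    using assms[OF that] by simp
  show "integrable M (\<lambda>\<omega>. \<Sum>i\<in>I. c i * f i \<omega>)"
    by (rule Bochner_Integration.integrable_sum[OF i])
  show "integral\<^sup>L M (\<lambda>\<omega>. \<Sum>i\<in>I. c i * f i \<omega>) = (\<Sum>i\<in>I. c i * integral\<^sup>L M (f i))"
    by (subst Bochner_Integration.integral_sum[OF i]) simp_all
qed

lemma integral_bilinear_form:
  assumes M: "M \<in> carrier_mat a b"
    and u: "\<And>\<omega>. dim_vec (u \<omega>) = a" "\<And>i. i < a \<Longrightarrow> square_integrable (\<lambda>\<omega>. u \<omega> $ i)"
    and v: "\<And>\<omega>. dim_vec (v \<omega>) = b" "\<And>j. j < b \<Longrightarrow> square_integrable (\<lambda>\<omega>. v \<omega> $ j)"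
  shows "integrable noise_space (\<lambda>\<omega>. u \<omega> \<bullet> (M *\<^sub>v v \<omega>))"
    and "integral\<^sup>L noise_space (\<lambda>\<omega>. u \<omega> \<bullet> (M *\<^sub>v v \<omega>)) =
      (\<Sum>i<a. \<Sum>j<b. M $$ (i, j) * integral\<^sup>L noise_space (\<lambda>\<omega>. u \<omega> $ i * v \<omega> $ j))"
proof -
  note [simp] = M[simplified]
  have e: "u \<omega> \<bullet> (M *\<^sub>v v \<omega>) = (\<Sum>i<a. \<Sum>j<b. M $$ (i, j) * (u \<omega> $ i * v \<omega> $ j))" for \<omega>
    by (simp add: scalar_prod_def atLeast0LessThan u v sum_distrib_left mult_ac)
  have i: "integrable noise_space (\<lambda>\<omega>. u \<omega> $ i * v \<omega> $ j)" if "i < a" "j < b" for i j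
    by (rule square_integrable_mult[OF u(2)[OF that(1)] v(2)[OF that(2)]])
  show "integrable noise_space (\<lambda>\<omega>. u \<omega> \<bullet> (M *\<^sub>v v \<omega>))"
    unfolding e by (intro Bochner_Integration.integrable_sum integral_weighted_sum(1)) (simp add: i)
  show "integral\<^sup>L noise_space (\<lambda>\<omega>. u \<omega> \<bullet> (M *\<^sub>v v \<omega>)) =
      (\<Sum>i<a. \<Sum>j<b. M $$ (i, j) * integral\<^sup>L noise_space (\<lambda>\<omega>. u \<omega> $ i * v \<omega> $ j))"
  proof -
    have "integral\<^sup>L noise_space (\<lambda>\<omega>. u \<omega> \<bullet> (M *\<^sub>v v \<omega>)) =
      (\<Sum>i<a. integral\<^sup>L noise_space (\<lambda>\<omega>. \<Sum>j<b. M $$ (i, j) * (u \<omega> $ i * v \<omega> $ j)))"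
      unfolding e by (intro Bochner_Integration.integral_sum integral_weighted_sum(1)) (simp add: i)
    also have "\<dots> = (\<Sum>i<a. \<Sum>j<b. M $$ (i, j) * integral\<^sup>L noise_space (\<lambda>\<omega>. u \<omega> $ i * v \<omega> $ j))"
      by (intro sum.cong refl integral_weighted_sum(2)) (simp add: i)
    finally show ?thesis .
  qed
qed

lemma subalgebra_past: 
  assumes G: "is_lti n m p G"
  shows "subalgebra noise_space (past_algebra G)"
    and "k < 0 \<Longrightarrow> i < p \<Longrightarrow> (\<lambda>\<omega>. stationary_output G k \<omega> $ i) \<in> borel_measurable (past_algebra G)"
proof -
  note [simp] = is_lti_dims[OF G]
  define gen where "gen = {(\<lambda>\<omega>. stationary_output G k \<omega> $ i) -` S \<inter> space noise_space | k i S.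
        k < 0 \<and> i < p \<and> S \<in> sets borel}"
  have past: "past_algebra G = sigma (space noise_space) gen"
    by (simp add: past_algebra_def gen_def)
  have sub: "gen \<subseteq> sets noise_space"
    unfolding gen_def using stationary_output_measurable[OF G] by (auto intro: measurable_sets)
  then have pow: "gen \<subseteq> Pow (space noise_space)" using sets.space_closed by blast
  have sets: "sets (past_algebra G) = sigma_sets (space noise_space) gen"
    unfolding past by (rule sets_measure_of[OF pow])
  have space: "space (past_algebra G) = space noise_space"
    unfolding past by (rule space_measure_of[OF pow])
  show "subalgebra noise_space (past_algebra G)"
    unfolding subalgebra_def using space sets sets.sigma_sets_subset[OF sub] by simp
  show "(\<lambda>\<omega>. stationary_output G k \<omega> $ i) \<in> borel_measurable (past_algebra G)" if "k < 0" "i < p"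
  proof (rule measurableI)
    fix S :: "real set" assume "S \<in> sets borel"
    then have "(\<lambda>\<omega>. stationary_output G k \<omega> $ i) -` S \<inter> space noise_space \<in> gen"
      unfolding gen_def using that by blast
    then show "(\<lambda>\<omega>. stationary_output G k \<omega> $ i) -` S \<inter> space (past_algebra G) \<in> sets (past_algebra G)"
      unfolding sets space by (rule sigma_sets.Basic)
  qed simp
qed

lemma square_integrable_cond_exp:
  assumes sub: "subalgebra noise_space \<F>" and f: "square_integrable f"
  shows "square_integrable (real_cond_exp noise_space \<F> f)"
proof -
  interpret finite_measure_subalgebra noise_space \<F>
    using sub by unfold_locales
  have "integrable noise_space (\<lambda>\<omega>. (real_cond_exp noise_space \<F> f \<omega>)\<^sup>2)"
    using f by (intro integrable_convex_cond_exp[where I = UNIV])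
      (auto simp: square_integrable_def intro!: square_integrable_integrable[OF f] convex_power2)
  then show ?thesis by (simp add: square_integrable_def)
qed

text \<open>The conditional expectation is the orthogonal projection onto the square integrable functions that
are measurable for the smaller algebra.\<close>

lemma cond_exp_orthogonal:
  assumes sub: "subalgebra noise_space \<F>" and f: "square_integrable f"
    and g: "square_integrable g" "g \<in> borel_measurable \<F>"
  shows "integral\<^sup>L noise_space (\<lambda>\<omega>. g \<omega> * (f \<omega> - real_cond_exp noise_space \<F> f \<omega>)) = 0"
proof -
  interpret finite_measure_subalgebra noise_space \<F>
    using sub by unfold_locales
  have "f \<in> borel_measurable noise_space" using f by (simp add: square_integrable_def)
  from real_cond_exp_intg[OF square_integrable_mult[OF g(1) f] g(2) this] square_integrable_mult[OF g(1) f]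
  show ?thesis by (simp add: right_diff_distrib)
qed

lemma prediction_error_index:
  assumes "is_lti n m p G" "i < p"
  shows "prediction_error G \<omega> $ i = stationary_output G 0 \<omega> $ i -
     real_cond_exp noise_space (past_algebra G) (\<lambda>\<omega>. stationary_output G 0 \<omega> $ i) \<omega>"
  using assms is_lti_dims(7)[OF assms(1)] by (simp add: prediction_error_def)

lemma prediction_error_square_integrable:
  assumes G: "is_lti n m p G" "stable_system G" and i: "i < p"
  shows "square_integrable (\<lambda>\<omega>. prediction_error G \<omega> $ i)"
  unfolding prediction_error_index[OF G(1) i]
  by (intro square_integrable_diff square_integrable_cond_exp subalgebra_past[OF G(1)]
      stationary_output_square_integrable[OF G i])

lemma prediction_error_orthogonal:
  assumes G: "is_lti n m p G" "stable_system G" and i: "i < p"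
    and g: "square_integrable g" "g \<in> borel_measurable (past_algebra G)"
  shows "integral\<^sup>L noise_space (\<lambda>\<omega>. g \<omega> * prediction_error G \<omega> $ i) = 0"
  unfolding prediction_error_index[OF G(1) i]
  by (rule cond_exp_orthogonal[OF subalgebra_past(1)[OF G(1)] stationary_output_square_integrable[OF G i] g])

lemma sum_lessThan_add: "(\<Sum>i<a + b. f i) = (\<Sum>i<a. f i) + (\<Sum>i<b. f (a + i))" for f :: "nat \<Rightarrow> real"
  by (induction b) (simp_all add: add.assoc)

context
  fixes n nf m p :: nat and F G :: lti
  assumes F: "is_lti n m p F" "stable_system F" and G: "is_lti nf m m G" "stable_system G"
begin

private abbreviation "x \<equiv> stationary_state (cascade F G)"
private abbreviation "w \<equiv> stationary_output G"

private lemmas FG = cascade_stable[OF F G]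

private lemma cascade_entries:
  "i < n \<Longrightarrow> l < n \<Longrightarrow> sysA (cascade F G) $$ (i, l) = sysA F $$ (i, l)"
  "i < n \<Longrightarrow> k < nf \<Longrightarrow> sysA (cascade F G) $$ (i, n + k) = (sysB F * sysC G) $$ (i, k)"
  "h < nf \<Longrightarrow> l < n \<Longrightarrow> sysA (cascade F G) $$ (n + h, l) = 0"
  "h < nf \<Longrightarrow> k < nf \<Longrightarrow> sysA (cascade F G) $$ (n + h, n + k) = sysA G $$ (h, k)"
  "i < n \<Longrightarrow> j < m \<Longrightarrow> sysB (cascade F G) $$ (i, j) = (sysB F * sysD G) $$ (i, j)"
  "q < p \<Longrightarrow> l < n \<Longrightarrow> sysC (cascade F G) $$ (q, l) = sysC F $$ (q, l)"
  "q < p \<Longrightarrow> k < nf \<Longrightarrow> sysC (cascade F G) $$ (q, n + k) = (sysD F * sysC G) $$ (q, k)"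
  "sysD (cascade F G) = sysD F * sysD G"
  by (simp_all add: cascade_def append_rows_def append_cols_def is_lti_dims[OF F(1)] is_lti_dims[OF G(1)]
      del: index_mult_mat(1))

text \<open>The filter is not influenced by the system that it drives.\<close>

lemma cascade_filter_state:
  assumes i: "i < nf"
  shows "x t \<omega> $ (n + i) = stationary_state G t \<omega> $ i"
proof -
  note [simp] = is_lti_dims[OF F(1)] is_lti_dims[OF G(1)]
  have "state_response (cascade F G) (n + i) k j = state_response G i k j" if "j < m" for k j
    using i that
  proof (induction k arbitrary: i)
    case 0
    then show ?case
      by (simp add: state_response_def cascade_def append_rows_def)
  next
    case (Suc k)
    have "n + i < n + nf" using Suc.prems by simp
    then show ?case
      using Suc
      by (simp add: state_response_Suc[OF FG(1)] state_response_Suc[OF G(1)] sum_lessThan_add cascade_entries)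
  qed
  then show ?thesis
    using i by (simp add: stationary_state_index[OF FG(1)] stationary_state_index[OF G(1)] filtered_def)
qed

lemma cascade_state_recursion:
  "AE \<omega> in noise_space. \<forall>t. \<forall>i<n. x (t + 1) \<omega> $ i =
     (\<Sum>l<n. sysA F $$ (i, l) * x t \<omega> $ l) + (\<Sum>j<m. sysB F $$ (i, j) * w t \<omega> $ j)"
  using AE_stationary_recursion[OF FG]
proof eventually_elim
  case (elim \<omega>)
  note [simp] = is_lti_dims[OF F(1)] is_lti_dims[OF G(1)]
  show ?case
  proof (intro allI impI)
    fix t i assume i: "i < n"
    have "x (t + 1) \<omega> $ i = (\<Sum>l<n. sysA F $$ (i, l) * x t \<omega> $ l)
        + (\<Sum>l<nf. (sysB F * sysC G) $$ (i, l) * stationary_state G t \<omega> $ l)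
        + (\<Sum>j<m. (sysB F * sysD G) $$ (i, j) * \<omega> (t, j))"
      using elim i
      by (simp add: sum_lessThan_add cascade_filter_state cascade_entries del: index_mult_mat(1))
    also have "\<dots> = (\<Sum>l<n. sysA F $$ (i, l) * x t \<omega> $ l) + (\<Sum>j<m. sysB F $$ (i, j) * w t \<omega> $ j)"
      using i
      by (simp add: mult_mat_index stationary_output_index[OF G(1)] distrib_left sum.distrib sum_distrib_left sum_distrib_right mult.assoc del: index_mult_mat(1))
         (subst (1 2) sum.swap, simp)
    finally show "x (t + 1) \<omega> $ i =
     (\<Sum>l<n. sysA F $$ (i, l) * x t \<omega> $ l) + (\<Sum>j<m. sysB F $$ (i, j) * w t \<omega> $ j)" .
  qed
qed

lemma cascade_output:
  assumes i: "i < p"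
  shows "stationary_output (cascade F G) t \<omega> $ i =
     (\<Sum>l<n. sysC F $$ (i, l) * x t \<omega> $ l) + (\<Sum>j<m. sysD F $$ (i, j) * w t \<omega> $ j)"
proof -
  note [simp] = is_lti_dims[OF F(1)] is_lti_dims[OF G(1)]
  have "stationary_output (cascade F G) t \<omega> $ i = (\<Sum>l<n. sysC F $$ (i, l) * x t \<omega> $ l)
        + (\<Sum>l<nf. (sysD F * sysC G) $$ (i, l) * stationary_state G t \<omega> $ l)
        + (\<Sum>j<m. (sysD F * sysD G) $$ (i, j) * \<omega> (t, j))"
      using i
      by (simp add: stationary_output_index[OF FG(1)] sum_lessThan_add cascade_filter_state cascade_entries
          del: index_mult_mat(1))
  also have "\<dots> = (\<Sum>l<n. sysC F $$ (i, l) * x t \<omega> $ l) + (\<Sum>j<m. sysD F $$ (i, j) * w t \<omega> $ j)"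
      using i
      by (simp add: mult_mat_index stationary_output_index[OF G(1)] distrib_left sum.distrib sum_distrib_left sum_distrib_right mult.assoc del: index_mult_mat(1))
         (subst (1 2) sum.swap, simp)
  finally show ?thesis .
qed

text \<open>Going back \<open>N\<close> steps, the state of the driven system is a finite combination of past filter outputs
plus a remainder that the \<open>N\<close>-th power of the state matrix makes small.\<close>

lemma cascade_state_unrolled:
  "AE \<omega> in noise_space. \<forall>N. \<forall>l<n. x 0 \<omega> $ l = (\<Sum>q<n. (sysA F ^\<^sub>m N) $$ (l, q) * x (- int N) \<omega> $ q)
     + (\<Sum>k<N. \<Sum>j<m. state_response F l k j * w (- 1 - int k) \<omega> $ j)"
  using cascade_state_recursion
proof eventually_elim
  case (elim \<omega>)
  note [simp] = is_lti_dims[OF F(1)] is_lti_dims[OF G(1)]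
  show ?case
  proof (intro allI impI)
    fix N l assume l: "l < n"
    then show "x 0 \<omega> $ l = (\<Sum>q<n. (sysA F ^\<^sub>m N) $$ (l, q) * x (- int N) \<omega> $ q)
     + (\<Sum>k<N. \<Sum>j<m. state_response F l k j * w (- 1 - int k) \<omega> $ j)"
    proof (induction N)
      case 0
      have "(\<Sum>q<n. (sysA F ^\<^sub>m 0) $$ (l, q) * x 0 \<omega> $ q) = (\<Sum>q<n. if q = l then x 0 \<omega> $ q else 0)"
        using l by (intro sum.cong) auto
      then show ?case using l by simp
    next
      case (Suc N)
      have "x (- int N) \<omega> $ q = (\<Sum>r<n. sysA F $$ (q, r) * x (- int (Suc N)) \<omega> $ r)
          + (\<Sum>j<m. sysB F $$ (q, j) * w (- 1 - int N) \<omega> $ j)" if "q < n" for q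
        using elim[rule_format, OF that, of "- int (Suc N)"] by simp
      then have "(\<Sum>q<n. (sysA F ^\<^sub>m N) $$ (l, q) * x (- int N) \<omega> $ q) =
          (\<Sum>r<n. (\<Sum>q<n. (sysA F ^\<^sub>m N) $$ (l, q) * sysA F $$ (q, r)) * x (- int (Suc N)) \<omega> $ r)
        + (\<Sum>j<m. (\<Sum>q<n. (sysA F ^\<^sub>m N) $$ (l, q) * sysB F $$ (q, j)) * w (- 1 - int N) \<omega> $ j)"
        by (simp add: distrib_left sum.distrib sum_distrib_left sum_distrib_right mult.assoc del: of_nat_Suc)
           (subst (1 2) sum.swap, simp)
      also have "\<dots> = (\<Sum>r<n. (sysA F ^\<^sub>m Suc N) $$ (l, r) * x (- int (Suc N)) \<omega> $ r)
        + (\<Sum>j<m. state_response F l N j * w (- 1 - int N) \<omega> $ j)"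
        using l by (simp add: state_response_def mult_mat_index del: index_mult_mat(1) of_nat_Suc)
      finally show ?case using Suc.IH[OF l] by simp
    qed
  qed
qed

text \<open>The state is a limit of combinations of past filter outputs, all of which are orthogonal to the
prediction error. The remainder after \<open>N\<close> steps contributes coefficients that tend to 0, times
moments that are bounded uniformly in \<open>N\<close> by stationarity. The argument is carried out on moments
because the state is measurable with respect to the past only up to null sets.\<close>

lemma prediction_error_orthogonal_state:
  assumes i: "i < m" and l: "l < n"
  shows "integral\<^sup>L noise_space (\<lambda>\<omega>. x 0 \<omega> $ l * prediction_error G \<omega> $ i) = 0"
proof -
  note [simp] = is_lti_dims[OF F(1)] is_lti_dims[OF G(1)]
  let ?e = "\<lambda>\<omega>. prediction_error G \<omega> $ i"
  let ?E = "integral\<^sup>L noise_space"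
  have e: "square_integrable ?e" by (rule prediction_error_square_integrable[OF G i])
  have xs: "square_integrable (\<lambda>\<omega>. x t \<omega> $ q)" if "q < n" for t q
    using that by (intro stationary_state_square_integrable[OF FG]) simp
  have ws: "square_integrable (\<lambda>\<omega>. w t \<omega> $ j)" if "j < m" for t j
    by (rule stationary_output_square_integrable[OF G that])
  have w0: "?E (\<lambda>\<omega>. w (- 1 - int k) \<omega> $ j * ?e \<omega>) = 0" if "j < m" for k j
    by (rule prediction_error_orthogonal[OF G i ws[OF that]]) (rule subalgebra_past(2)[OF G(1) _ that], simp)
  have eq: "?E (\<lambda>\<omega>. x 0 \<omega> $ l * ?e \<omega>) = (\<Sum>q<n. (sysA F ^\<^sub>m N) $$ (l, q) * ?E (\<lambda>\<omega>. x (- int N) \<omega> $ q * ?e \<omega>))" for N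
  proof -
    have "?E (\<lambda>\<omega>. x 0 \<omega> $ l * ?e \<omega>) = ?E (\<lambda>\<omega>. (\<Sum>q<n. (sysA F ^\<^sub>m N) $$ (l, q) * (x (- int N) \<omega> $ q * ?e \<omega>))
        + (\<Sum>k<N. \<Sum>j<m. state_response F l k j * (w (- 1 - int k) \<omega> $ j * ?e \<omega>)))"
    proof (rule integral_cong_AE)
      show "(\<lambda>\<omega>. x 0 \<omega> $ l * ?e \<omega>) \<in> borel_measurable noise_space"
        using square_integrable_mult[OF xs[OF l] e] by auto
      show "(\<lambda>\<omega>. (\<Sum>q<n. (sysA F ^\<^sub>m N) $$ (l, q) * (x (- int N) \<omega> $ q * ?e \<omega>))
        + (\<Sum>k<N. \<Sum>j<m. state_response F l k j * (w (- 1 - int k) \<omega> $ j * ?e \<omega>))) \<in> borel_measurable noise_space"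
        using square_integrable_mult[OF xs e] square_integrable_mult[OF ws e]
        by (intro borel_measurable_add borel_measurable_sum borel_measurable_times[OF borel_measurable_const]) auto
      show "AE \<omega> in noise_space. x 0 \<omega> $ l * ?e \<omega> = (\<Sum>q<n. (sysA F ^\<^sub>m N) $$ (l, q) * (x (- int N) \<omega> $ q * ?e \<omega>))
        + (\<Sum>k<N. \<Sum>j<m. state_response F l k j * (w (- 1 - int k) \<omega> $ j * ?e \<omega>))"
        using cascade_state_unrolled
      proof eventually_elim
        case (elim \<omega>)
        show ?case
          by (subst elim[rule_format, OF l, of N]) (simp add: distrib_right sum_distrib_right mult.assoc)
      qed
    qed
    also have "\<dots> = (\<Sum>q<n. (sysA F ^\<^sub>m N) $$ (l, q) * ?E (\<lambda>\<omega>. x (- int N) \<omega> $ q * ?e \<omega>))"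
    proof (subst Bochner_Integration.integral_add)
      have 1: "integrable noise_space (\<lambda>\<omega>. x (- int N) \<omega> $ q * ?e \<omega>)" if "q \<in> {..<n}" for q
        using that square_integrable_mult[OF xs e] by simp
      have 2: "integrable noise_space (\<lambda>\<omega>. w (- 1 - int k) \<omega> $ j * ?e \<omega>)" if "j \<in> {..<m}" for j k
        using that square_integrable_mult[OF ws e] by simp
      note 3 = integral_weighted_sum(1)[OF 2]
      show "integrable noise_space (\<lambda>\<omega>. \<Sum>q<n. (sysA F ^\<^sub>m N) $$ (l, q) * (x (- int N) \<omega> $ q * ?e \<omega>))"
        by (rule integral_weighted_sum(1)[OF 1])
      show "integrable noise_space (\<lambda>\<omega>. \<Sum>k<N. \<Sum>j<m. state_response F l k j * (w (- 1 - int k) \<omega> $ j * ?e \<omega>))"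
        by (rule Bochner_Integration.integrable_sum[OF 3])
      have "?E (\<lambda>\<omega>. \<Sum>k<N. \<Sum>j<m. state_response F l k j * (w (- 1 - int k) \<omega> $ j * ?e \<omega>))
          = (\<Sum>k<N. \<Sum>j<m. state_response F l k j * ?E (\<lambda>\<omega>. w (- 1 - int k) \<omega> $ j * ?e \<omega>))"
      proof -
        have "?E (\<lambda>\<omega>. \<Sum>k<N. \<Sum>j<m. state_response F l k j * (w (- 1 - int k) \<omega> $ j * ?e \<omega>))
          = (\<Sum>k<N. ?E (\<lambda>\<omega>. \<Sum>j<m. state_response F l k j * (w (- 1 - int k) \<omega> $ j * ?e \<omega>)))"
          by (rule Bochner_Integration.integral_sum) (rule 3)
        also have "\<dots> = (\<Sum>k<N. \<Sum>j<m. state_response F l k j * ?E (\<lambda>\<omega>. w (- 1 - int k) \<omega> $ j * ?e \<omega>))"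
          by (intro sum.cong refl integral_weighted_sum(2) 2)
        finally show ?thesis .
      qed
      also have "\<dots> = 0" using w0 by simp
      finally have "?E (\<lambda>\<omega>. \<Sum>k<N. \<Sum>j<m. state_response F l k j * (w (- 1 - int k) \<omega> $ j * ?e \<omega>)) = 0" .
      moreover have "?E (\<lambda>\<omega>. \<Sum>q<n. (sysA F ^\<^sub>m N) $$ (l, q) * (x (- int N) \<omega> $ q * ?e \<omega>))
        = (\<Sum>q<n. (sysA F ^\<^sub>m N) $$ (l, q) * ?E (\<lambda>\<omega>. x (- int N) \<omega> $ q * ?e \<omega>))"
        by (rule integral_weighted_sum(2)) (rule 1)
      ultimately show "?E (\<lambda>\<omega>. \<Sum>q<n. (sysA F ^\<^sub>m N) $$ (l, q) * (x (- int N) \<omega> $ q * ?e \<omega>))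
         + ?E (\<lambda>\<omega>. \<Sum>k<N. \<Sum>j<m. state_response F l k j * (w (- 1 - int k) \<omega> $ j * ?e \<omega>))
        = (\<Sum>q<n. (sysA F ^\<^sub>m N) $$ (l, q) * ?E (\<lambda>\<omega>. x (- int N) \<omega> $ q * ?e \<omega>))"
        by simp
    qed
    finally show ?thesis .
  qed
  have lim: "(\<lambda>N. \<Sum>q<n. (sysA F ^\<^sub>m N) $$ (l, q) * ?E (\<lambda>\<omega>. x (- int N) \<omega> $ q * ?e \<omega>)) \<longlonglongrightarrow> 0"
  proof (rule tendsto_null_sum)
    fix q assume "q \<in> {..<n}"
    then have q: "q < n" by simp
    define K where "K = ?E (\<lambda>\<omega>. (x 0 \<omega> $ q)\<^sup>2) + ?E (\<lambda>\<omega>. (?e \<omega>)\<^sup>2)"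
    have K: "\<bar>?E (\<lambda>\<omega>. x t \<omega> $ q * ?e \<omega>)\<bar> \<le> K" for t
    proof -
      have i2: "integrable noise_space (\<lambda>\<omega>. (x t \<omega> $ q)\<^sup>2)" "integrable noise_space (\<lambda>\<omega>. (?e \<omega>)\<^sup>2)"
        using xs[OF q] e by (simp_all add: square_integrable_def)
      have "\<bar>?E (\<lambda>\<omega>. x t \<omega> $ q * ?e \<omega>)\<bar> \<le> ?E (\<lambda>\<omega>. \<bar>x t \<omega> $ q * ?e \<omega>\<bar>)"
        by (rule integral_abs_bound)
      also have "\<dots> \<le> ?E (\<lambda>\<omega>. (x t \<omega> $ q)\<^sup>2 + (?e \<omega>)\<^sup>2)"
        using i2 square_integrable_mult[OF xs[OF q] e]
        by (intro integral_mono abs_mult_le_sum_squares) auto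
      also have "\<dots> = ?E (\<lambda>\<omega>. (x t \<omega> $ q)\<^sup>2) + ?E (\<lambda>\<omega>. (?e \<omega>)\<^sup>2)"
        using i2 by simp
      also have "?E (\<lambda>\<omega>. (x t \<omega> $ q)\<^sup>2) = ?E (\<lambda>\<omega>. (x 0 \<omega> $ q)\<^sup>2)"
        using stationary_state_covariance_shift[OF FG, of q q t 0] q by (simp add: power2_eq_square)
      finally show ?thesis by (simp add: K_def)
    qed
    have "summable (\<lambda>N. \<bar>(sysA F ^\<^sub>m N) $$ (l, q)\<bar>)"
      using F l q by (intro summable_abs_matrix_power[of _ n]) (simp_all add: is_lti_def stable_system_def)
    from summable_LIMSEQ_zero[OF summable_mult2[OF this, of K]]
    show "(\<lambda>N. (sysA F ^\<^sub>m N) $$ (l, q) * ?E (\<lambda>\<omega>. x (- int N) \<omega> $ q * ?e \<omega>)) \<longlonglongrightarrow> 0"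
      by (rule Lim_null_comparison[rotated]) (auto simp: abs_mult intro!: always_eventually mult_left_mono K)
  qed
  have "(\<lambda>N::nat. ?E (\<lambda>\<omega>. x 0 \<omega> $ l * ?e \<omega>)) \<longlonglongrightarrow> 0"
    using lim by (simp flip: eq)
  then show ?thesis by (simp add: LIMSEQ_const_iff)
qed

end

section \<open>The anisotropic norm bound\<close>

text \<open>A vector at which a nonnegative form vanishes lies in the kernel of its matrix.\<close>

lemma pos_definite_of_nonneg:
  assumes S: "S \<in> carrier_mat n n" "transpose_mat S = S"
    and nonneg: "\<And>x. x \<in> carrier_vec n \<Longrightarrow> 0 \<le> x \<bullet> (S *\<^sub>v x)"
    and det: "Determinant.det S \<noteq> 0"
  shows "pos_definite S"
  unfolding pos_definite_iff[OF S(1)]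
proof (intro conjI ballI impI)
  note [simp] = S(1)[simplified]
  fix x :: "real vec" assume x: "x \<in> carrier_vec n" "x \<noteq> 0\<^sub>v n"
  show "0 < x \<bullet> (S *\<^sub>v x)"
  proof (rule ccontr)
    assume "\<not> ?thesis"
    then have x0: "x \<bullet> (S *\<^sub>v x) = 0" using nonneg[OF x(1)] by simp
    define y where "y = S *\<^sub>v x"
    have y: "y \<in> carrier_vec n" by (simp add: y_def)
    have "y \<noteq> 0\<^sub>v n" using det x det_0_iff_vec_prod_zero[OF S(1)] by (auto simp: y_def)
    then have t: "0 < y \<bullet> y" using scalar_prod_self_pos[OF y] by simp
    define q where "q = y \<bullet> (S *\<^sub>v y)"
    have q: "0 \<le> q" using nonneg[OF y] by (simp add: q_def)
    \<comment> \<open>A step along \<open>- y\<close> that is short enough to make the form negative.\<close>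
    define c where "c = y \<bullet> y / (q + 1)"
    have c: "0 < c" "c * (q + 1) = y \<bullet> y" using t q by (simp_all add: c_def)
    have xSy: "x \<bullet> (S *\<^sub>v y) = y \<bullet> y"
      using scalar_prod_transpose[of x S y] S(2) x y by (simp add: y_def)
    have "0 \<le> (x - c \<cdot>\<^sub>v y) \<bullet> (S *\<^sub>v (x - c \<cdot>\<^sub>v y))" using x y by (intro nonneg) simp
    also have "\<dots> = c * (c * q) - 2 * c * (y \<bullet> y)"
    proof -
      have "y \<bullet> (S *\<^sub>v x) = y \<bullet> y" by (simp add: y_def)
      then show ?thesis
        using x y by (simp add: dim_rules x0 xSy flip: q_def) (simp add: algebra_simps)
    qed
    also have "\<dots> = - (c * c) - c * (y \<bullet> y)"
      unfolding c(2)[symmetric] by (simp add: algebra_simps)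
    also have "\<dots> < 0" using mult_pos_pos[OF c(1) c(1)] mult_pos_pos[OF c(1) t] by linarith
    finally show False by simp
  qed
qed (rule S(2))

lemma second_moment_carrier: "second_moment m u \<in> carrier_mat m m"
  by (simp add: second_moment_def)

lemma second_moment_nonneg:
  assumes u: "\<And>\<omega>. dim_vec (u \<omega>) = m" "\<And>i. i < m \<Longrightarrow> square_integrable (\<lambda>\<omega>. u \<omega> $ i)"
    and x: "x \<in> carrier_vec m"
  shows "0 \<le> x \<bullet> (second_moment m u *\<^sub>v x)"
proof -
  define M where "M = Matrix.mat m m (\<lambda>(i, j). x $ i * x $ j)"
  have M: "M \<in> carrier_mat m m" by (simp add: M_def)
  have "u \<omega> \<bullet> (M *\<^sub>v u \<omega>) = (\<Sum>i<m. x $ i * u \<omega> $ i)\<^sup>2" for \<omega>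
    by (simp add: M_def scalar_prod_def atLeast0LessThan u(1) power2_eq_square sum_product sum_distrib_left mult_ac)
  then have "0 \<le> integral\<^sup>L noise_space (\<lambda>\<omega>. u \<omega> \<bullet> (M *\<^sub>v u \<omega>))"
    by (intro integral_nonneg_AE AE_I2) simp
  also have "\<dots> = (\<Sum>i<m. \<Sum>j<m. M $$ (i, j) * integral\<^sup>L noise_space (\<lambda>\<omega>. u \<omega> $ i * u \<omega> $ j))"
    by (intro integral_bilinear_form(2)[OF M] u)
  also have "\<dots> = x \<bullet> (second_moment m u *\<^sub>v x)"
    using x by (simp add: M_def second_moment_def scalar_prod_def atLeast0LessThan sum_distrib_left mult_ac)
  finally show ?thesis .
qed

lemma h2_norm_square:
  assumes G: "is_lti n m p G" "stable_system G"
  shows "(h2_norm G)\<^sup>2 = integral\<^sup>L noise_space (\<lambda>\<omega>. stationary_output G 0 \<omega> \<bullet> stationary_output G 0 \<omega>)"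
    and "integrable noise_space (\<lambda>\<omega>. stationary_output G 0 \<omega> \<bullet> stationary_output G 0 \<omega>)"
    and "(h2_norm G)\<^sup>2 = trace_mat (second_moment p (stationary_output G 0))"
proof -
  note [simp] = is_lti_dims[OF G(1)]
  have d: "dim_vec (stationary_output G 0 \<omega>) = p" for \<omega> by (simp add: stationary_output_def)
  have e: "stationary_output G 0 \<omega> \<bullet> stationary_output G 0 \<omega> = (\<Sum>i<p. (stationary_output G 0 \<omega> $ i)\<^sup>2)" for \<omega>
    by (simp add: scalar_prod_def d atLeast0LessThan power2_eq_square)
  have i: "integrable noise_space (\<lambda>\<omega>. (stationary_output G 0 \<omega> $ i)\<^sup>2)" if "i \<in> {..<p}" for i
    using stationary_output_square_integrable[OF G, of i 0] that by (simp add: square_integrable_def)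
  have s: "(h2_norm G)\<^sup>2 = (\<Sum>i<p. integral\<^sup>L noise_space (\<lambda>\<omega>. (stationary_output G 0 \<omega> $ i)\<^sup>2))"
    unfolding h2_norm_stationary[OF G] by (intro real_sqrt_pow2 sum_nonneg integral_nonneg_AE AE_I2) simp
  show "(h2_norm G)\<^sup>2 = integral\<^sup>L noise_space (\<lambda>\<omega>. stationary_output G 0 \<omega> \<bullet> stationary_output G 0 \<omega>)"
    unfolding e s by (rule Bochner_Integration.integral_sum[OF i, symmetric])
  show "integrable noise_space (\<lambda>\<omega>. stationary_output G 0 \<omega> \<bullet> stationary_output G 0 \<omega>)"
    unfolding e by (rule Bochner_Integration.integrable_sum[OF i])
  show "(h2_norm G)\<^sup>2 = trace_mat (second_moment p (stationary_output G 0))"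
    unfolding s by (simp add: trace_mat_def second_moment_def power2_eq_square)
qed

text \<open>Integrate the dissipation inequality along the stationary cascade. The storage terms at times 0
and 1 have equal expectation. In the remaining gap, replace the filter output by its prediction
\<open>q\<close> plus the prediction error \<open>e\<close>: the mixed terms are bilinear in \<open>e\<close> and in one of the state and
\<open>q\<close>, both orthogonal to \<open>e\<close>; the part without \<open>e\<close> is nonnegative by dissipativity; and the part
that is quadratic in \<open>e\<close> is the form of \<open>Phi\<close>.\<close>

theorem cascade_h2_bound:
  fixes s :: real
  assumes F: "is_lti n m p F" "stable_system F" and G: "is_lti nf m m G" "stable_system G"
    and X: "X \<in> carrier_mat n n" "transpose_mat X = X"
    and Phi: "Phi = s \<cdot>\<^sub>m 1\<^sub>m m - transpose_mat (sysB F) * X * sysB F - transpose_mat (sysD F) * sysD F"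
    and dissipative: "\<And>x w. x \<in> carrier_vec n \<Longrightarrow> w \<in> carrier_vec m \<Longrightarrow>
      (sysA F *\<^sub>v x + sysB F *\<^sub>v w) \<bullet> (X *\<^sub>v (sysA F *\<^sub>v x + sysB F *\<^sub>v w))
        + (sysC F *\<^sub>v x + sysD F *\<^sub>v w) \<bullet> (sysC F *\<^sub>v x + sysD F *\<^sub>v w)
      \<le> x \<bullet> (X *\<^sub>v x) + s * (w \<bullet> w)"
  shows "(h2_norm (cascade F G))\<^sup>2 \<le> s * (h2_norm G)\<^sup>2
     - (\<Sum>i<m. \<Sum>j<m. Phi $$ (i, j) * second_moment m (prediction_error G) $$ (i, j))"
proof -
  note FG = cascade_stable[OF F G]
  note [simp] = is_lti_dims[OF F(1)] is_lti_dims[OF G(1)] X(1)[simplified]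
  let ?E = "integral\<^sup>L noise_space"
  define x where "x \<omega> = vec n (\<lambda>i. stationary_state (cascade F G) 0 \<omega> $ i)" for \<omega>
  define w where "w = stationary_output G 0"
  define e where "e = prediction_error G"
  define q where "q \<omega> = w \<omega> - e \<omega>" for \<omega>
  define x1 where "x1 \<omega> = sysA F *\<^sub>v x \<omega> + sysB F *\<^sub>v w \<omega>" for \<omega>
  define z where "z \<omega> = sysC F *\<^sub>v x \<omega> + sysD F *\<^sub>v w \<omega>" for \<omega>
  \<comment> \<open>The off-diagonal block of the gap form, which couples state and input.\<close>
  define N where "N = transpose_mat (sysA F) * X * sysB F + transpose_mat (sysC F) * sysD F"
  have dims [simp]: "dim_vec (x \<omega>) = n" "dim_vec (w \<omega>) = m" "dim_vec (e \<omega>) = m" "dim_vec (q \<omega>) = m"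
    "dim_vec (x1 \<omega>) = n" "dim_vec (z \<omega>) = p" for \<omega>
    by (simp_all add: x_def w_def e_def q_def x1_def z_def stationary_output_def prediction_error_def)
  have Phic: "Phi \<in> carrier_mat m m" and Nc: "N \<in> carrier_mat n m" by (simp_all add: Phi N_def)
  note [simp] = Phic[simplified] Nc[simplified]
  have sq: "i < n \<Longrightarrow> square_integrable (\<lambda>\<omega>. x \<omega> $ i)" "j < m \<Longrightarrow> square_integrable (\<lambda>\<omega>. w \<omega> $ j)"
    "j < m \<Longrightarrow> square_integrable (\<lambda>\<omega>. e \<omega> $ j)" "j < m \<Longrightarrow> square_integrable (\<lambda>\<omega>. q \<omega> $ j)" for i j
  proof -
    show "i < n \<Longrightarrow> square_integrable (\<lambda>\<omega>. x \<omega> $ i)"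
      using stationary_state_square_integrable[OF FG, of i 0] by (simp add: x_def)
    show w: "j < m \<Longrightarrow> square_integrable (\<lambda>\<omega>. w \<omega> $ j)"
      using stationary_output_square_integrable[OF G] by (simp add: w_def)
    show e: "j < m \<Longrightarrow> square_integrable (\<lambda>\<omega>. e \<omega> $ j)"
      using prediction_error_square_integrable[OF G] by (simp add: e_def)
    show "j < m \<Longrightarrow> square_integrable (\<lambda>\<omega>. q \<omega> $ j)"
      using square_integrable_diff[OF w e] by (simp add: q_def)
  qed
  have orth_x: "?E (\<lambda>\<omega>. x \<omega> $ l * e \<omega> $ j) = 0" if "l < n" "j < m" for l j
    using prediction_error_orthogonal_state[OF F G that(2,1)] that by (simp add: x_def e_def)
  have orth_q: "?E (\<lambda>\<omega>. q \<omega> $ i * e \<omega> $ j) = 0" if ij: "i < m" "j < m" for i j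
  proof -
    have qi: "q \<omega> $ i = real_cond_exp noise_space (past_algebra G) (\<lambda>\<omega>. stationary_output G 0 \<omega> $ i) \<omega>" for \<omega>
      using ij dims(3)[of \<omega>] prediction_error_index[OF G(1) ij(1), of \<omega>] by (simp add: q_def e_def w_def)
    have "?E (\<lambda>\<omega>. q \<omega> $ i * prediction_error G \<omega> $ j) = 0"
      using sq(4)[OF ij(1)] unfolding qi
      by (intro prediction_error_orthogonal[OF G ij(2)]) auto
    then show ?thesis by (simp add: e_def)
  qed

  have expand: "x \<omega> \<bullet> (X *\<^sub>v x \<omega>) + s * (w \<omega> \<bullet> w \<omega>) - x1 \<omega> \<bullet> (X *\<^sub>v x1 \<omega>) - z \<omega> \<bullet> z \<omega>
      \<ge> e \<omega> \<bullet> (Phi *\<^sub>v e \<omega>) + 2 * (q \<omega> \<bullet> (Phi *\<^sub>v e \<omega>)) - 2 * (x \<omega> \<bullet> (N *\<^sub>v e \<omega>))" for \<omega>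
  proof -
    define a where "a = sysA F *\<^sub>v x \<omega> + sysB F *\<^sub>v q \<omega>"
    define b where "b = sysC F *\<^sub>v x \<omega> + sysD F *\<^sub>v q \<omega>"
    have [simp]: "dim_vec a = n" "dim_vec b = p" by (simp_all add: a_def b_def)
    have w: "w \<omega> = q \<omega> + e \<omega>" by (rule eq_vecI) (simp_all add: q_def)
    have x1: "x1 \<omega> = a + sysB F *\<^sub>v e \<omega>"
      unfolding x1_def a_def w by (rule eq_vecI) (simp_all add: mult_vec_add del: index_mult_mat_vec)
    have z: "z \<omega> = b + sysD F *\<^sub>v e \<omega>"
      unfolding z_def b_def w by (rule eq_vecI) (simp_all add: mult_vec_add del: index_mult_mat_vec)
    have adj: "u \<bullet> (transpose_mat M *\<^sub>v v) = (M *\<^sub>v u) \<bullet> v" if "dim_vec u = dim_col M" "dim_vec v = dim_row M"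
      for M :: "real mat" and u v
      using that scalar_prod_transpose[of v M u] by (simp add: scalar_prod_commute)
    have sym: "(sysB F *\<^sub>v e \<omega>) \<bullet> (X *\<^sub>v a) = a \<bullet> (X *\<^sub>v (sysB F *\<^sub>v e \<omega>))"
      using scalar_prod_transpose[of a X "sysB F *\<^sub>v e \<omega>"] X(2) by (simp add: scalar_prod_commute)
    have qPe: "v \<bullet> (Phi *\<^sub>v e \<omega>) = s * (v \<bullet> e \<omega>) - (sysB F *\<^sub>v v) \<bullet> (X *\<^sub>v (sysB F *\<^sub>v e \<omega>)) - (sysD F *\<^sub>v v) \<bullet> (sysD F *\<^sub>v e \<omega>)"
      if "dim_vec v = m" for v
      using that unfolding Phi by (simp add: dim_rules adj)
    have xNe: "x \<omega> \<bullet> (N *\<^sub>v e \<omega>) = (sysA F *\<^sub>v x \<omega>) \<bullet> (X *\<^sub>v (sysB F *\<^sub>v e \<omega>)) + (sysC F *\<^sub>v x \<omega>) \<bullet> (sysD F *\<^sub>v e \<omega>)"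
      unfolding N_def by (simp add: dim_rules adj)
    have "0 \<le> x \<omega> \<bullet> (X *\<^sub>v x \<omega>) + s * (q \<omega> \<bullet> q \<omega>) - a \<bullet> (X *\<^sub>v a) - b \<bullet> b"
      using dissipative[of "x \<omega>" "q \<omega>"] by (simp add: a_def b_def)
    moreover have "x1 \<omega> \<bullet> (X *\<^sub>v x1 \<omega>) = a \<bullet> (X *\<^sub>v a) + 2 * (a \<bullet> (X *\<^sub>v (sysB F *\<^sub>v e \<omega>))) + (sysB F *\<^sub>v e \<omega>) \<bullet> (X *\<^sub>v (sysB F *\<^sub>v e \<omega>))"
      unfolding x1 by (simp add: dim_rules sym)
    moreover have "z \<omega> \<bullet> z \<omega> = b \<bullet> b + 2 * (b \<bullet> (sysD F *\<^sub>v e \<omega>)) + (sysD F *\<^sub>v e \<omega>) \<bullet> (sysD F *\<^sub>v e \<omega>)"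
      unfolding z by (simp add: dim_rules scalar_prod_commute[of "sysD F *\<^sub>v e \<omega>" b])
    moreover have "w \<omega> \<bullet> w \<omega> = q \<omega> \<bullet> q \<omega> + 2 * (q \<omega> \<bullet> e \<omega>) + e \<omega> \<bullet> e \<omega>"
      unfolding w by (simp add: dim_rules scalar_prod_commute[of "e \<omega>" "q \<omega>"])
    moreover have "a \<bullet> (X *\<^sub>v (sysB F *\<^sub>v e \<omega>)) = (sysA F *\<^sub>v x \<omega>) \<bullet> (X *\<^sub>v (sysB F *\<^sub>v e \<omega>)) + (sysB F *\<^sub>v q \<omega>) \<bullet> (X *\<^sub>v (sysB F *\<^sub>v e \<omega>))"
      "b \<bullet> (sysD F *\<^sub>v e \<omega>) = (sysC F *\<^sub>v x \<omega>) \<bullet> (sysD F *\<^sub>v e \<omega>) + (sysD F *\<^sub>v q \<omega>) \<bullet> (sysD F *\<^sub>v e \<omega>)"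
      unfolding a_def b_def by (simp_all add: dim_rules)
    ultimately show ?thesis
      by (simp add: qPe xNe algebra_simps)
  qed

  have x1_index: "x1 \<omega> $ i = (\<Sum>l<n. sysA F $$ (i, l) * stationary_state (cascade F G) 0 \<omega> $ l) + (\<Sum>j<m. sysB F $$ (i, j) * w \<omega> $ j)"
    if "i < n" for i \<omega>
    using that by (simp add: x1_def mult_vec_index x_def del: index_mult_mat_vec)
  have x1_next: "AE \<omega> in noise_space. \<forall>i<n. x1 \<omega> $ i = stationary_state (cascade F G) 1 \<omega> $ i"
    using cascade_state_recursion[OF F G]
  proof eventually_elim
    case (elim \<omega>)
    then show ?case using elim[rule_format, of _ 0] by (simp add: x1_index w_def)
  qed
  have x1_sq: "square_integrable (\<lambda>\<omega>. x1 \<omega> $ i)" if "i < n" for i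
    using that sq(1,2) unfolding x1_index[OF that]
    by (intro square_integrable_add square_integrable_sum square_integrable_cmult
        stationary_state_square_integrable[OF FG]) auto
  have x1_cov: "?E (\<lambda>\<omega>. x1 \<omega> $ i * x1 \<omega> $ j) = ?E (\<lambda>\<omega>. x \<omega> $ i * x \<omega> $ j)" if ij: "i < n" "j < n" for i j
  proof -
    have "?E (\<lambda>\<omega>. x1 \<omega> $ i * x1 \<omega> $ j) = ?E (\<lambda>\<omega>. stationary_state (cascade F G) 1 \<omega> $ i * stationary_state (cascade F G) 1 \<omega> $ j)"
    proof (rule integral_cong_AE)
      show "(\<lambda>\<omega>. x1 \<omega> $ i * x1 \<omega> $ j) \<in> borel_measurable noise_space"
        using square_integrable_mult[OF x1_sq x1_sq] ij by auto
      show "(\<lambda>\<omega>. stationary_state (cascade F G) 1 \<omega> $ i * stationary_state (cascade F G) 1 \<omega> $ j) \<in> borel_measurable noise_space"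
        using ij by (intro borel_measurable_times stationary_state_measurable[OF FG(1)]) auto
      show "AE \<omega> in noise_space. x1 \<omega> $ i * x1 \<omega> $ j = stationary_state (cascade F G) 1 \<omega> $ i * stationary_state (cascade F G) 1 \<omega> $ j"
        using x1_next by eventually_elim (simp add: ij)
    qed
    also have "\<dots> = ?E (\<lambda>\<omega>. x \<omega> $ i * x \<omega> $ j)"
      using stationary_state_covariance_shift[OF FG, of i j 1 0] ij by (simp add: x_def)
    finally show ?thesis .
  qed
  have "z \<omega> = stationary_output (cascade F G) 0 \<omega>" for \<omega>
  proof (rule eq_vecI)
    show "dim_vec (z \<omega>) = dim_vec (stationary_output (cascade F G) 0 \<omega>)"
      using is_lti_dims[OF FG(1)] by (simp add: stationary_output_def)
    fix i assume "i < dim_vec (stationary_output (cascade F G) 0 \<omega>)"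
    then have "i < p" using is_lti_dims[OF FG(1)] by (simp add: stationary_output_def)
    then show "z \<omega> $ i = stationary_output (cascade F G) 0 \<omega> $ i"
      by (simp add: cascade_output[OF F G] z_def mult_vec_index x_def w_def[symmetric] del: index_mult_mat_vec)
  qed
  then have z: "(h2_norm (cascade F G))\<^sup>2 = ?E (\<lambda>\<omega>. z \<omega> \<bullet> z \<omega>)" "integrable noise_space (\<lambda>\<omega>. z \<omega> \<bullet> z \<omega>)"
    using h2_norm_square[OF FG] by simp_all
  have w: "(h2_norm G)\<^sup>2 = ?E (\<lambda>\<omega>. w \<omega> \<bullet> w \<omega>)" "integrable noise_space (\<lambda>\<omega>. w \<omega> \<bullet> w \<omega>)"
    using h2_norm_square[OF G] by (simp_all add: w_def)
  note bx = integral_bilinear_form[where u = x and v = x, OF X(1) dims(1) sq(1) dims(1) sq(1)]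
  note bx1 = integral_bilinear_form[where u = x1 and v = x1, OF X(1) dims(5) x1_sq dims(5) x1_sq]
  note be = integral_bilinear_form[where u = e and v = e, OF Phic dims(3) sq(3) dims(3) sq(3)]
  note bq = integral_bilinear_form[where u = q and v = e, OF Phic dims(4) sq(4) dims(3) sq(3)]
  note bN = integral_bilinear_form[where u = x and v = e, OF Nc dims(1) sq(1) dims(3) sq(3)]
  have "?E (\<lambda>\<omega>. e \<omega> \<bullet> (Phi *\<^sub>v e \<omega>) + 2 * (q \<omega> \<bullet> (Phi *\<^sub>v e \<omega>)) - 2 * (x \<omega> \<bullet> (N *\<^sub>v e \<omega>)))
      \<le> ?E (\<lambda>\<omega>. x \<omega> \<bullet> (X *\<^sub>v x \<omega>) + s * (w \<omega> \<bullet> w \<omega>) - x1 \<omega> \<bullet> (X *\<^sub>v x1 \<omega>) - z \<omega> \<bullet> z \<omega>)"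
    using bx(1) bx1(1) be(1) bq(1) bN(1) z(2) w(2)
    by (intro integral_mono expand) simp_all
  also have "\<dots> = ?E (\<lambda>\<omega>. x \<omega> \<bullet> (X *\<^sub>v x \<omega>)) + s * (h2_norm G)\<^sup>2 - ?E (\<lambda>\<omega>. x1 \<omega> \<bullet> (X *\<^sub>v x1 \<omega>)) - (h2_norm (cascade F G))\<^sup>2"
    using bx(1) bx1(1) z(2) w(2) unfolding z(1) w(1) by simp
  also have "?E (\<lambda>\<omega>. x1 \<omega> \<bullet> (X *\<^sub>v x1 \<omega>)) = ?E (\<lambda>\<omega>. x \<omega> \<bullet> (X *\<^sub>v x \<omega>))"
    by (simp add: bx(2) bx1(2) x1_cov)
  also have "?E (\<lambda>\<omega>. e \<omega> \<bullet> (Phi *\<^sub>v e \<omega>) + 2 * (q \<omega> \<bullet> (Phi *\<^sub>v e \<omega>)) - 2 * (x \<omega> \<bullet> (N *\<^sub>v e \<omega>)))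
      = ?E (\<lambda>\<omega>. e \<omega> \<bullet> (Phi *\<^sub>v e \<omega>)) + 2 * ?E (\<lambda>\<omega>. q \<omega> \<bullet> (Phi *\<^sub>v e \<omega>)) - 2 * ?E (\<lambda>\<omega>. x \<omega> \<bullet> (N *\<^sub>v e \<omega>))"
    using be(1) bq(1) bN(1) by simp
  also have "?E (\<lambda>\<omega>. q \<omega> \<bullet> (Phi *\<^sub>v e \<omega>)) = 0" by (simp add: bq(2) orth_q)
  also have "?E (\<lambda>\<omega>. x \<omega> \<bullet> (N *\<^sub>v e \<omega>)) = 0" by (simp add: bN(2) orth_x)
  also have "?E (\<lambda>\<omega>. e \<omega> \<bullet> (Phi *\<^sub>v e \<omega>)) = (\<Sum>i<m. \<Sum>j<m. Phi $$ (i, j) * second_moment m (prediction_error G) $$ (i, j))"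
    by (simp add: be(2) second_moment_def flip: e_def)
  finally show ?thesis by simp
qed

text \<open>Bounded mean anisotropy is a lower bound for the determinant of the prediction error covariance in
terms of the total variance \<open>\<tau>\<close> of the filter output, and the trace inequality turns it into a lower
bound for the weighted trace of that covariance.\<close>

lemma mean_anisotropy_bound:
  assumes m: "0 < m" and G: "is_lti nf m m G" "stable_system G" and a: "mean_anisotropy G \<le> ereal a"
    and Phi: "Phi \<in> carrier_mat m m" "pos_definite Phi"
  shows "0 < h2_norm G"
    and "(h2_norm G)\<^sup>2 * (Determinant.det Phi powr (1 / real m) * exp (- 2 * a / real m))
      \<le> (\<Sum>i<m. \<Sum>j<m. Phi $$ (i, j) * second_moment m (prediction_error G) $$ (i, j))"
proof -
  note [simp] = is_lti_dims[OF G(1)]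
  define \<tau> where "\<tau> = (h2_norm G)\<^sup>2"
  define S where "S = second_moment m (prediction_error G)"
  define d where "d = Determinant.det ((real m / \<tau>) \<cdot>\<^sub>m S)"
  have Sc: "S \<in> carrier_mat m m" unfolding S_def by (rule second_moment_carrier)
  have d: "d = (real m / \<tau>) ^ m * Determinant.det S"
    using Sc by (simp add: d_def det_smult)
  have ma: "mean_anisotropy G = (if d > 0 then ereal (- (1 / 2) * ln d) else \<infinity>)"
    by (simp add: mean_anisotropy_def Let_def d_def S_def \<tau>_def h2_norm_square(3)[OF G])
  have d0: "0 < d" using a unfolding ma by (auto split: if_splits)
  have "- (1 / 2) * ln d \<le> a" using a d0 unfolding ma by simp
  then have "exp (- 2 * a) \<le> exp (ln d)" by simp
  then have da: "exp (- 2 * a) \<le> d" using d0 by simp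
  \<comment> \<open>If \<open>\<tau>\<close> were 0, division by zero would turn the normalised covariance into the zero matrix.\<close>
  have "\<tau> \<noteq> 0" using d0 m unfolding d by (auto simp: power_0_left)
  then have \<tau>: "0 < \<tau>" by (simp add: \<tau>_def)
  then have "h2_norm G \<noteq> 0" by (auto simp: \<tau>_def)
  moreover have "0 \<le> h2_norm G"
    unfolding h2_norm_stationary[OF G] by (intro real_sqrt_ge_zero sum_nonneg integral_nonneg_AE AE_I2) simp
  ultimately show "0 < h2_norm G" by simp
  have detS: "Determinant.det S = d * (\<tau> / real m) ^ m"
    using \<tau> m by (simp add: d power_divide)
  have "pos_definite S"
  proof (rule pos_definite_of_nonneg[OF Sc])
    show "transpose_mat S = S"
      by (rule eq_matI) (auto simp: S_def second_moment_def mult.commute)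
    show "Determinant.det S \<noteq> 0" using d0 \<tau> m by (simp add: detS)
    show "0 \<le> x \<bullet> (S *\<^sub>v x)" if "x \<in> carrier_vec m" for x
      unfolding S_def using that prediction_error_square_integrable[OF G]
      by (intro second_moment_nonneg) (simp_all add: prediction_error_def)
  qed
  have detPhi: "0 < Determinant.det Phi" by (rule hadamard_inequality(2)[OF Phi])
  have "\<tau> * (Determinant.det Phi powr (1 / real m) * exp (- 2 * a / real m))
      = \<tau> * (Determinant.det Phi powr (1 / real m) * exp (- 2 * a) powr (1 / real m))"
    by (simp add: powr_def)
  also have "\<dots> \<le> \<tau> * (Determinant.det Phi powr (1 / real m) * d powr (1 / real m))"
    using da \<tau> m by (intro mult_left_mono powr_mono2) simp_all
  also have "\<dots> = real m * (Determinant.det Phi powr (1 / real m) * (d powr (1 / real m) * ((\<tau> / real m) ^ m) powr (1 / real m)))"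
  proof -
    have "((\<tau> / real m) ^ m) powr (1 / real m) = \<tau> / real m"
      using \<tau> m by (simp add: powr_powr flip: powr_realpow)
    then show ?thesis using m by simp
  qed
  also have "\<dots> = real m * (Determinant.det Phi * Determinant.det S) powr (1 / real m)"
    using detPhi d0 \<tau> by (simp add: detS powr_mult)
  also have "\<dots> \<le> (\<Sum>i<m. \<Sum>j<m. Phi $$ (i, j) * S $$ (i, j))"
    by (rule trace_mult_ge_det[OF m Phi Sc \<open>pos_definite S\<close>])
  finally show "(h2_norm G)\<^sup>2 * (Determinant.det Phi powr (1 / real m) * exp (- 2 * a / real m))
      \<le> (\<Sum>i<m. \<Sum>j<m. Phi $$ (i, j) * second_moment m (prediction_error G) $$ (i, j))"
    by (simp add: \<tau>_def S_def)
qed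

text \<open>The strict dissipation inequality is needed at \<open>w = 0\<close> for stability and at \<open>x = 0\<close> for positive
definiteness of \<open>Phi\<close>. The resulting bound \<open>b\<close> for the squared gain does not depend on the filter,
so it passes to the supremum.\<close>

theorem anisotropic_bounded_real:
  assumes m: "0 < m" and F: "is_lti n m p F"
    and X: "X \<in> carrier_mat n n" "pos_definite X"
    and Phi: "Phi = s \<cdot>\<^sub>m 1\<^sub>m m - transpose_mat (sysB F) * X * sysB F - transpose_mat (sysD F) * sysD F"
    and dissipative: "\<And>x w. x \<in> carrier_vec n \<Longrightarrow> w \<in> carrier_vec m \<Longrightarrow> x \<noteq> 0\<^sub>v n \<or> w \<noteq> 0\<^sub>v m \<Longrightarrow>
      (sysA F *\<^sub>v x + sysB F *\<^sub>v w) \<bullet> (X *\<^sub>v (sysA F *\<^sub>v x + sysB F *\<^sub>v w))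
        + (sysC F *\<^sub>v x + sysD F *\<^sub>v w) \<bullet> (sysC F *\<^sub>v x + sysD F *\<^sub>v w)
      < x \<bullet> (X *\<^sub>v x) + s * (w \<bullet> w)"
    and \<gamma>: "0 < \<gamma>" and bound: "s - Determinant.det Phi powr (1 / real m) * exp (- 2 * a / real m) < \<gamma>\<^sup>2"
  shows "stable_system F" and "anisotropic_norm a F < ereal \<gamma>"
proof -
  note [simp] = is_lti_dims[OF F] X(1)[simplified]
  have Xt: "transpose_mat X = X" using X by (simp add: pos_definite_iff)
  have zero: "M *\<^sub>v 0\<^sub>v k = 0\<^sub>v (dim_row M)" if "dim_col M = k" for M :: "real mat" and k
    using that by (rule mult_zero_vec)
  show st: "stable_system F"
    unfolding stable_system_def
  proof (intro allI impI)
    fix ev assume ev: "eigenvalue (map_mat complex_of_real (sysA F)) ev"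
    show "cmod ev < 1"
    proof (rule lyapunov_stable[OF _ X _ ev])
      show "sysA F \<in> carrier_mat n n" by simp
      fix x :: "real vec" assume x: "x \<in> carrier_vec n" "x \<noteq> 0\<^sub>v n"
      have r: "sysA F *\<^sub>v x + 0\<^sub>v n = sysA F *\<^sub>v x" by (rule eq_vecI) simp_all
      show "(sysA F *\<^sub>v x) \<bullet> (X *\<^sub>v (sysA F *\<^sub>v x)) < x \<bullet> (X *\<^sub>v x)"
        using dissipative[of x "0\<^sub>v m"] x
          scalar_prod_self_pos(1)[of "sysC F *\<^sub>v x + sysD F *\<^sub>v 0\<^sub>v m" p]
        by (simp add: zero r scalar_prod_zero_left)
    qed
  qed
  have Phic: "Phi \<in> carrier_mat m m" by (simp add: Phi)
  have adj: "u \<bullet> (transpose_mat M *\<^sub>v v) = (M *\<^sub>v u) \<bullet> v" if "dim_vec u = dim_col M" "dim_vec v = dim_row M"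
    for M :: "real mat" and u v
    using that scalar_prod_transpose[of v M u] by (simp add: scalar_prod_commute)
  have Phipos: "pos_definite Phi"
    unfolding pos_definite_iff[OF Phic]
  proof (intro conjI ballI impI)
    show "transpose_mat Phi = Phi"
      unfolding Phi using Xt by (simp add: transpose_minus transpose_smult_real transpose_mult_dim mult_assoc_dim)
    fix w :: "real vec" assume w: "w \<in> carrier_vec m" "w \<noteq> 0\<^sub>v m"
    have l: "0\<^sub>v k + v = v" if "dim_vec v = k" for v :: "real vec" and k
      using that by (intro eq_vecI) simp_all
    show "0 < w \<bullet> (Phi *\<^sub>v w)"
      using dissipative[of "0\<^sub>v n" w] w unfolding Phi
      by (simp add: dim_rules adj l)
  qed
  define b where "b = s - Determinant.det Phi powr (1 / real m) * exp (- 2 * a / real m)"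
  have ratio: "h2_norm (cascade F G) / h2_norm G \<le> sqrt b" if G: "G \<in> shaping_filters m a" for G
  proof -
    obtain nf where nf: "is_lti nf m m G" "stable_system G" "mean_anisotropy G \<le> ereal a"
      using G by (auto simp: shaping_filters_def)
    note ma = mean_anisotropy_bound[OF m nf Phic Phipos]
    have "(h2_norm (cascade F G))\<^sup>2 \<le> s * (h2_norm G)\<^sup>2
       - (\<Sum>i<m. \<Sum>j<m. Phi $$ (i, j) * second_moment m (prediction_error G) $$ (i, j))"
    proof (rule cascade_h2_bound[OF F st nf(1,2) X(1) Xt Phi])
      fix x w :: "real vec" assume xw: "x \<in> carrier_vec n" "w \<in> carrier_vec m"
      show "(sysA F *\<^sub>v x + sysB F *\<^sub>v w) \<bullet> (X *\<^sub>v (sysA F *\<^sub>v x + sysB F *\<^sub>v w))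
        + (sysC F *\<^sub>v x + sysD F *\<^sub>v w) \<bullet> (sysC F *\<^sub>v x + sysD F *\<^sub>v w)
        \<le> x \<bullet> (X *\<^sub>v x) + s * (w \<bullet> w)"
      proof (cases "x \<noteq> 0\<^sub>v n \<or> w \<noteq> 0\<^sub>v m")
        case True
        then show ?thesis using dissipative[OF xw] by simp
      next
        case False
        then show ?thesis by (simp add: dim_rules)
      qed
    qed
    also have "\<dots> \<le> b * (h2_norm G)\<^sup>2"
      using ma(2) by (simp add: b_def algebra_simps)
    finally have "(h2_norm (cascade F G) / h2_norm G)\<^sup>2 \<le> b"
      using ma(1) by (simp add: power_divide divide_le_eq)
    then show ?thesis by (rule real_le_rsqrt)
  qed
  have "anisotropic_norm a F \<le> ereal (sqrt b)"
    unfolding anisotropic_norm_def using ratio by (intro SUP_least) simp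
  also have "sqrt b < \<gamma>"
    using bound \<gamma> real_sqrt_less_mono[of b "\<gamma>\<^sup>2"] by (simp add: b_def)
  finally show "anisotropic_norm a F < ereal \<gamma>" by simp
qed

theorem theorem5:
  fixes n m nu nz ny :: nat
    and a \<gamma> \<eta> :: real
    and A B1 B2 C1 C2 D11 D12 V W X Y \<Phi>X \<Phi>Y :: "real mat"
  assumes dims: "0 < n" "0 < m" "0 < nu" "0 < nz" "0 < ny"
    and a: "0 \<le> a"
    and \<gamma>: "0 < \<gamma>"
    and A: "A \<in> carrier_mat n n"
    and B1: "B1 \<in> carrier_mat n m"
    and B2: "B2 \<in> carrier_mat n nu"
    and C1: "C1 \<in> carrier_mat nz n"
    and C2: "C2 \<in> carrier_mat ny n"
    and D11: "D11 \<in> carrier_mat nz m"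
    and D12: "D12 \<in> carrier_mat nz nu"
    and W: "null_space_basis_mat (transpose_mat B2 @\<^sub>c transpose_mat D12) W"
    and V: "null_space_basis_mat (C2 @\<^sub>c 0\<^sub>m ny m) V"
    and X: "X \<in> carrier_mat n n" "pos_definite X"
    and Y: "Y \<in> carrier_mat n n" "pos_definite Y"
    and \<Phi>X: "\<Phi>X = \<eta>\<^sup>2 \<cdot>\<^sub>m 1\<^sub>m m - transpose_mat B1 * X * B1 - transpose_mat D11 * D11"
    and \<Phi>Y: "\<Phi>Y = \<eta>\<^sup>2 \<cdot>\<^sub>m 1\<^sub>m nz - C1 * Y * transpose_mat C1 - D11 * transpose_mat D11"
    and LMI_V: "neg_definite (transpose_mat V *
          four_block_mat
            (- X + transpose_mat A * X * A + transpose_mat C1 * C1)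
            (transpose_mat A * X * B1 + transpose_mat C1 * D11)
            (transpose_mat B1 * X * A + transpose_mat D11 * C1)
            (- \<Phi>X) * V)"
    and LMI_W: "neg_definite (transpose_mat W *
          four_block_mat
            (- Y + A * Y * transpose_mat A + B1 * transpose_mat B1)
            (A * Y * transpose_mat C1 + B1 * transpose_mat D11)
            (C1 * Y * transpose_mat A + D11 * transpose_mat B1)
            (- \<Phi>Y) * W)"
    and det_bound: "\<eta>\<^sup>2 - Determinant.det \<Phi>X powr (1 / real m) * exp (- 2 * a / real m) < \<gamma>\<^sup>2"
    and coupling: "X * Y = \<eta>\<^sup>2 \<cdot>\<^sub>m 1\<^sub>m n"
  shows "\<exists>K \<in> carrier_mat nu ny.
           stable_system (closed_loop A B1 B2 C1 C2 D11 D12 K) \<and>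
           anisotropic_norm a (closed_loop A B1 B2 C1 C2 D11 D12 K) < ereal \<gamma>"
proof -
  obtain K where K: "K \<in> carrier_mat nu ny"
    and dissipative: "\<And>x w. x \<in> carrier_vec n \<Longrightarrow> w \<in> carrier_vec m \<Longrightarrow> x \<noteq> 0\<^sub>v n \<or> w \<noteq> 0\<^sub>v m \<Longrightarrow>
      ((A + B2 * K * C2) *\<^sub>v x + B1 *\<^sub>v w) \<bullet> (X *\<^sub>v ((A + B2 * K * C2) *\<^sub>v x + B1 *\<^sub>v w))
       + ((C1 + D12 * K * C2) *\<^sub>v x + D11 *\<^sub>v w) \<bullet> ((C1 + D12 * K * C2) *\<^sub>v x + D11 *\<^sub>v w)
      < x \<bullet> (X *\<^sub>v x) + \<eta>\<^sup>2 * (w \<bullet> w)"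
    using static_output_feedback_exists[OF dims(1) A B1 B2 C1 C2 D11 D12 W V X Y
        LMI_V[unfolded \<Phi>X] LMI_W[unfolded \<Phi>Y] coupling] by blast
  define F where "F = closed_loop A B1 B2 C1 C2 D11 D12 K"
  have sys: "sysA F = A + B2 * K * C2" "sysB F = B1" "sysC F = C1 + D12 * K * C2" "sysD F = D11"
    by (simp_all add: F_def closed_loop_def)
  have "is_lti n m nz F"
    unfolding is_lti_def sys using A B1 B2 C1 C2 D11 D12 K by simp
  from anisotropic_bounded_real[OF dims(2) this X _ _ \<gamma> det_bound, unfolded sys, OF \<Phi>X dissipative]
  have "stable_system F" "anisotropic_norm a F < ereal \<gamma>" by simp_all
  then show ?thesis using K unfolding F_def by blast
qed

end
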